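(* Let $\nu\ge2$. There exist $\delta_0=\delta_0(\nu)\in(0,1)$ and $C=C(\nu)>0$ such that the following holds. Let $\epsilon\in\left(0,\frac{2}{2+\nu}\right)$, $0<\delta\le\delta_0$, and let $N=2^n$ ($n\in\mathbb N$) be such that $\delta^\epsilon N=2^m$ for some integer $0\le m\le n$ (so that $\delta^{-\epsilon}\in\mathbb N$). Let $P\in\mathcal D_N$ satisfy $\|P-\mathrm{Id}\|_2\le\delta^{1-\frac\epsilon2}$ and $|P(\kappa)-\kappa|\le\delta^\epsilon$ for all $\kappa\in\mathcal R_N$. Then there exists a permutation $\tilde P\in\mathcal D_N$ which is constant on the tiling $\mathcal R_{\delta^{-\epsilon}}$ (whose cubes have side $\delta^\epsilon$), and a discrete flow connecting $P$ to $\tilde P$ of length at most $$C\max\left\{\delta^{\frac12-\frac{3\epsilon}{4}},\ \delta^{\frac16+\frac{7\epsilon}{12}}\right\}.$$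
   Context: For $N\in\mathbb N$, $\mathcal R_N$ is the tiling of $[0,1]^\nu$ by $N^\nu$ closed axis-parallel cubes of side $N^{-1}$; $c(\kappa)$ is the center of a cube $\kappa\in\mathcal R_N$. $\mathcal D_N$ is the group of permutations of $\mathcal R_N$: measure-preserving maps $P:[0,1]^\nu\to[0,1]^\nu$ (up to null sets) which send each cube of $\mathcal R_N$ onto a cube of $\mathcal R_N$ bijectively, by translation: $P(x)=x+c(P(\kappa))-c(\kappa)$ for $x\in\mathrm{int}(\kappa)$. $|P(\kappa)-\kappa|$ denotes $|c(P(\kappa))-c(\kappa)|$ (Euclidean norm). $\|P-Q\|_2$ is the norm of $P-Q$ in $L^2([0,1]^\nu;\mathbb R^\nu)$. A permutation $\tilde P\in\mathcal D_N$ is constant on the coarser tiling $\mathcal R_{\delta^{-\epsilon}}$ if for every $K\in\mathcal R_{\delta^{-\epsilon}}$ and every $\kappa\in\mathcal R_N$ with $\kappa\subset K$ one has $\tilde P(\kappa)\subset K$. A rectangle is a set $\prod_{i=1}^\nu[h_i/N,\tilde h_i/N]$ with integers $0\le h_i<\tilde h_i\le N$; an array $A$ is a rectangle which has side $1/N$ in all coordinate directions but one; its length $\ell(A)$ is the number of cubes of $\mathcal R_N$ it contains, and we write $A=[\kappa_1,\dots,\kappa_{\ell(A)}]$ for its consecutive cubes. Sets are called disjoint if their interiors are disjoint. A sequence of $h$ swapping couples in an array $A=[\kappa_1,\dots,\kappa_{\ell(A)}]$ is given by indices $p_1<p_2<\dots<p_{2h}$, $2h\le\ell(A)$; its couples are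 $(\kappa_{p_j},\kappa_{p_{2h-j+1}})$, $j=1,\dots,h$ (nested couples). An elementary movement $Z:[0,1]^\nu\to[0,1]^\nu$ is given by pairwise disjoint arrays $A_1,\dots,A_m$ and, for each $i$, a sequence of $h(i)$ swapping couples in $A_i$: $Z$ exchanges by translation the two cubes of each couple, and is the identity elsewhere. Its cost is $L(Z)=\max_i\ell(A_i)\,N^{-1-\frac\nu2}\sqrt{\sum_{i=1}^m h(i)}$ (computed from the given arrays and couples). A discrete flow is a finite sequence $\{Z_k\}_{k=1}^T$ of elementary movements; its length is $\sum_{k=1}^T L(Z_k)$; it connects $P$ to $\tilde P$ if $Z_T\circ\cdots\circ Z_1\circ P=\tilde P$. *)

theory Defs
  imports "HOL-Analysis.Analysis"
begin

section \<open>The unit cube and its tilings\<close>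

text \<open>The dimension \<open>\<nu>\<close> is \<open>CARD('n)\<close>. Maps of the unit cube are represented by functions on the
  whole of \<open>real^'n\<close> whose values outside the unit cube are irrelevant.\<close>

definition unit_cube :: "(real^'n) set" where
  "unit_cube = cbox 0 1"

definition grid_box :: "nat \<Rightarrow> ('n \<Rightarrow> nat) \<Rightarrow> ('n \<Rightarrow> nat) \<Rightarrow> (real^'n) set" where
  "grid_box N h h' = cbox (\<chi> i. real (h i) / real N) (\<chi> i. real (h' i) / real N)"

definition tiling :: "nat \<Rightarrow> (real^'n) set set" where
  "tiling N = {grid_box N h (\<lambda>i. h i + 1) | h. \<forall>i. h i < N}"

definition center :: "(real^'n) set \<Rightarrow> real^'n" where
  "center \<kappa> = midpoint (interval_lowerbound \<kappa>) (interval_upperbound \<kappa>)"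

lemma center_grid_box:
  fixes h h' :: "'n::finite \<Rightarrow> nat"
  assumes "\<And>i. h i \<le> h' i"
  shows "center (grid_box N h h') = (\<chi> i. (real (h i) + real (h' i)) / (2 * real N))"
proof -
  have box_ne: "grid_box N h h' \<noteq> {}"
    using assms by (auto simp: grid_box_def interval_ne_empty_cart divide_right_mono)
  show ?thesis
    using box_ne unfolding center_def grid_box_def
    by (simp add: midpoint_def vec_eq_iff add_divide_distrib mult.commute)
qed

section \<open>Permutations of the tiling\<close>

definition measure_preserving_cube :: "((real^'n) \<Rightarrow> (real^'n)) \<Rightarrow> bool" where
  "measure_preserving_cube P \<longleftrightarrow>
     P \<in> lebesgue_on unit_cube \<rightarrow>\<^sub>M lebesgue_on unit_cube \<and>
     distr (lebesgue_on unit_cube) (lebesgue_on unit_cube) P = lebesgue_on unit_cube"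

text \<open>The cube \<open>P(\<kappa>)\<close>. As \<open>P\<close> is only prescribed up to null sets, its values on the boundary of
  \<open>\<kappa>\<close> must not matter.\<close>

definition cube_image :: "((real^'n) \<Rightarrow> (real^'n)) \<Rightarrow> (real^'n) set \<Rightarrow> (real^'n) set" where
  "cube_image P \<kappa> = closure (P ` interior \<kappa>)"

definition permutations_of_tiling :: "nat \<Rightarrow> ((real^'n) \<Rightarrow> (real^'n)) set" where
  "permutations_of_tiling N = {P. measure_preserving_cube P \<and>
     bij_betw (cube_image P) (tiling N) (tiling N) \<and>
     (\<forall>\<kappa>\<in>tiling N. \<forall>x\<in>interior \<kappa>. P x = x + center (cube_image P \<kappa>) - center \<kappa>)}"

definition displacement :: "((real^'n) \<Rightarrow> (real^'n)) \<Rightarrow> (real^'n) set \<Rightarrow> real" where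
  "displacement P \<kappa> = norm (center (cube_image P \<kappa>) - center \<kappa>)"

definition L2_norm_cube :: "((real^'n) \<Rightarrow> (real^'n)) \<Rightarrow> real" where
  "L2_norm_cube f = sqrt (LINT x|lebesgue_on unit_cube. (norm (f x))\<^sup>2)"

definition constant_on_tiling :: "nat \<Rightarrow> nat \<Rightarrow> ((real^'n) \<Rightarrow> (real^'n)) \<Rightarrow> bool" where
  "constant_on_tiling N M P \<longleftrightarrow>
     (\<forall>K\<in>tiling M. \<forall>\<kappa>\<in>tiling N. \<kappa> \<subseteq> K \<longrightarrow> cube_image P \<kappa> \<subseteq> K)"

section \<open>Arrays, swapping couples and elementary movements\<close>

definition is_array :: "nat \<Rightarrow> (real^'n) set \<Rightarrow> bool" where
  "is_array N A \<longleftrightarrow> (\<exists>h h' d. (\<forall>i. h i < h' i \<and> h' i \<le> N) \<and>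
     (\<forall>i. i \<noteq> d \<longrightarrow> h' i = h i + 1) \<and> A = grid_box N h h')"

text \<open>An array is given by the list of its consecutive cubes. The centers of these cubes differ in
  one coordinate only, so the componentwise order on \<open>real^'n\<close> orders them along the array.\<close>

definition array_cubes :: "nat \<Rightarrow> (real^'n) set list \<Rightarrow> bool" where
  "array_cubes N \<kappa>s \<longleftrightarrow> (\<exists>A. is_array N A \<and> set \<kappa>s = {\<kappa> \<in> tiling N. \<kappa> \<subseteq> A} \<and>
     distinct \<kappa>s \<and> sorted_wrt (\<lambda>\<kappa> \<kappa>'. center \<kappa> \<le> center \<kappa>') \<kappa>s)"

text \<open>The indices \<open>p\<^sub>1 < \<dots> < p\<^bsub>2h\<^esub>\<close> form the list \<open>ps\<close>. Positions in \<open>\<kappa>s\<close> and \<open>ps\<close> are counted from \<open>0\<close>,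
  so the cube \<open>\<kappa>\<^sub>p\<close> is \<open>\<kappa>s ! (p - 1)\<close>, and the couples pair the entries \<open>j\<close> and \<open>2h - 1 - j\<close> of \<open>ps\<close>
  for \<open>j = 0, \<dots>, h - 1\<close>.\<close>

definition swapping_indices :: "(real^'n) set list \<Rightarrow> nat list \<Rightarrow> bool" where
  "swapping_indices \<kappa>s ps \<longleftrightarrow>
     even (length ps) \<and> sorted_wrt (<) ps \<and> (\<forall>p\<in>set ps. p < length \<kappa>s)"

definition num_couples :: "nat list \<Rightarrow> nat" where
  "num_couples ps = length ps div 2"

definition swapping_couples ::
    "(real^'n) set list \<Rightarrow> nat list \<Rightarrow> ((real^'n) set \<times> (real^'n) set) set" where
  "swapping_couples \<kappa>s ps =
     {(\<kappa>s ! (ps ! j), \<kappa>s ! (ps ! (length ps - 1 - j))) | j. j < num_couples ps}"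

type_synonym 'n movement_data = "((real^'n) set list \<times> nat list) list"

definition valid_movement_data :: "nat \<Rightarrow> 'n::finite movement_data \<Rightarrow> bool" where
  "valid_movement_data N D \<longleftrightarrow>
     (\<forall>(\<kappa>s, ps)\<in>set D. array_cubes N \<kappa>s \<and> swapping_indices \<kappa>s ps) \<and>
     sorted_wrt (\<lambda>(\<kappa>s, _) (\<kappa>s', _). interior (\<Union>(set \<kappa>s)) \<inter> interior (\<Union>(set \<kappa>s')) = {}) D"

definition movement_couples :: "'n::finite movement_data \<Rightarrow> ((real^'n) set \<times> (real^'n) set) set" where
  "movement_couples D = (\<Union>(\<kappa>s, ps)\<in>set D. swapping_couples \<kappa>s ps)"

text \<open>On the boundaries of the exchanged cubes, a null set, the values of \<open>Z\<close> are arbitrary.\<close>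

definition elementary_movement ::
    "nat \<Rightarrow> 'n::finite movement_data \<Rightarrow> ((real^'n) \<Rightarrow> (real^'n)) \<Rightarrow> bool" where
  "elementary_movement N D Z \<longleftrightarrow> valid_movement_data N D \<and> Z \<in> unit_cube \<rightarrow> unit_cube \<and>
     (\<forall>(\<kappa>, \<kappa>')\<in>movement_couples D.
        (\<forall>x\<in>interior \<kappa>. Z x = x + center \<kappa>' - center \<kappa>) \<and>
        (\<forall>x\<in>interior \<kappa>'. Z x = x + center \<kappa> - center \<kappa>')) \<and>
     (\<forall>x\<in>unit_cube - (\<Union>(\<kappa>, \<kappa>')\<in>movement_couples D. \<kappa> \<union> \<kappa>'). Z x = x)"

text \<open>The value \<open>0\<close> is inserted so that the maximum is also meaningful when there are no arrays.\<close>

definition movement_cost :: "nat \<Rightarrow> 'n::finite movement_data \<Rightarrow> real" where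
  "movement_cost N D =
     real (Max (insert 0 ((\<lambda>(\<kappa>s, ps). length \<kappa>s) ` set D))) *
     real N powr (- 1 - real CARD('n) / 2) *
     sqrt (\<Sum>(\<kappa>s, ps)\<leftarrow>D. real (num_couples ps))"

section \<open>Discrete flows\<close>

text \<open>A flow is the list of its movements \<open>Z\<^sub>1, \<dots>, Z\<^sub>T\<close>, each with the arrays and couples that
  define it, because the cost depends on these and not only on the map.\<close>

type_synonym 'n flow = "('n movement_data \<times> ((real^'n) \<Rightarrow> (real^'n))) list"

definition discrete_flow :: "nat \<Rightarrow> 'n::finite flow \<Rightarrow> bool" where
  "discrete_flow N F \<longleftrightarrow> (\<forall>(D, Z)\<in>set F. elementary_movement N D Z)"

definition flow_length :: "nat \<Rightarrow> 'n::finite flow \<Rightarrow> real" where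
  "flow_length N F = (\<Sum>(D, Z)\<leftarrow>F. movement_cost N D)"

definition flow_connects ::
    "'n::finite flow \<Rightarrow> ((real^'n) \<Rightarrow> (real^'n)) \<Rightarrow> ((real^'n) \<Rightarrow> (real^'n)) \<Rightarrow> bool" where
  "flow_connects F P Q \<longleftrightarrow>
     (AE x in lebesgue_on unit_cube. fold (\<lambda>(D, Z) y. Z y) F (P x) = Q x)"

end

theory Submission
  imports Defs
begin

text \<open>Reading a permutation of the tiling as a permutation \<open>\<pi>\<close> of \<open>{0..<N}\<^sup>\<nu>\<close>, the key fact is that any
  permutation which moves only \<open>k\<close> cubes and preserves the boxes of side \<open>2\<^sup>p\<close> of a dyadic grid is
  realized by a flow of length at most \<open>C 2\<^sup>p N\<^sup>-\<^sup>1 \<surd>(k N\<^sup>-\<^sup>\<nu>)\<close>. It follows by bisecting the boxes again and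
  again: at each step the cubes which have to change sides are exchanged by mirror images across the
  bisecting hyperplane, after an auxiliary movement has made the two sets of wrong cubes mirror
  images of each other; this auxiliary movement is undone afterwards, so the number of misplaced cubes does
  not grow, and the costs form a geometric series.

  The theorem then needs two permutations. Averaging over the translates of the coarse grid gives a
  translate whose walls are crossed by a volume at most \<open>\<parallel>P - Id\<parallel>\<^sub>1 \<delta>\<^sup>-\<^sup>\<epsilon>\<close>, of order
  \<open>\<delta>\<close> to the power \<open>1 - 3\<epsilon>/2\<close>; moving these cubes back over distances of order \<open>1\<close>
  costs \<open>\<delta>\<close> to the power \<open>1/2 - 3\<epsilon>/4\<close>. Now every translated cell is invariant, so the walls of the
  original grid are dealt with inside these cells, at distance \<open>\<delta>\<^sup>\<epsilon>\<close>. By Chebyshev's inequality with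
  threshold \<open>\<delta>\<close> to the power \<open>2/3\<close>, the volume crossing the original walls is of order \<open>\<delta>\<close> to the power
  \<open>2/3 - \<epsilon>\<close>, which costs \<open>\<delta>\<close> to the power \<open>1/3 + \<epsilon>/2\<close>.\<close>

section \<open>Mirror movements on integer points\<close>

text \<open>A movement costs its greatest array length times the square root of the number of
  couples in all its arrays, so exchanges at one scale have to be made in parallel. Nested couples
  at symmetric positions of an array are pairs of mirror images; hence the basic letter is the
  reflection of blocks of length \<open>2 ^ k\<close>, which complements the \<open>k\<close> lowest
  binary digits of one coordinate, restricted to a symmetric set of points.

  Two sortings are used because walls fixed in advance are only known to be crossed by a volume of
  order \<delta> to the power 2/3 - \<epsilon>. Sorting this volume at once over distances of order
  1 would give \<delta> to the power 1/3 - \<epsilon>/2, worse than the claim for \<epsilon> between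
  2/13 and 1/2. Inside invariant cells one gains the factor \<delta> to the power \<epsilon>, and
  1/3 + \<epsilon>/2 exceeds 1/6 + 7\<epsilon>/12 whenever \<epsilon> < 2.

  Translated cells become dyadic boxes in translated coordinates, but those at the border are not
  contained in the cube. For this reason lattice flows are confined to a region \<open>R\<close>,
  and boxes must lie wholly in it.\<close>

definition mirror :: "nat \<Rightarrow> nat \<Rightarrow> nat" where
  "mirror k v = (v div 2 ^ k) * 2 ^ k + (2 ^ k - 1 - v mod 2 ^ k)"

lemma mirror_div: "mirror k v div 2 ^ k = v div 2 ^ k"
  and mirror_mod: "mirror k v mod 2 ^ k = 2 ^ k - 1 - v mod 2 ^ k"
proof -
  have "2 ^ k - 1 - v mod 2 ^ k < (2::nat) ^ k"
    by (simp add: less_imp_diff_less)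
  then show "mirror k v div 2 ^ k = v div 2 ^ k" "mirror k v mod 2 ^ k = 2 ^ k - 1 - v mod 2 ^ k"
    unfolding mirror_def by simp_all
qed

lemma mirror_mirror [simp]: "mirror k (mirror k v) = v"
proof -
  have "v mod 2 ^ k < (2::nat) ^ k" by simp
  then have "2 ^ k - 1 - (2 ^ k - 1 - v mod 2 ^ k) = v mod 2 ^ k" by arith
  then show ?thesis
    unfolding mirror_def[of k "mirror k v"] by (metis div_mult_mod_eq mirror_div mirror_mod)
qed

lemma div_power_Suc: "v div 2 ^ Suc r = v div 2 ^ r div (2::nat)"
  by (simp only: power_Suc2 div_mult2_eq)

text \<open>Complete blocks of length \<open>2 ^ Suc r\<close> consist of an even number of half
  blocks, so only the position \<open>m\<close> within its block matters, and \<open>m < h\<close>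
  holds for exactly one of two mirror images. Thus a reflection exchanges the two sides of a
  bisection.\<close>

lemma even_mirror: "even (mirror (Suc r) v div 2 ^ r) \<longleftrightarrow> odd (v div 2 ^ r)"
proof -
  define h where "h = (2::nat) ^ r"
  have h: "h > 0" by (simp add: h_def)
  define m where "m = v mod (2 * h)"
  have m: "m < 2 * h" using h by (simp add: m_def)
  have v: "v = (v div (2 * h)) * 2 * h + m"
    by (simp only: m_def mult.assoc div_mult_mod_eq)
  have e: "even ((q * 2 * h + t) div h) \<longleftrightarrow> even (t div h)" for q t :: nat
    using h by simp
  have half: "even (t div h) \<longleftrightarrow> t < h" if "t < 2 * h" for t
  proof (cases "t < h")
    case False
    then have "t div h = 1" using that h
      by (intro div_nat_eqI) auto
    with False show ?thesis by simp
  qed simp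
  have "mirror (Suc r) v = (v div (2 * h)) * 2 * h + (2 * h - 1 - m)"
    by (simp add: mirror_def h_def m_def mult.assoc)
  then have "even (mirror (Suc r) v div h) \<longleftrightarrow> 2 * h - 1 - m < h"
    using half[of "2 * h - 1 - m"] h by (simp only: e)
  also have "\<dots> \<longleftrightarrow> \<not> m < h" using m by arith
  also have "\<dots> \<longleftrightarrow> odd (v div h)"
    by (subst v) (simp only: e half[OF m])
  finally show ?thesis by (simp add: h_def)
qed

definition reflect :: "'n \<Rightarrow> nat \<Rightarrow> ('n \<Rightarrow> nat) \<Rightarrow> 'n \<Rightarrow> nat" where
  "reflect d k z = z(d := mirror k (z d))"

lemma reflect_reflect [simp]: "reflect d k (reflect d k z) = z"
  by (simp add: reflect_def fun_eq_iff)

text \<open>The dyadic block of length \<open>2 ^ k\<close> through \<open>z\<close> in direction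
  \<open>d\<close>. It will be an array of a movement, which is why all of it, and not only its
  swapped points, has to lie in the admissible region.\<close>

definition line :: "'n \<Rightarrow> nat \<Rightarrow> ('n \<Rightarrow> nat) \<Rightarrow> ('n \<Rightarrow> nat) set" where
  "line d k z = {w. w d div 2 ^ k = z d div 2 ^ k \<and> (\<forall>i. i \<noteq> d \<longrightarrow> w i = z i)}"

definition swap_on :: "'n \<Rightarrow> nat \<Rightarrow> ('n \<Rightarrow> nat) set \<Rightarrow> ('n \<Rightarrow> nat) \<Rightarrow> 'n \<Rightarrow> nat" where
  "swap_on d k S z = (if z \<in> S then reflect d k z else z)"

lemma swap_on_swap_on:
  assumes "reflect d k ` S \<subseteq> S"
  shows "swap_on d k S (swap_on d k S z) = z"
  using assms by (auto simp: swap_on_def)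

lemma bij_swap_on:
  assumes "reflect d k ` S \<subseteq> S"
  shows "bij (swap_on d k S)"
  by (rule o_bij[of "swap_on d k S"]) (auto simp: swap_on_swap_on[OF assms])

text \<open>Words in mirror swaps on the unbounded lattice, together with their cost in units of
  \<open>N powr (- 1 - \<nu> / 2)\<close>: the array length is \<open>2 ^ k\<close>, and every point
  of \<open>S\<close> is counted as a couple, although two points form one.\<close>

inductive flowable :: "('n \<Rightarrow> nat) set \<Rightarrow> (('n \<Rightarrow> nat) \<Rightarrow> 'n \<Rightarrow> nat) \<Rightarrow> real \<Rightarrow> bool"
  for R where
  flowable_id: "flowable R id 0"
| flowable_step: "flowable R f c \<Longrightarrow> finite S \<Longrightarrow> reflect d k ` S \<subseteq> S \<Longrightarrow> \<forall>z\<in>S. line d k z \<subseteq> R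
    \<Longrightarrow> flowable R (swap_on d k S \<circ> f) (2 ^ k * sqrt (card S) + c)"

lemma flowable_comp:
  assumes "flowable R g c'" "flowable R f c"
  shows "flowable R (g \<circ> f) (c' + c)"
  using assms
proof induction
  case (flowable_step g c' S d k)
  from flowable.flowable_step[OF flowable_step.IH[OF assms(2)] flowable_step.hyps(2-4)]
  show ?case by (simp only: o_assoc add.assoc)
qed simp

lemma flowable_swap_on:
  assumes "finite S" "reflect d k ` S \<subseteq> S" "\<forall>z\<in>S. line d k z \<subseteq> R"
  shows "flowable R (swap_on d k S) (2 ^ k * sqrt (card S))"
  using flowable_step[OF flowable_id assms] by simp

lemma flowable_bij: "flowable R f c \<Longrightarrow> bij f"
proof (induction rule: flowable.induct)
  case (flowable_step f c S d k)
  show ?case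
    by (rule bij_comp[OF flowable_step.IH bij_swap_on[OF flowable_step.hyps(3)]])
qed (rule bij_id)

text \<open>Each letter is an involution, so the reversed word is the inverse and has the same cost.
  Conjugating by a flow therefore costs that flow twice.\<close>

lemma flowable_inv:
  assumes "flowable R f c"
  shows "flowable R (inv f) c"
  using assms
proof induction
  case (flowable_step f c S d k)
  note b = bij_swap_on[OF flowable_step.hyps(3)]
  have "inv (swap_on d k S) = swap_on d k S"
    using swap_on_swap_on[OF flowable_step.hyps(3)] by (intro inv_unique_comp) auto
  then have "inv (swap_on d k S \<circ> f) = inv f \<circ> swap_on d k S"
    using o_inv_distrib[OF b flowable_bij[OF flowable_step.hyps(1)]] by simp
  then show ?case
    using flowable_comp[OF flowable_step.IH flowable_swap_on[OF flowable_step.hyps(2-4)]]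
    by (metis add.commute)
qed (metis flowable_id inv_id)

section \<open>Dyadic boxes with a separate exponent for each direction\<close>

definition box_index :: "('n \<Rightarrow> nat) \<Rightarrow> ('n \<Rightarrow> nat) \<Rightarrow> 'n \<Rightarrow> nat" where
  "box_index q z = (\<lambda>i. z i div 2 ^ q i)"

definition in_box :: "('n \<Rightarrow> nat) set \<Rightarrow> ('n \<Rightarrow> nat) \<Rightarrow> ('n \<Rightarrow> nat) \<Rightarrow> bool" where
  "in_box R q z \<longleftrightarrow> {w. box_index q w = box_index q z} \<subseteq> R"

lemma finite_box:
  fixes q :: "'n::finite \<Rightarrow> nat"
  shows "finite {w. box_index q w = u}"
proof (rule finite_subset)
  have "w i < (w i div 2 ^ q i + 1) * 2 ^ q i" for w :: "'n \<Rightarrow> nat" and i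
    by (simp add: dividend_less_div_times)
  then show "{w. box_index q w = u} \<subseteq> PiE UNIV (\<lambda>i. {..<(u i + 1) * 2 ^ q i})"
    by (auto simp: box_index_def PiE_def Pi_def)
  show "finite (PiE UNIV (\<lambda>i::'n. {..<(u i + 1) * 2 ^ q i}))"
    by (intro finite_PiE) auto
qed

lemma box_index_refine:
  assumes "q d = Suc r" "box_index (q(d := r)) w = box_index (q(d := r)) z"
  shows "box_index q w = box_index q z"
proof
  fix i
  show "box_index q w i = box_index q z i"
    using fun_cong[OF assms(2), of i] assms(1)
    by (cases "i = d") (auto simp: box_index_def div_power_Suc simp del: power_Suc)
qed

text \<open>Halving side \<open>d\<close> reveals one more binary digit of the coordinate
  \<open>d\<close>, the parity of \<open>z d div 2 ^ r\<close>, and a number is determined by its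
  half and its parity.\<close>

lemma box_index_refine_iff:
  assumes "q d = Suc r"
  shows "box_index (q(d := r)) w = box_index (q(d := r)) z \<longleftrightarrow>
    box_index q w = box_index q z \<and> (even (w d div 2 ^ r) \<longleftrightarrow> even (z d div 2 ^ r))"
proof (rule iffI)
  assume a: "box_index (q(d := r)) w = box_index (q(d := r)) z"
  have "w d div 2 ^ r = z d div 2 ^ r"
    using fun_cong[OF a, of d] by (simp add: box_index_def)
  with box_index_refine[OF assms a]
  show "box_index q w = box_index q z \<and> (even (w d div 2 ^ r) \<longleftrightarrow> even (z d div 2 ^ r))" by simp
next
  assume a: "box_index q w = box_index q z \<and> (even (w d div 2 ^ r) \<longleftrightarrow> even (z d div 2 ^ r))"
  from fun_cong[OF conjunct1[OF a], of d] assms have "w d div 2 ^ r div 2 = z d div 2 ^ r div 2"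
    by (simp add: box_index_def div_power_Suc del: power_Suc)
  with a have "w d div 2 ^ r = z d div 2 ^ r"
    by (metis bit_eq_rec)
  moreover have "w i div 2 ^ q i = z i div 2 ^ q i" for i
    using a by (metis box_index_def)
  ultimately show "box_index (q(d := r)) w = box_index (q(d := r)) z"
    by (simp add: box_index_def fun_eq_iff)
qed

lemma box_index_reflect:
  assumes "q d = k"
  shows "box_index q (reflect d k z) = box_index q z"
  using assms by (auto simp: box_index_def reflect_def mirror_div)

lemma line_subset_box:
  assumes "q d = k" "in_box R q z"
  shows "line d k z \<subseteq> R"
  using assms by (force simp: in_box_def line_def box_index_def)

lemma in_box_cong: "box_index q w = box_index q z \<Longrightarrow> in_box R q w \<longleftrightarrow> in_box R q z"
  by (simp add: in_box_def)

lemma in_box_refine: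
  assumes "q d = Suc r" "in_box R q z"
  shows "in_box R (q(d := r)) z"
  using assms box_index_refine[of q d r] unfolding in_box_def by blast

text \<open>An intermediate set of the right size is chosen in each fibre of \<open>key\<close>
  separately. The fibres are disjoint, so the union of the choices meets each fibre in its own
  choice.\<close>

lemma between_fibres:
  assumes "finite V" "U \<subseteq> V"
    "\<And>u. card {x\<in>U. key x = u} \<le> t u \<and> t u \<le> card {x\<in>V. key x = u}"
  shows "\<exists>A. U \<subseteq> A \<and> A \<subseteq> V \<and> (\<forall>u. card {x\<in>A. key x = u} = t u)"
proof -
  have "\<forall>u. \<exists>A. {x\<in>U. key x = u} \<subseteq> A \<and> A \<subseteq> {x\<in>V. key x = u} \<and> card A = t u"
    using assms by (intro allI exists_subset_between) auto
  from choice[OF this] obtain A where A: "\<And>u. {x\<in>U. key x = u} \<subseteq> A u"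
    "\<And>u. A u \<subseteq> {x\<in>V. key x = u}" "\<And>u. card (A u) = t u" by blast
  have "{x \<in> \<Union>(range A). key x = u} = A u" for u
    using A(2) by blast
  moreover have "U \<subseteq> \<Union>(range A)" "\<Union>(range A) \<subseteq> V"
    using A(1,2) by blast+
  ultimately show ?thesis using A(3) by (intro exI[of _ "\<Union>(range A)"] conjI allI) simp_all
qed

section \<open>Dyadic bisection\<close>

definition left_half :: "'n \<Rightarrow> nat \<Rightarrow> ('n \<Rightarrow> nat) set" where
  "left_half d r = {z. even (z d div 2 ^ r)}"

lemma reflect_left_half: "reflect d (Suc r) z \<in> left_half d r \<longleftrightarrow> z \<notin> left_half d r"
  by (simp add: left_half_def reflect_def even_mirror)

lemma box_index_halves:
  assumes "q d = Suc r"
  shows "box_index (q(d := r)) w = box_index (q(d := r)) z \<longleftrightarrow>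
    box_index q w = box_index q z \<and> (w \<in> left_half d r \<longleftrightarrow> z \<in> left_half d r)"
  using box_index_refine_iff[of q d r, OF assms] by (simp add: left_half_def)

text \<open>With \<open>A\<close> the part of \<open>X\<close> in the left halves and \<open>B\<close> the mirror image of the rest, a set \<open>A'\<close> is the
  left part of a mirror movement of \<open>X\<close> whenever \<open>A \<inter> B \<subseteq> A' \<subseteq> A \<union> B\<close>; half of \<open>|A| + |B|\<close> always lies
  between the two cardinalities.\<close>

lemma halving:
  assumes q: "q d = Suc r" and fin: "finite X" and good: "\<forall>z\<in>X. in_box R q z"
  obtains S where "finite S" "reflect d (Suc r) ` S \<subseteq> S" "\<forall>z\<in>S. line d (Suc r) z \<subseteq> R"
    "card S \<le> 2 * card X" "box_index q ` S \<subseteq> box_index q ` X"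
    "\<And>u. card {z \<in> swap_on d (Suc r) S ` X. z \<in> left_half d r \<and> box_index q z = u}
      = (card {z\<in>X. box_index q z = u} + 1) div 2"
proof -
  define \<rho> where "\<rho> = reflect d (Suc r)"
  define L where "L = left_half d r"
  have \<rho>L: "\<rho> z \<in> L \<longleftrightarrow> z \<notin> L" and \<rho>\<rho>: "\<rho> (\<rho> z) = z" and \<rho>q: "box_index q (\<rho> z) = box_index q z" for z
    by (simp_all add: \<rho>_def L_def reflect_left_half box_index_reflect[of q d, OF q])
  have inj: "inj_on \<rho> U" for U by (metis \<rho>\<rho> inj_onI)
  define A where "A = X \<inter> L"
  define B where "B = \<rho> ` (X - L)"
  have finAB: "finite A" "finite B" using fin by (simp_all add: A_def B_def)
  have BL: "B \<subseteq> L" by (auto simp: B_def \<rho>L)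
  have Bmem: "z \<in> B \<longleftrightarrow> \<rho> z \<in> X" if "z \<in> L" for z
    using that by (auto simp: B_def \<rho>\<rho> \<rho>L image_iff) (metis \<rho>\<rho> \<rho>L Diff_iff)
  define s where "s u = card {z\<in>X. box_index q z = u}" for u
  have sAB: "s u = card {z\<in>A. box_index q z = u} + card {z\<in>B. box_index q z = u}" for u
  proof -
    have "{z\<in>B. box_index q z = u} = \<rho> ` {z \<in> X - L. box_index q z = u}"
      by (auto simp: B_def \<rho>q)
    then have "card {z\<in>B. box_index q z = u} = card {z \<in> X - L. box_index q z = u}"
      by (simp add: card_image inj)
    moreover have "{z\<in>X. box_index q z = u} = {z\<in>A. box_index q z = u} \<union> {z \<in> X - L. box_index q z = u}"
      by (auto simp: A_def)
    ultimately show ?thesis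
      unfolding s_def using fin by (simp add: card_Un_disjoint A_def disjoint_iff)
  qed
  \<comment> \<open>Rounding half of the number up makes the target depend on the number of points
    in the box alone, so two sets with equal counts will be halved alike.\<close>
  have s_mid: "card {z \<in> A \<inter> B. box_index q z = u} \<le> (s u + 1) div 2
      \<and> (s u + 1) div 2 \<le> card {z \<in> A \<union> B. box_index q z = u}" for u
  proof -
    let ?A = "{z\<in>A. box_index q z = u}" and ?B = "{z\<in>B. box_index q z = u}"
    have eq: "{z \<in> A \<inter> B. box_index q z = u} = ?A \<inter> ?B" "{z \<in> A \<union> B. box_index q z = u} = ?A \<union> ?B"
      by auto
    have "s u = card (?A \<union> ?B) + card (?A \<inter> ?B)"
      using sAB card_Un_Int[of ?A ?B] finAB by simp
    moreover have "card (?A \<inter> ?B) \<le> card (?A \<union> ?B)"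
      using finAB by (intro card_mono) auto
    ultimately show ?thesis unfolding eq by linarith
  qed
  have "\<exists>A'. A \<inter> B \<subseteq> A' \<and> A' \<subseteq> A \<union> B
      \<and> (\<forall>u. card {z\<in>A'. box_index q z = u} = (s u + 1) div 2)"
    by (rule between_fibres[OF finite_UnI[OF finAB] _ s_mid]) blast
  then obtain A' where A': "A \<inter> B \<subseteq> A'" "A' \<subseteq> A \<union> B"
      "\<And>u. card {z\<in>A'. box_index q z = u} = (s u + 1) div 2"
    by blast
  \<comment> \<open>\<open>D\<close> lists the pairs to be swapped by their left members. Since
    \<open>A'\<close> lies between \<open>A \<inter> B\<close> and \<open>A \<union> B\<close>, each
    of these pairs contains exactly one point of \<open>X\<close>; swapping it adds its left member
    to the left part or removes it, which turns \<open>A\<close> into \<open>A'\<close>.\<close>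
  define D where "D = (A - A') \<union> (A' - A)"
  define S where "S = D \<union> \<rho> ` D"
  have DAB: "D \<subseteq> A \<union> B" using A' by (auto simp: D_def)
  have DL: "D \<subseteq> L" using DAB BL by (auto simp: A_def)
  have finD: "finite D" using DAB finAB by (meson finite_UnI finite_subset)
  have "box_index q ` D \<subseteq> box_index q ` (A \<union> B)" using DAB by blast
  also have "\<dots> \<subseteq> box_index q ` X" by (auto simp: A_def B_def \<rho>q)
  finally have "box_index q ` D \<subseteq> box_index q ` X" .
  then have SX: "box_index q ` S \<subseteq> box_index q ` X"
    by (auto simp: S_def \<rho>q)
  have cardAB: "card (A \<union> B) \<le> card X"
  proof -
    have "card (A \<union> B) \<le> card A + card B" by (rule card_Un_le)
    also have "\<dots> = card (X \<inter> L) + card (X - L)"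
      by (simp add: A_def B_def card_image inj)
    also have "\<dots> = card X" using fin by (metis card_Int_Diff)
    finally show ?thesis .
  qed
  have "card S \<le> card D + card (\<rho> ` D)" unfolding S_def by (rule card_Un_le)
  also have "\<dots> = 2 * card D" by (simp add: card_image inj)
  also have "card D \<le> card X" using card_mono[OF _ DAB] cardAB finAB by simp
  finally have cardS: "card S \<le> 2 * card X" by simp
  have Ssym: "reflect d (Suc r) ` S \<subseteq> S"
    unfolding \<rho>_def[symmetric] by (auto simp: S_def \<rho>\<rho>)
  have lines: "\<forall>z\<in>S. line d (Suc r) z \<subseteq> R"
  proof
    fix z assume "z \<in> S"
    with SX obtain x where "x \<in> X" "box_index q z = box_index q x" by blast
    with good have "in_box R q z" using in_box_cong by blast
    then show "line d (Suc r) z \<subseteq> R" using line_subset_box[of q d] q by blast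
  qed
  have inv: "swap_on d (Suc r) S (swap_on d (Suc r) S z) = z" for z
    by (rule swap_on_swap_on[OF Ssym])
  have memX': "z \<in> swap_on d (Suc r) S ` X \<longleftrightarrow> swap_on d (Suc r) S z \<in> X" for z
    by (metis (no_types, lifting) image_iff inv)
  have "z \<in> swap_on d (Suc r) S ` X \<and> z \<in> L \<longleftrightarrow> z \<in> A'" for z
  proof (cases "z \<in> L")
    case True
    then have zS: "z \<in> S \<longleftrightarrow> z \<in> D" using DL by (auto simp: S_def \<rho>L)
    have "swap_on d (Suc r) S z \<in> X \<longleftrightarrow> z \<in> A'"
    proof (cases "z \<in> D")
      case True
      then have "swap_on d (Suc r) S z \<in> X \<longleftrightarrow> z \<in> B"
        using zS Bmem \<open>z \<in> L\<close> by (simp add: swap_on_def \<rho>_def)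
      with True A' show ?thesis by (auto simp: D_def)
    next
      case False
      then have "swap_on d (Suc r) S z \<in> X \<longleftrightarrow> z \<in> A"
        using zS \<open>z \<in> L\<close> by (simp add: swap_on_def A_def)
      with False show ?thesis by (auto simp: D_def)
    qed
    with True show ?thesis by (simp add: memX')
  next
    case False
    then have "z \<notin> A'" using A' BL by (auto simp: A_def)
    with False show ?thesis by simp
  qed
  then have "{z \<in> swap_on d (Suc r) S ` X. z \<in> left_half d r \<and> box_index q z = u}
      = {z\<in>A'. box_index q z = u}" for u
    unfolding L_def by blast
  with A'(3) have "card {z \<in> swap_on d (Suc r) S ` X. z \<in> left_half d r \<and> box_index q z = u}
      = (s u + 1) div 2" for u by simp
  then show ?thesis
    using finD by (intro that[OF _ Ssym lines cardS SX]) (auto simp: S_def s_def)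
qed

text \<open>Halving side \<open>d\<close> lowers this sum by the new length of that side, so the costs of successive
  bisections telescope.\<close>

definition box_size :: "('n::finite \<Rightarrow> nat) \<Rightarrow> real" where
  "box_size q = (\<Sum>i\<in>UNIV. 2 ^ q i)"

lemma box_size_split:
  assumes "q d = Suc r"
  shows "box_size q = box_size (q(d := r)) + 2 ^ r"
proof -
  have "box_size q = (\<Sum>i\<in>UNIV-{d}. 2 ^ q i) + 2 ^ Suc r"
    unfolding box_size_def using assms by (subst sum.remove[of _ d]) auto
  moreover have "box_size (q(d := r)) = (\<Sum>i\<in>UNIV-{d}. 2 ^ q i) + 2 ^ r"
    unfolding box_size_def by (subst sum.remove[of _ d]) auto
  ultimately show ?thesis by simp
qed

lemma box_size_nonneg: "0 \<le> box_size q"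
  by (simp add: box_size_def sum_nonneg)

lemma shape_induct [case_names zero split]:
  fixes q :: "'n::finite \<Rightarrow> nat"
  assumes zero: "P (\<lambda>_. 0)"
    and split: "\<And>q d r. q d = Suc r \<Longrightarrow> \<forall>i. q i \<le> q d \<Longrightarrow> P (q(d := r)) \<Longrightarrow> P q"
  shows "P q"
proof (induction "\<Sum>i\<in>UNIV. q i" arbitrary: q rule: less_induct)
  case less
  have "Max (range q) \<in> range q" by (rule Max_in) auto
  then obtain d where "q d = Max (range q)" by force
  then have d: "\<forall>i. q i \<le> q d" by simp
  show ?case
  proof (cases "q d")
    case 0
    with d have "q = (\<lambda>_. 0)" by auto
    with zero show ?thesis by simp
  next
    case (Suc r)
    have "(\<Sum>i\<in>UNIV. (q(d := r)) i) < (\<Sum>i\<in>UNIV. q i)"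
      by (rule sum_strict_mono_ex1) (use Suc in auto)
    with less have "P (q(d := r))" by blast
    with split Suc d show ?thesis by blast
  qed
qed

lemma box_index_zero: "box_index (\<lambda>_. 0) w = w"
  by (simp add: box_index_def)

lemma card_halves:
  assumes "finite X"
  shows "card {z\<in>X. box_index q z = u} =
    card {z\<in>X. z \<in> left_half d r \<and> box_index q z = u} + card {z\<in>X. z \<notin> left_half d r \<and> box_index q z = u}"
  using assms by (subst card_Un_disjoint[symmetric]) (auto intro!: arg_cong[where f=card])

text \<open>After \<open>halving\<close> both sets, each half box contains equally many points of
  either, so induction carries one balanced set to the other; the swap that balanced
  \<open>Y\<close> is its own inverse and leads on to \<open>Y\<close>. The constant 6 pays for two
  swaps of at most \<open>2 * card X\<close> points on lines of length \<open>2 * 2 ^ r\<close>,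
  with 3/2 as a bound for the root of 2, while \<open>box_size\<close> drops by
  \<open>2 ^ r\<close>. The clause on boxes that miss \<open>X\<close> will keep the flow out of the
  opposite halves in \<open>exchange\<close>.\<close>

lemma transport:
  fixes q :: "'n::finite \<Rightarrow> nat"
  assumes "finite X" "finite Y" "\<forall>z\<in>X. in_box R q z" "\<forall>z\<in>Y. in_box R q z"
    "\<And>u. card {z\<in>X. box_index q z = u} = card {z\<in>Y. box_index q z = u}"
  shows "\<exists>\<phi> c. flowable R \<phi> c \<and> c \<le> 6 * box_size q * sqrt (card X) \<and> \<phi> ` X = Y \<and>
    (\<forall>z. box_index q (\<phi> z) = box_index q z) \<and>
    (\<forall>z. box_index q z \<notin> box_index q ` X \<longrightarrow> \<phi> z = z)"
  using assms
proof (induction q arbitrary: X Y rule: shape_induct)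
  case zero
  have "X = Y"
  proof (rule set_eqI)
    fix u
    have c: "card {z\<in>V. z = u} = (if u \<in> V then 1 else 0)" for V :: "('n \<Rightarrow> nat) set"
    proof (cases "u \<in> V")
      case True
      then have "{z\<in>V. z = u} = {u}" by blast
      with True show ?thesis by simp
    qed simp
    show "u \<in> X \<longleftrightarrow> u \<in> Y"
      using zero(5)[of u] unfolding box_index_zero c by (simp split: if_splits)
  qed
  then show ?case
    by (intro exI[of _ id] exI[of _ 0] conjI flowable_id) (simp_all add: box_size_nonneg)
next
  case (split q d r)
  note q = split.hyps(1)
  obtain S where S: "finite S" "reflect d (Suc r) ` S \<subseteq> S" "\<forall>z\<in>S. line d (Suc r) z \<subseteq> R"
    "card S \<le> 2 * card X" "box_index q ` S \<subseteq> box_index q ` X"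
    and Sc: "\<And>u. card {z \<in> swap_on d (Suc r) S ` X. z \<in> left_half d r \<and> box_index q z = u}
      = (card {z\<in>X. box_index q z = u} + 1) div 2"
    by (rule halving[of q d, OF q split.prems(1,3)]) (rule that)
  obtain T where T: "finite T" "reflect d (Suc r) ` T \<subseteq> T" "\<forall>z\<in>T. line d (Suc r) z \<subseteq> R"
    "card T \<le> 2 * card Y" "box_index q ` T \<subseteq> box_index q ` Y"
    and Tc: "\<And>u. card {z \<in> swap_on d (Suc r) T ` Y. z \<in> left_half d r \<and> box_index q z = u}
      = (card {z\<in>Y. box_index q z = u} + 1) div 2"
    by (rule halving[of q d, OF q split.prems(2,4)]) (rule that)
  let ?f = "swap_on d (Suc r) S" and ?g = "swap_on d (Suc r) T"
  have fq: "box_index q (?f z) = box_index q z" and gq: "box_index q (?g z) = box_index q z" for z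
    by (simp_all add: swap_on_def box_index_reflect[of q d, OF q])
  have bf: "bij ?f" and bg: "bij ?g" by (simp_all add: bij_swap_on S T)
  have inj: "inj_on ?f V" "inj_on ?g V" for V
    using bf bg by (metis bij_is_inj inj_on_subset subset_UNIV)+
  have imq: "{z \<in> h ` V. box_index q z = u} = h ` {z\<in>V. box_index q z = u}"
    if "\<And>z. box_index q (h z) = box_index q z" for h V u
    using that by auto
  have cardX': "card {z \<in> ?f ` X. box_index q z = u} = card {z\<in>X. box_index q z = u}"
    and cardY': "card {z \<in> ?g ` Y. box_index q z = u} = card {z\<in>Y. box_index q z = u}" for u
    by (simp_all add: imq[OF fq] imq[OF gq] card_image inj)
  have eq: "card {z \<in> ?f ` X. box_index (q(d := r)) z = u} = card {z \<in> ?g ` Y. box_index (q(d := r)) z = u}" for u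
  proof (cases "u \<in> range (box_index (q(d := r)))")
    case True
    then obtain w where w: "u = box_index (q(d := r)) w" by blast
    let ?u = "box_index q w"
    have l: "card {z \<in> ?f ` X. z \<in> left_half d r \<and> box_index q z = ?u}
        = card {z \<in> ?g ` Y. z \<in> left_half d r \<and> box_index q z = ?u}"
      unfolding Sc Tc split.prems(5) ..
    moreover have "card {z \<in> ?f ` X. box_index q z = ?u} = card {z \<in> ?g ` Y. box_index q z = ?u}"
      unfolding cardX' cardY' split.prems(5) ..
    ultimately have "card {z \<in> ?f ` X. z \<notin> left_half d r \<and> box_index q z = ?u}
        = card {z \<in> ?g ` Y. z \<notin> left_half d r \<and> box_index q z = ?u}"
      using card_halves[of "?f ` X" q ?u d r] card_halves[of "?g ` Y" q ?u d r] split.prems(1,2)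
      by simp
    with l show ?thesis
      unfolding w box_index_halves[of q d, OF q]
      by (cases "w \<in> left_half d r") (simp_all only: simp_thms conj_commute[of "_ = _"])
  next
    case False
    then have *: "{z \<in> V. box_index (q(d := r)) z = u} = {}" for V by blast
    show ?thesis unfolding * ..
  qed
  have good: "\<forall>z\<in>?f ` X. in_box R (q(d := r)) z" "\<forall>z\<in>?g ` Y. in_box R (q(d := r)) z"
    using split.prems(3,4) in_box_refine[of q d, OF q] in_box_cong[OF fq] in_box_cong[OF gq] by blast+
  obtain \<phi> c where \<phi>: "flowable R \<phi> c" "c \<le> 6 * box_size (q(d := r)) * sqrt (card (?f ` X))"
      "\<phi> ` ?f ` X = ?g ` Y" "\<forall>z. box_index (q(d := r)) (\<phi> z) = box_index (q(d := r)) z"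
      "\<forall>z. box_index (q(d := r)) z \<notin> box_index (q(d := r)) ` ?f ` X \<longrightarrow> \<phi> z = z"
    using split.IH[OF finite_imageI[OF split.prems(1)] finite_imageI[OF split.prems(2)] good eq] by blast
  have cardXY: "card X = card Y"
    by (metis (no_types, lifting) \<phi>(1) \<phi>(3) bij_is_inj card_image flowable_bij inj inj_on_subset subset_UNIV)
  let ?\<psi> = "?g \<circ> (\<phi> \<circ> ?f)"
  have flow: "flowable R ?\<psi> (2 ^ Suc r * sqrt (card T) + (c + 2 ^ Suc r * sqrt (card S)))"
    by (intro flowable_comp flowable_swap_on S T \<phi>(1))
  have sq: "sqrt (card V) \<le> 3/2 * sqrt (card X)" if "card V \<le> 2 * card X" for V :: "('n \<Rightarrow> nat) set"
  proof -
    have "real (card V) \<le> (3/2)\<^sup>2 * card X" using that by (simp add: power2_eq_square)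
    then have "sqrt (card V) \<le> sqrt ((3/2)\<^sup>2 * card X)" by (rule real_sqrt_le_mono)
    then show ?thesis by (simp add: real_sqrt_mult)
  qed
  have "2 ^ Suc r * sqrt (card T) + (c + 2 ^ Suc r * sqrt (card S))
      \<le> 2 ^ Suc r * (3/2 * sqrt (card X)) + (6 * box_size (q(d := r)) * sqrt (card X) + 2 ^ Suc r * (3/2 * sqrt (card X)))"
    using \<phi>(2) sq[of T] sq[of S] S(4) T(4) cardXY
    by (intro add_mono mult_left_mono) (auto simp: card_image inj)
  also have "\<dots> = 6 * box_size q * sqrt (card X)"
    by (simp add: box_size_split[of q d, OF q] algebra_simps)
  finally have cost: "2 ^ Suc r * sqrt (card T) + (c + 2 ^ Suc r * sqrt (card S)) \<le> 6 * box_size q * sqrt (card X)" .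
  have im: "?\<psi> ` X = Y"
  proof -
    have "?\<psi> ` X = ?g ` ?g ` Y" unfolding image_comp[symmetric] \<phi>(3) ..
    then show ?thesis by (simp add: swap_on_swap_on[OF T(2)] image_image)
  qed
  have pres: "box_index q (?\<psi> z) = box_index q z" for z
  proof -
    have "box_index q (\<phi> w) = box_index q w" for w
      by (rule box_index_refine[of q d, OF q \<phi>(4)[rule_format]])
    then show ?thesis by (simp only: o_apply fq gq)
  qed
  \<comment> \<open>\<open>T\<close> touches only boxes that meet \<open>Y\<close>. As these also
    meet \<open>X\<close>, the last swap cannot move a point of a box without points of
    \<open>X\<close>.\<close>
  have XY: "box_index q ` Y \<subseteq> box_index q ` X"
  proof
    fix u assume "u \<in> box_index q ` Y"
    then obtain y where y: "y \<in> Y" "u = box_index q y" by (elim imageE)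
    from y(1) have "y \<in> ?\<psi> ` X" by (simp only: im)
    then obtain x where x: "y = ?\<psi> x" "x \<in> X" by (rule imageE)
    have "u = box_index q x" unfolding y(2) x(1) by (rule pres)
    then show "u \<in> box_index q ` X" using x(2) by (rule image_eqI)
  qed
  have fixed: "?\<psi> z = z" if z: "box_index q z \<notin> box_index q ` X" for z
  proof -
    have "?f z = z" using z S(5) by (auto simp: swap_on_def)
    moreover have "\<phi> z = z"
    proof -
      have "box_index (q(d := r)) z \<noteq> box_index (q(d := r)) (?f x)" if "x \<in> X" for x
        using z that box_index_refine[of q d r z "?f x", OF q] fq by auto
      then show ?thesis using \<phi>(5) by blast
    qed
    moreover have "?g z = z" using z T(5) XY by (auto simp: swap_on_def)
    ultimately show ?thesis by simp
  qed
  show ?case using flow cost im pres fixed by blast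
qed

text \<open>If \<open>\<phi>\<close> carries \<open>U\<close> to the mirror image \<open>Y\<close> of \<open>V\<close> inside the left halves, then conjugating the mirror
  swap of \<open>Y\<close> and \<open>V\<close> by \<open>\<phi>\<close> exchanges \<open>U\<close> and \<open>V\<close> and returns all other points to their place.\<close>

lemma exchange:
  fixes q :: "'n::finite \<Rightarrow> nat"
  assumes q: "q d = Suc r" and fin: "finite U" "finite V"
    and halves: "U \<subseteq> left_half d r" "V \<inter> left_half d r = {}"
    and good: "\<forall>z\<in>U. in_box R q z" "\<forall>z\<in>V. in_box R q z"
    and eq: "\<And>u. card {z\<in>U. box_index q z = u} = card {z\<in>V. box_index q z = u}"
  shows "\<exists>h c. flowable R h c \<and> c \<le> 12 * box_size q * sqrt (card U) \<and> h ` U = V \<and> h ` V = U \<and>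
    (\<forall>z. z \<notin> U \<union> V \<longrightarrow> h z = z) \<and> (\<forall>z. box_index q (h z) = box_index q z)"
proof -
  define \<rho> where "\<rho> = reflect d (Suc r)"
  define q' where "q' = q(d := r)"
  define Y where "Y = \<rho> ` V"
  have \<rho>L: "\<rho> z \<in> left_half d r \<longleftrightarrow> z \<notin> left_half d r" and \<rho>\<rho>: "\<rho> (\<rho> z) = z"
    and \<rho>q: "box_index q (\<rho> z) = box_index q z" for z
    by (simp_all add: \<rho>_def reflect_left_half box_index_reflect[of q d, OF q])
  have inj: "inj_on \<rho> U" for U by (metis \<rho>\<rho> inj_onI)
  have YL: "Y \<subseteq> left_half d r" using halves(2) by (auto simp: Y_def \<rho>L)
  have \<rho>Y: "\<rho> ` Y = V" by (simp add: Y_def image_image \<rho>\<rho>)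
  note q'_iff = box_index_halves[of q d, OF q, folded q'_def]
  have eqY: "card {z\<in>Y. box_index q z = u} = card {z\<in>U. box_index q z = u}" for u
  proof -
    have "{z\<in>Y. box_index q z = u} = \<rho> ` {z\<in>V. box_index q z = u}"
      by (auto simp: Y_def \<rho>q)
    then show ?thesis using eq by (simp add: card_image inj)
  qed
  \<comment> \<open>Both sets lie in the left halves, where their points in a half box are their
    points in the surrounding box; in the right halves both counts vanish.\<close>
  have eq': "card {z\<in>U. box_index q' z = u} = card {z\<in>Y. box_index q' z = u}" for u
  proof (cases "u \<in> box_index q' ` left_half d r")
    case True
    then obtain w where w: "u = box_index q' w" "w \<in> left_half d r" by blast
    have *: "{z\<in>W. box_index q' z = u} = {z\<in>W. box_index q z = box_index q w}"
      if "W \<subseteq> left_half d r" for W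
      using that w unfolding w(1) q'_iff by blast
    show ?thesis unfolding *[OF YL] *[OF halves(1)] eqY ..
  next
    case False
    then have *: "{z\<in>W. box_index q' z = u} = {}" if "W \<subseteq> left_half d r" for W
      using that by blast
    show ?thesis unfolding *[OF YL] *[OF halves(1)] ..
  qed
  have goodU: "\<forall>z\<in>U. in_box R q' z"
    using good(1) in_box_refine[of q d, OF q] by (simp add: q'_def)
  have "\<forall>z\<in>Y. in_box R q z"
    using good(2) in_box_cong[OF \<rho>q] by (auto simp: Y_def)
  then have goodY: "\<forall>z\<in>Y. in_box R q' z" and linesY: "\<forall>z\<in>Y. line d (Suc r) z \<subseteq> R"
    using in_box_refine[of q d, OF q] line_subset_box[of q d, OF q] by (simp_all add: q'_def)
  have linesV: "\<forall>z\<in>V. line d (Suc r) z \<subseteq> R"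
    using good(2) line_subset_box[of q d, OF q] by simp
  obtain \<phi> c where \<phi>: "flowable R \<phi> c" "c \<le> 6 * box_size q' * sqrt (card U)" "\<phi> ` U = Y"
      "\<forall>z. box_index q' (\<phi> z) = box_index q' z"
      "\<forall>z. box_index q' z \<notin> box_index q' ` U \<longrightarrow> \<phi> z = z"
    using transport[OF fin(1) _ goodU goodY eq'] fin(2) unfolding Y_def by blast
  have b: "bij \<phi>" by (rule flowable_bij[OF \<phi>(1)])
  \<comment> \<open>No right half meets \<open>U\<close>, so \<open>\<phi>\<close> fixes the right
    halves pointwise; in particular the conjugation does not disturb \<open>V\<close>.\<close>
  have fixR: "\<phi> z = z" if "z \<notin> left_half d r" for z
    using \<phi>(5) that halves(1) q'_iff by blast
  have invR: "inv \<phi> z = z" if "z \<notin> left_half d r" for z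
    using fixR[OF that] b by (metis bij_inv_eq_iff)
  define T where "T = Y \<union> V"
  have T: "finite T" "reflect d (Suc r) ` T \<subseteq> T" "\<forall>z\<in>T. line d (Suc r) z \<subseteq> R"
  proof -
    show "finite T" "reflect d (Suc r) ` T \<subseteq> T"
      using fin \<rho>Y unfolding T_def \<rho>_def[symmetric] by (simp_all add: Y_def[symmetric] image_Un) (simp add: Y_def)
    show "\<forall>z\<in>T. line d (Suc r) z \<subseteq> R"
      using linesY linesV unfolding T_def by blast
  qed
  let ?s = "swap_on d (Suc r) T"
  let ?h = "inv \<phi> \<circ> (?s \<circ> \<phi>)"
  have sY: "?s ` Y = V" and sV: "?s ` V = Y"
    using \<rho>Y by (auto simp: swap_on_def T_def \<rho>_def[symmetric] image_def Y_def \<rho>\<rho>)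
  have phV: "\<phi> ` V = V" "inv \<phi> ` V = V"
    using fixR invR halves(2) by force+
  \<comment> \<open>Using \<open>\<phi>\<close> twice doubles the constant 6 of
    \<open>transport\<close>. The swap between costs at most 3 times
    \<open>2 ^ r * sqrt (card U)\<close>; allowing 12 times makes the sum a multiple of
    \<open>box_size q\<close>.\<close>
  have "flowable R ?h (c + (2 ^ Suc r * sqrt (card T) + c))"
    by (intro flowable_comp flowable_inv flowable_swap_on T \<phi>(1))
  moreover have "c + (2 ^ Suc r * sqrt (card T) + c) \<le> 12 * box_size q * sqrt (card U)"
  proof -
    have "card Y = card U" using \<phi>(3) b by (metis bij_is_inj card_image inj_on_subset subset_UNIV)
    moreover have "card V = card Y" by (simp add: Y_def card_image inj)
    ultimately have "card T \<le> 2 * card U" unfolding T_def using card_Un_le[of Y V] by simp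
    then have "real (card T) \<le> (3/2)\<^sup>2 * card U" by (simp add: power2_eq_square)
    then have "sqrt (card T) \<le> sqrt ((3/2)\<^sup>2 * card U)" by (rule real_sqrt_le_mono)
    then have "sqrt (card T) \<le> 3/2 * sqrt (card U)" by (simp add: real_sqrt_mult)
    then have "2 ^ Suc r * sqrt (card T) \<le> 2 ^ Suc r * (3/2 * sqrt (card U))"
      by (intro mult_left_mono) auto
    also have "\<dots> \<le> 12 * 2 ^ r * sqrt (card U)" by simp
    finally have "c + (2 ^ Suc r * sqrt (card T) + c)
        \<le> 12 * box_size q' * sqrt (card U) + 12 * 2 ^ r * sqrt (card U)"
      using \<phi>(2) by linarith
    also have "\<dots> = 12 * box_size q * sqrt (card U)"
      by (simp add: box_size_split[of q d, OF q] q'_def algebra_simps)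
    finally show ?thesis .
  qed
  moreover have "?h ` U = V"
    unfolding image_comp[symmetric] \<phi>(3) sY phV ..
  moreover have "?h ` V = U"
  proof -
    have "?h ` V = inv \<phi> ` \<phi> ` U" unfolding image_comp[symmetric] \<phi>(3) sV phV ..
    then show ?thesis using b by (simp only: image_inv_f_f bij_is_inj)
  qed
  moreover have "?h z = z" if z: "z \<notin> U \<union> V" for z
  proof -
    have "\<phi> z \<notin> Y" using z \<phi>(3) b by (metis UnI1 bij_is_inj inj_image_mem_iff)
    moreover have "\<phi> z \<notin> V" using z phV b by (metis UnI2 bij_is_inj inj_image_mem_iff)
    ultimately show ?thesis using b by (simp add: swap_on_def T_def bij_is_inj)
  qed
  moreover have "box_index q (?h z) = box_index q z" for z
  proof -
    have p: "box_index q (\<phi> z) = box_index q z" for z using \<phi>(4) q'_iff by blast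
    have "box_index q (inv \<phi> z) = box_index q z" for z
      using p[of "inv \<phi> z"] b by (simp add: bij_is_surj surj_f_inv_f)
    with p show ?thesis by (simp add: swap_on_def box_index_reflect[of q d, OF q])
  qed
  ultimately show ?thesis by blast
qed

text \<open>The largest side is bisected first, so that \<open>box_size\<close> stays comparable to the side being halved.\<close>

theorem route:
  fixes q :: "'n::finite \<Rightarrow> nat"
  assumes "bij \<sigma>" "finite {z. \<sigma> z \<noteq> z}" "\<And>z. box_index q (\<sigma> z) = box_index q z"
    "\<And>z. \<sigma> z \<noteq> z \<Longrightarrow> in_box R q z"
  shows "\<exists>c. flowable R \<sigma> c \<and> c \<le> 24 * CARD('n) * box_size q * sqrt (card {z. \<sigma> z \<noteq> z})"
  using assms
proof (induction q arbitrary: \<sigma> rule: shape_induct)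
  case zero
  then have "\<sigma> = id" by (simp add: box_index_zero fun_eq_iff)
  then have "flowable R \<sigma> 0" by (simp only: flowable_id)
  then show ?case
    by (intro exI[of _ 0]) (simp add: box_size_nonneg)
next
  case (split q d r)
  note q = split.hyps(1) and b = split.prems(1) and fin = split.prems(2) and pres = split.prems(3)
  define U where "U = {z. z \<in> left_half d r \<and> \<sigma> z \<notin> left_half d r}"
  define V where "V = {z. z \<notin> left_half d r \<and> \<sigma> z \<in> left_half d r}"
  let ?X = "{z. \<sigma> z \<noteq> z}"
  have UX: "U \<subseteq> ?X" and VX: "V \<subseteq> ?X" by (auto simp: U_def V_def)
  have finUV: "finite U" "finite V" using UX VX fin by (meson finite_subset)+
  have halves: "U \<subseteq> left_half d r" "V \<inter> left_half d r = {}" by (auto simp: U_def V_def)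
  have good: "\<forall>z\<in>U. in_box R q z" "\<forall>z\<in>V. in_box R q z" using UX VX split.prems(4) by blast+
  \<comment> \<open>A bijection that preserves a finite box takes as many points out of its left
    half as it brings in.\<close>
  have eq: "card {z\<in>U. box_index q z = u} = card {z\<in>V. box_index q z = u}" for u
  proof -
    let ?L = "{z. box_index q z = u \<and> z \<in> left_half d r}"
    let ?S = "{z. box_index q z = u \<and> z \<in> left_half d r \<and> \<sigma> z \<in> left_half d r}"
    let ?L' = "{z. box_index q z = u \<and> \<sigma> z \<in> left_half d r}"
    have f: "finite {z. box_index q z = u \<and> P z}" for P
      using finite_box[of q u] by (rule rev_finite_subset) auto
    have "\<sigma> ` ?L' = ?L"
    proof
      show "?L \<subseteq> \<sigma> ` ?L'"
      proof
        fix z assume z: "z \<in> ?L"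
        obtain w where "z = \<sigma> w" using b by (metis bij_pointE)
        with z pres show "z \<in> \<sigma> ` ?L'" by auto
      qed
    qed (use pres in auto)
    then have "card ?L = card ?L'"
      using card_image[OF inj_on_subset[OF bij_is_inj[OF b] subset_UNIV], of ?L'] by simp
    moreover have L: "?L = ?S \<union> {z\<in>U. box_index q z = u}" and L': "?L' = ?S \<union> {z\<in>V. box_index q z = u}"
      by (auto simp: U_def V_def)
    have fin_u: "finite {z\<in>U. box_index q z = u}" "finite {z\<in>V. box_index q z = u}"
      using finUV by simp_all
    have "card ?L = card ?S + card {z\<in>U. box_index q z = u}"
      by (subst L, rule card_Un_disjoint[OF f fin_u(1)]) (auto simp: U_def)
    moreover have "card ?L' = card ?S + card {z\<in>V. box_index q z = u}"
      by (subst L', rule card_Un_disjoint[OF f fin_u(2)]) (auto simp: V_def)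
    ultimately show ?thesis by simp
  qed
  obtain h c where h: "flowable R h c" "c \<le> 12 * box_size q * sqrt (card U)" "h ` U = V" "h ` V = U"
      "\<forall>z. z \<notin> U \<union> V \<longrightarrow> h z = z" "\<forall>z. box_index q (h z) = box_index q z"
    using exchange[of q d, OF q finUV halves good eq] by blast
  have bh: "bij h" by (rule flowable_bij[OF h(1)])
  \<comment> \<open>The exchange \<open>h\<close> already puts every crossing point on its proper
    side, so the remaining permutation \<open>?\<tau>\<close> preserves the half boxes. Its support
    does not grow, because \<open>h\<close> only interchanges \<open>U\<close> and \<open>V\<close>,
    whose points are all moved by \<open>\<sigma>\<close>.\<close>
  let ?\<tau> = "\<sigma> \<circ> inv h"
  have \<tau>h: "?\<tau> (h z) = \<sigma> z" for z using bh by (simp add: bij_is_inj)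
  have surj: "\<exists>w. z = h w" for z using bh by (metis bij_pointE)
  have b\<tau>: "bij ?\<tau>" by (intro bij_comp bij_imp_bij_inv bh b)
  have sub: "{z. ?\<tau> z \<noteq> z} \<subseteq> ?X"
  proof
    fix z assume z: "z \<in> {z. ?\<tau> z \<noteq> z}"
    obtain w where w: "z = h w" using surj by blast
    show "z \<in> ?X"
    proof (cases "w \<in> U \<union> V")
      case True
      then have "z \<in> U \<union> V" using w h(3,4) by blast
      then show ?thesis using UX VX by blast
    next
      case False
      then have "z = w" using w h(5) by simp
      moreover have "?\<tau> z = \<sigma> w" unfolding w by (rule \<tau>h)
      ultimately show ?thesis using z by simp
    qed
  qed
  then have fin\<tau>: "finite {z. ?\<tau> z \<noteq> z}" using fin by (rule finite_subset)
  have pres\<tau>: "box_index (q(d := r)) (?\<tau> z) = box_index (q(d := r)) z" for z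
  proof -
    obtain w where w: "z = h w" using surj by blast
    have "h w \<in> left_half d r \<longleftrightarrow> \<sigma> w \<in> left_half d r"
    proof -
      consider "w \<in> U" | "w \<in> V" | "w \<notin> U" "w \<notin> V" by blast
      then show ?thesis
      proof cases
        case 1
        then have "h w \<in> V" using h(3) by blast
        with 1 show ?thesis by (auto simp: U_def V_def)
      next
        case 2
        then have "h w \<in> U" using h(4) by blast
        with 2 show ?thesis by (auto simp: U_def V_def)
      next
        case 3
        with h(5) have "h w = w" by simp
        with 3 show ?thesis by (auto simp: U_def V_def)
      qed
    qed
    then show ?thesis
      unfolding w \<tau>h box_index_halves[of q d, OF q] using pres h(6) by simp
  qed
  have good\<tau>: "in_box R (q(d := r)) z" if "?\<tau> z \<noteq> z" for z
    using that sub split.prems(4) in_box_refine[of q d, OF q] by blast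
  obtain c' where c': "flowable R ?\<tau> c'"
      "c' \<le> 24 * CARD('n) * box_size (q(d := r)) * sqrt (card {z. ?\<tau> z \<noteq> z})"
    using split.IH[OF b\<tau> fin\<tau> pres\<tau> good\<tau>] by blast
  have "?\<tau> \<circ> h = \<sigma>" using \<tau>h by auto
  then have "flowable R \<sigma> (c' + c)" using flowable_comp[OF c'(1) h(1)] by simp
  \<comment> \<open>Side \<open>d\<close> is a longest one, so \<open>box_size q\<close> is at most
    \<open>CARD('n)\<close> times \<open>2 * 2 ^ r\<close>. The exchange thus costs 24 times
    \<open>CARD('n) * 2 ^ r\<close> times the root, and \<open>2 ^ r\<close> is exactly what
    \<open>box_size\<close> loses.\<close>
  moreover have "c' + c \<le> 24 * CARD('n) * box_size q * sqrt (card ?X)"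
  proof -
    have "box_size q \<le> (\<Sum>i\<in>(UNIV::'n set). 2 ^ q d)"
      unfolding box_size_def using split.hyps(2) by (intro sum_mono power_increasing) auto
    then have bs: "box_size q \<le> CARD('n) * (2 * 2 ^ r)" by (simp add: q)
    have "c \<le> 12 * (CARD('n) * (2 * 2 ^ r)) * sqrt (card ?X)"
      using h(2) bs card_mono[OF fin UX] box_size_nonneg[of q]
      by (elim order_trans) (intro mult_mono real_sqrt_le_mono, auto)
    moreover have "c' \<le> 24 * CARD('n) * box_size (q(d := r)) * sqrt (card ?X)"
      using c'(2) card_mono[OF fin sub] box_size_nonneg[of "q(d := r)"]
      by (elim order_trans) (intro mult_mono real_sqrt_le_mono, auto)
    ultimately show ?thesis
      by (simp add: box_size_split[of q d, OF q] algebra_simps)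
  qed
  ultimately show ?case by blast
qed

section \<open>Relabelling and crossings of coarse walls\<close>

definition grid :: "nat \<Rightarrow> ('n \<Rightarrow> nat) set" where
  "grid N = {x. \<forall>i. x i < N}"

lemma grid_PiE: "grid N = PiE UNIV (\<lambda>_. {..<N})"
  by (auto simp: grid_def PiE_def)

lemma finite_grid [simp]: "finite (grid N :: ('n::finite \<Rightarrow> nat) set)"
  by (simp add: grid_PiE finite_PiE)

lemma card_grid: "card (grid N :: ('n::finite \<Rightarrow> nat) set) = N ^ CARD('n)"
  by (simp add: grid_PiE card_PiE)

lemma fibrewise_bijection:
  fixes u v :: "'a \<Rightarrow> 'b"
  assumes "finite W" and eq: "\<And>l. card {y\<in>W. u y = l} = card {y\<in>W. v y = l}"
  obtains f where "bij_betw f W W" "\<And>y. y \<in> W \<Longrightarrow> v (f y) = u y"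
proof -
  have "\<exists>g. bij_betw g {y\<in>W. u y = l} {y\<in>W. v y = l}" for l
    using assms by (intro finite_same_card_bij) auto
  then obtain g where g: "\<And>l. bij_betw (g l) {y\<in>W. u y = l} {y\<in>W. v y = l}" by metis
  define f where "f y = g (u y) y" for y
  have f: "f y \<in> W" "v (f y) = u y" if "y \<in> W" for y
    using bij_betwE[OF g[of "u y"]] that by (auto simp: f_def)
  have "inj_on f W"
  proof (rule inj_onI)
    fix y y' assume y: "y \<in> W" "y' \<in> W" "f y = f y'"
    then have "u y = u y'" using f(2) by metis
    with y show "y = y'"
      using bij_betw_imp_inj_on[OF g[of "u y"]] by (auto simp: f_def dest: inj_onD)
  qed
  then have "bij_betw f W W"
    using f(1) assms(1) by (simp add: bij_betw_def endo_inj_surj image_subset_iff)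
  from that[OF this f(2)] show ?thesis by blast
qed

text \<open>Among the positions whose occupant came from another label, each label is demanded as
  often as it is available: this holds on all of \<open>G\<close>, and demand and supply agree off
  \<open>W\<close>. Permuting \<open>W\<close> alone therefore restores all labels, and no more
  points move than had crossed.\<close>

lemma relabel:
  fixes label :: "'a \<Rightarrow> 'b"
  assumes "finite G" and \<pi>: "bij_betw \<pi> G G"
  obtains \<sigma> where "bij_betw \<sigma> G G" "\<And>x. x \<in> G \<Longrightarrow> label (\<sigma> (\<pi> x)) = label x"
    "{y\<in>G. \<sigma> y \<noteq> y} \<subseteq> \<pi> ` {x\<in>G. label (\<pi> x) \<noteq> label x}"
proof -
  define \<pi>' where "\<pi>' = the_inv_into G \<pi>"
  have \<pi>': "\<pi>' y \<in> G" "\<pi> (\<pi>' y) = y" if "y \<in> G" for y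
    using that \<pi> by (auto simp: \<pi>'_def bij_betw_def the_inv_into_into f_the_inv_into_f)
  have \<pi>'\<pi>: "\<pi>' (\<pi> x) = x" if "x \<in> G" for x
    using that \<pi> by (simp add: \<pi>'_def bij_betw_def the_inv_into_f_f)
  have \<pi>G: "\<pi> x \<in> G" if "x \<in> G" for x using that \<pi> bij_betwE by blast
  have inj: "inj_on \<pi> G" using \<pi> by (rule bij_betw_imp_inj_on)
  define W where "W = {y\<in>G. label (\<pi>' y) \<noteq> label y}"
  have W: "W = \<pi> ` {x\<in>G. label (\<pi> x) \<noteq> label x}"
  proof (intro equalityI subsetI)
    fix y assume "y \<in> W"
    then show "y \<in> \<pi> ` {x\<in>G. label (\<pi> x) \<noteq> label x}"
      using \<pi>'[of y] by (intro image_eqI[of _ _ "\<pi>' y"]) (auto simp: W_def)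
  qed (auto simp: W_def \<pi>'\<pi> \<pi>G)
  have finW: "finite W" using assms(1) by (simp add: W_def)
  have eq: "card {y\<in>W. label (\<pi>' y) = l} = card {y\<in>W. label y = l}" for l
  proof -
    let ?H = "{y\<in>G. label (\<pi>' y) = l}" and ?P = "{y\<in>G. label y = l}"
    let ?C = "{y\<in>G. label (\<pi>' y) = l \<and> label y = l}"
    have "?H = \<pi> ` ?P"
    proof (intro equalityI subsetI)
      fix y assume "y \<in> ?H"
      then show "y \<in> \<pi> ` ?P"
        using \<pi>'[of y] by (intro image_eqI[of _ _ "\<pi>' y"]) auto
    qed (auto simp: \<pi>'\<pi> \<pi>G)
    then have "card ?H = card ?P"
      using inj by (simp add: card_image inj_on_subset[of \<pi> G])
    moreover have H: "?H = {y\<in>W. label (\<pi>' y) = l} \<union> ?C" and P: "?P = {y\<in>W. label y = l} \<union> ?C"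
      by (auto simp: W_def)
    have "card ?H = card {y\<in>W. label (\<pi>' y) = l} + card ?C"
      by (subst H, rule card_Un_disjoint) (use assms(1) in \<open>auto simp: W_def\<close>)
    moreover have "card ?P = card {y\<in>W. label y = l} + card ?C"
      by (subst P, rule card_Un_disjoint) (use assms(1) in \<open>auto simp: W_def\<close>)
    ultimately show ?thesis by simp
  qed
  obtain f where f: "bij_betw f W W" "\<And>y. y \<in> W \<Longrightarrow> label (f y) = label (\<pi>' y)"
    by (rule fibrewise_bijection[of W "\<lambda>y. label (\<pi>' y)" label, OF finW eq]) (rule that)
  define \<sigma> where "\<sigma> y = (if y \<in> W then f y else y)" for y
  have "bij_betw \<sigma> (W \<union> (G - W)) (W \<union> (G - W))"
  proof (rule bij_betw_combine)
    show "bij_betw \<sigma> W W" using f(1) by (simp add: \<sigma>_def cong: bij_betw_cong)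
    show "bij_betw \<sigma> (G - W) (G - W)"
      using bij_betw_id[of "G - W"] by (rule iffD1[OF bij_betw_cong, rotated]) (simp add: \<sigma>_def)
  qed blast
  moreover have "W \<union> (G - W) = G" by (auto simp: W_def)
  ultimately have "bij_betw \<sigma> G G" by simp
  moreover have "label (\<sigma> (\<pi> x)) = label x" if "x \<in> G" for x
    using that f(2)[of "\<pi> x"] by (auto simp: \<sigma>_def \<pi>'\<pi> W_def \<pi>G)
  moreover have "{y\<in>G. \<sigma> y \<noteq> y} \<subseteq> W" by (auto simp: \<sigma>_def)
  ultimately show ?thesis using that unfolding W by blast
qed

text \<open>Hermite's identity.\<close>

lemma sum_shifted_div: "(\<Sum>s<b. (x + s) div b) = x" if "b > 0" for b x :: nat
proof (induction x)
  case (Suc x)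
  have "(\<Sum>s<b. (Suc x + s) div b) + x div b = (\<Sum>s<Suc b. (x + s) div b)"
    by (subst sum.lessThan_Suc_shift) simp
  also have "\<dots> = x + (x div b + 1)"
    using Suc that by simp
  finally show ?case by simp
qed (use that in simp)

text \<open>By Hermite's identity the quotients of \<open>x + s\<close> and \<open>y + s\<close>
  differ by \<open>\<bar>x - y\<bar>\<close> in total over all shifts, and each shift with a wall
  between the two points contributes at least one.\<close>

lemma card_separating_shifts:
  fixes x y b :: nat
  assumes "b > 0"
  shows "real (card {s\<in>{..<b}. (x + s) div b \<noteq> (y + s) div b}) \<le> \<bar>real x - real y\<bar>"
proof -
  have *: "card {s\<in>{..<b}. (x + s) div b \<noteq> (y + s) div b} \<le> y - x" if "x \<le> y" for x y :: nat
  proof -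
    have le: "(x + s) div b \<le> (y + s) div b" for s using that by (simp add: div_le_mono)
    have "card {s\<in>{..<b}. (x + s) div b \<noteq> (y + s) div b}
        = (\<Sum>s<b. if (x + s) div b \<noteq> (y + s) div b then 1 else 0)"
      by (simp add: sum.If_cases Int_def conj_commute)
    also have "\<dots> \<le> (\<Sum>s<b. (y + s) div b - (x + s) div b)"
      using le by (intro sum_mono) (auto simp: Suc_le_eq le_neq_implies_less)
    also have "\<dots> = y - x"
      using le by (simp add: sum_subtractf_nat sum_shifted_div[OF assms])
    finally show ?thesis .
  qed
  show ?thesis
  proof (cases "x \<le> y")
    case True
    with *[OF this] show ?thesis by linarith
  next
    case False
    have "{s\<in>{..<b}. (x + s) div b \<noteq> (y + s) div b} = {s\<in>{..<b}. (y + s) div b \<noteq> (x + s) div b}"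
      by auto
    with False *[of y x] show ?thesis by simp
  qed
qed

text \<open>A single shift can serve all coordinates: a crossing is charged to some coordinate, and
  each coordinate is bounded separately over the same \<open>b\<close> shifts. The best shift is no
  worse than the mean.\<close>

lemma good_shift:
  fixes \<pi> :: "('n::finite \<Rightarrow> nat) \<Rightarrow> 'n \<Rightarrow> nat"
  assumes "b > 0" "finite G"
  shows "\<exists>s<b. b * real (card {x\<in>G. \<exists>i. (\<pi> x i + s) div b \<noteq> (x i + s) div b})
    \<le> (\<Sum>x\<in>G. \<Sum>i\<in>UNIV. \<bar>real (\<pi> x i) - real (x i)\<bar>)"
proof -
  define A where "A s = {x\<in>G. \<exists>i. (\<pi> x i + s) div b \<noteq> (x i + s) div b}" for s
  define I where "I s x i = (if (\<pi> x i + s) div b \<noteq> (x i + s) div b then 1 else 0 :: real)" for s x i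
  have card_le: "real (card (A s)) \<le> (\<Sum>x\<in>G. \<Sum>i\<in>UNIV. I s x i)" for s
  proof -
    have "real (card (A s)) = (\<Sum>x\<in>G. if \<exists>i. (\<pi> x i + s) div b \<noteq> (x i + s) div b then 1 else 0)"
      using assms(2) by (simp add: A_def sum.If_cases Int_def conj_commute)
    also have "\<dots> \<le> (\<Sum>x\<in>G. \<Sum>i\<in>UNIV. I s x i)"
    proof (rule sum_mono)
      fix x
      have "1 \<le> (\<Sum>i\<in>UNIV. I s x i)" if "(\<pi> x j + s) div b \<noteq> (x j + s) div b" for j
        using member_le_sum[of j UNIV "I s x"] that by (auto simp: I_def)
      then show "(if \<exists>i. (\<pi> x i + s) div b \<noteq> (x i + s) div b then 1 else 0) \<le> (\<Sum>i\<in>UNIV. I s x i)"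
        by (auto simp: I_def intro: sum_nonneg)
    qed
    finally show ?thesis .
  qed
  have sumI: "(\<Sum>s<b. I s x i) \<le> \<bar>real (\<pi> x i) - real (x i)\<bar>" for x i
    using card_separating_shifts[OF assms(1), of "\<pi> x i" "x i"]
    by (simp add: I_def sum.If_cases Int_def conj_commute)
  have "(\<Sum>s<b. real (card (A s))) \<le> (\<Sum>s<b. \<Sum>x\<in>G. \<Sum>i\<in>UNIV. I s x i)"
    by (intro sum_mono card_le)
  also have "\<dots> = (\<Sum>x\<in>G. \<Sum>i\<in>UNIV. \<Sum>s<b. I s x i)"
    by (subst sum.swap, subst (2) sum.swap) simp
  also have "\<dots> \<le> (\<Sum>x\<in>G. \<Sum>i\<in>UNIV. \<bar>real (\<pi> x i) - real (x i)\<bar>)"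
    by (intro sum_mono sumI)
  finally have total: "(\<Sum>s<b. real (card (A s))) \<le> (\<Sum>x\<in>G. \<Sum>i\<in>UNIV. \<bar>real (\<pi> x i) - real (x i)\<bar>)" .
  define s where "s = arg_min_on (\<lambda>s. card (A s)) {..<b}"
  have s: "s < b" and min: "card (A s) \<le> card (A s')" if "s' < b" for s'
    using arg_min_least[of "{..<b}" s' "\<lambda>s. card (A s)"] arg_min_if_finite(1)[of "{..<b}" "\<lambda>s. card (A s)"]
      assms(1) that by (auto simp: s_def)
  have "b * real (card (A s)) = (\<Sum>s'<b. real (card (A s)))" by simp
  also have "\<dots> \<le> (\<Sum>s'<b. real (card (A s')))" using min by (intro sum_mono) auto
  finally show ?thesis using total s assms(1) unfolding A_def by fastforce
qed

lemma card_near_walls: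
  fixes b K t N :: nat
  assumes "N = K * b"
  shows "card {y. y < N \<and> (y mod b < t \<or> b - t \<le> y mod b)} \<le> K * (2 * t)"
proof -
  let ?S = "{y. y < N \<and> (y mod b < t \<or> b - t \<le> y mod b)}"
  let ?g = "\<lambda>y. (y div b, y mod b)"
  have "inj_on ?g ?S"
    by (rule inj_onI) (metis div_mod_decomp prod.inject)
  moreover have "?g ` ?S \<subseteq> {..<K} \<times> ({..<t} \<union> {b - t..<b})"
  proof (cases "b = 0")
    case False
    then show ?thesis using assms by (auto simp: less_mult_imp_div_less)
  qed (use assms in auto)
  ultimately have "card ?S \<le> card ({..<K} \<times> ({..<t} \<union> {b - t..<b}))"
    by (intro card_inj_on_le[where f="?g"]) auto
  also have "\<dots> = K * card ({..<t} \<union> {b - t..<b})" by (simp add: card_cartesian_product)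
  also have "card ({..<t} \<union> {b - t..<b}) \<le> t + t"
    by (rule order_trans[OF card_Un_le]) auto
  finally show ?thesis by (simp add: mult_2)
qed

lemma near_wall:
  fixes x y b t :: nat
  assumes "x div b \<noteq> y div b" "\<bar>real x - real y\<bar> \<le> t"
  shows "y mod b < t \<or> b - t \<le> y mod b"
proof (rule ccontr)
  assume "\<not> ?thesis"
  then have m: "t \<le> y mod b" "y mod b + t < b" by auto
  then have "b > 0" by simp
  have y: "y = (y div b) * b + y mod b" by simp
  have "(y div b) * b \<le> x" "x < (y div b) * b + b"
    using assms(2) m y by linarith+
  then have "x div b = y div b"
    by (intro div_nat_eqI) (simp_all add: mult.commute)
  with assms(1) show False by simp
qed

text \<open>An interval of the translated grid which sticks out of \<open>{0..<N}\<close> is cut down to a part of one interval of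
  the original grid.\<close>

lemma truncated_interval:
  fixes x y b s N :: nat
  assumes "s < b" "x < N" "y < N" "b dvd N" "(x + s) div b = (y + s) div b"
    "\<not> (s \<le> (x + s) div b * b \<and> ((x + s) div b + 1) * b \<le> s + N)"
  shows "x div b = y div b"
proof -
  obtain K where K: "N = K * b" using assms(4) by (metis dvdE mult.commute)
  define k where "k = (x + s) div b"
  have bnd: "k * b \<le> z + s" "z + s < k * b + b" if "k = (z + s) div b" for z
    using that assms(1) by (auto simp: dividend_less_div_times add.commute)
  note bx = bnd[OF k_def] and b_y = bnd[OF k_def[unfolded assms(5)]]
  \<comment> \<open>An interval that sticks out on the left has \<open>k = 0\<close> and lies below
    the first wall \<open>b\<close>. One that sticks out on the right starts after
    \<open>(K - 1) * b\<close>, since \<open>s < b\<close>, and its points below \<open>N\<close>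
    belong to the last interval.\<close>
  consider "k * b < s" | "s + N < (k + 1) * b"
    using assms(6) unfolding k_def by linarith
  then show ?thesis
  proof cases
    case 1
    with assms(1) have "k * b < 1 * b" by linarith
    then have "k < 1" unfolding mult_less_cancel2 by blast
    then have "k = 0" by simp
    with bx b_y show ?thesis by simp
  next
    case 2
    then have "K * b < (k + 1) * b" using K by linarith
    then have "K < k + 1" unfolding mult_less_cancel2 by blast
    then have "K \<le> k" by simp
    then have kb: "K * b \<le> k * b" by simp
    have "K > 0" using K assms(2) by (cases K) auto
    then have Kb: "K * b = (K - 1) * b + b" by (simp add: diff_mult_distrib)
    have "z div b = K - 1" if "K * b \<le> z + s" "z < N" for z
      using that K Kb assms(1) by (intro div_nat_eqI) (simp_all add: mult.commute)
    with kb bx b_y assms(2,3) show ?thesis by (metis order_trans)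
  qed
qed

section \<open>Realization by elementary movements\<close>

definition cube :: "nat \<Rightarrow> ('n::finite \<Rightarrow> nat) \<Rightarrow> (real^'n) set" where
  "cube N x = grid_box N x (\<lambda>i. x i + 1)"

definition offset :: "nat \<Rightarrow> ('n::finite \<Rightarrow> nat) \<Rightarrow> ('n \<Rightarrow> nat) \<Rightarrow> real^'n" where
  "offset N x y = (\<chi> i. (real (y i) - real (x i)) / real N)"

lemma tiling_eq: "tiling N = cube N ` grid N"
  by (auto simp: tiling_def cube_def grid_def)

lemma interior_grid_box:
  "p \<in> interior (grid_box N h h') \<longleftrightarrow> (\<forall>i. h i / N < p $ i \<and> p $ i < h' i / N)"
  by (simp add: grid_box_def mem_box_cart)

lemma interior_cube:
  "p \<in> interior (cube N x) \<longleftrightarrow> (\<forall>i. x i / N < p $ i \<and> p $ i < (real (x i) + 1) / N)"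
  by (simp add: cube_def interior_grid_box add.commute)

lemma mem_cube:
  "p \<in> cube N x \<longleftrightarrow> (\<forall>i. x i / N \<le> p $ i \<and> p $ i \<le> (real (x i) + 1) / N)"
  by (simp add: cube_def grid_box_def mem_box_cart add.commute)

lemma center_cube: "center (cube N x) = (\<chi> i. (2 * real (x i) + 1) / (2 * real N))"
  by (simp add: cube_def center_grid_box vec_eq_iff)

lemma center_cube_diff: "center (cube N y) - center (cube N x) = offset N x y"
proof -
  have "(2 * a + 1) / (2 * n) - (2 * b + 1) / (2 * n) = (a - b) / n" for a b n :: real
    by (cases "n = 0") (simp_all add: field_simps)
  then show ?thesis by (simp add: center_cube offset_def vec_eq_iff)
qed

lemma center_in_interior: "N > 0 \<Longrightarrow> center (cube N x) \<in> interior (cube N x)"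
  by (simp add: interior_cube center_cube field_simps)

lemma interior_cubes_disjoint:
  assumes "p \<in> interior (cube N x)" "p \<in> interior (cube N y)" "N > 0"
  shows "x = y"
proof
  fix i
  have "real (x i) / N < (real (y i) + 1) / N" "real (y i) / N < (real (x i) + 1) / N"
    using assms(1,2) unfolding interior_cube by (meson less_trans)+
  then have "real (x i) < real (y i) + 1" "real (y i) < real (x i) + 1"
    using assms(3) by (simp_all add: divide_less_cancel)
  then show "x i = y i" by linarith
qed

lemma cube_inject: "N > 0 \<Longrightarrow> cube N x = cube N y \<longleftrightarrow> x = y"
  by (metis center_in_interior interior_cubes_disjoint)

lemma cube_subset_unit_cube: "x \<in> grid N \<Longrightarrow> cube N x \<subseteq> unit_cube"
proof
  fix p assume x: "x \<in> grid N" and p: "p \<in> cube N x"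
  have "0 \<le> p $ i \<and> p $ i \<le> 1" for i
  proof
    have "0 \<le> real (x i) / N" by simp
    also have "\<dots> \<le> p $ i" using p by (simp add: mem_cube)
    finally show "0 \<le> p $ i" .
    have "Suc (x i) \<le> N" using x by (simp add: grid_def Suc_leI)
    then have "real (x i) + 1 \<le> N" by linarith
    then have "(real (x i) + 1) / N \<le> 1" by (simp add: divide_le_eq_1)
    then show "p $ i \<le> 1" using p unfolding mem_cube by (meson order_trans)
  qed
  then show "p \<in> unit_cube" by (simp add: unit_cube_def mem_box_cart)
qed

lemma add_offset_interior:
  "p + offset N x y \<in> interior (cube N y) \<longleftrightarrow> p \<in> interior (cube N x)"
  by (auto simp: interior_cube offset_def add_divide_distrib diff_divide_distrib algebra_simps)

lemma offset_self [simp]: "offset N x x = 0"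
  by (simp add: offset_def vec_eq_iff)

lemma offset_add: "offset N x y + offset N y z = offset N x z"
  by (simp add: offset_def vec_eq_iff diff_divide_distrib)

text \<open>The choice is unique because the open cubes are disjoint. On the walls, where the values
  are free, the identity is taken, so that the unit cube is mapped into itself.\<close>

definition cell_map :: "nat \<Rightarrow> (('n::finite \<Rightarrow> nat) \<Rightarrow> 'n \<Rightarrow> nat) \<Rightarrow> real^'n \<Rightarrow> real^'n" where
  "cell_map N f p = (if \<exists>x\<in>grid N. p \<in> interior (cube N x)
     then p + offset N (THE x. p \<in> interior (cube N x)) (f (THE x. p \<in> interior (cube N x))) else p)"

lemma cell_map_interior:
  assumes "N > 0" "x \<in> grid N" "p \<in> interior (cube N x)"
  shows "cell_map N f p = p + offset N x (f x)"
proof -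
  have "(THE x. p \<in> interior (cube N x)) = x"
    using assms interior_cubes_disjoint by blast
  with assms show ?thesis by (auto simp: cell_map_def)
qed

lemma cell_map_else:
  "(\<And>x. x \<in> grid N \<Longrightarrow> p \<notin> interior (cube N x)) \<Longrightarrow> cell_map N f p = p"
  by (auto simp: cell_map_def)

lemma cell_map_unit_cube:
  assumes "N > 0" "\<And>x. x \<in> grid N \<Longrightarrow> f x \<in> grid N" "p \<in> unit_cube"
  shows "cell_map N f p \<in> unit_cube"
proof (cases "\<exists>x\<in>grid N. p \<in> interior (cube N x)")
  case True
  then obtain x where x: "x \<in> grid N" "p \<in> interior (cube N x)" by blast
  then have "cell_map N f p \<in> interior (cube N (f x))"
    using assms(1) by (simp add: cell_map_interior add_offset_interior)
  then show ?thesis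
    using assms(2)[OF x(1)] cube_subset_unit_cube interior_subset by blast
next
  case False
  with assms(3) show ?thesis by (simp add: cell_map_else)
qed

text \<open>The cost is measured in the same unit as for \<open>flowable\<close>. The formula is
  required at every interior point, and interior points go to interior points, so flows can be
  concatenated without exceptional null sets.\<close>

definition realizable :: "nat \<Rightarrow> (('n::finite \<Rightarrow> nat) \<Rightarrow> 'n \<Rightarrow> nat) \<Rightarrow> real \<Rightarrow> bool" where
  "realizable N f c \<longleftrightarrow> (\<exists>F. discrete_flow N F \<and>
     flow_length N F \<le> c * real N powr (- 1 - real CARD('n) / 2) \<and>
     (\<forall>x\<in>grid N. f x \<in> grid N \<and>
        (\<forall>p\<in>interior (cube N x). fold (\<lambda>(D, Z) y. Z y) F p = p + offset N x (f x))))"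

lemma realizable_mono:
  assumes "realizable N f c" "c \<le> c'"
  shows "realizable N f c'"
proof -
  have "c * real N powr a \<le> c' * real N powr a" for a
    using assms(2) by (intro mult_right_mono) auto
  with assms(1) show ?thesis unfolding realizable_def by (meson order_trans)
qed

lemma realizable_cong:
  assumes "realizable N f c" "\<And>x. x \<in> grid N \<Longrightarrow> f x = g x"
  shows "realizable N g c"
  using assms by (simp add: realizable_def)

lemma realizable_id: "realizable N (\<lambda>x. x) 0"
  unfolding realizable_def
  by (rule exI[of _ "[]"]) (simp add: discrete_flow_def flow_length_def)

lemma realizable_comp:
  assumes "realizable N g c'" "realizable N f c"
  shows "realizable N (g \<circ> f) (c' + c)"
proof -
  from assms(1) obtain G where G: "discrete_flow N G"
    "flow_length N G \<le> c' * real N powr (- 1 - real CARD('a) / 2)"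
    "\<And>x. x \<in> grid N \<Longrightarrow> g x \<in> grid N"
    "\<And>x p. x \<in> grid N \<Longrightarrow> p \<in> interior (cube N x) \<Longrightarrow> fold (\<lambda>(D, Z) y. Z y) G p = p + offset N x (g x)"
    unfolding realizable_def by blast
  from assms(2) obtain F where F: "discrete_flow N F"
    "flow_length N F \<le> c * real N powr (- 1 - real CARD('a) / 2)"
    "\<And>x. x \<in> grid N \<Longrightarrow> f x \<in> grid N"
    "\<And>x p. x \<in> grid N \<Longrightarrow> p \<in> interior (cube N x) \<Longrightarrow> fold (\<lambda>(D, Z) y. Z y) F p = p + offset N x (f x)"
    unfolding realizable_def by blast
  have "discrete_flow N (F @ G)" using F(1) G(1) by (auto simp: discrete_flow_def)
  moreover have "flow_length N (F @ G) \<le> (c' + c) * real N powr (- 1 - real CARD('a) / 2)"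
    using F(2) G(2) by (simp add: flow_length_def distrib_right)
  moreover have "fold (\<lambda>(D, Z) y. Z y) (F @ G) p = p + offset N x ((g \<circ> f) x)"
    if "x \<in> grid N" "p \<in> interior (cube N x)" for x p
    using that F(3,4)[OF that(1)] G(4)[of "f x" "p + offset N x (f x)"]
    by (simp add: add_offset_interior add.assoc offset_add)
  ultimately show ?thesis
    unfolding realizable_def using F(3) G(3) by (intro exI[of _ "F @ G"]) auto
qed

section \<open>Nested couples of a symmetric set of positions\<close>

lemma rev_filter_symmetric:
  fixes n :: nat
  assumes "\<And>t. t < n \<Longrightarrow> P (n - 1 - t) \<longleftrightarrow> P t"
  shows "rev (filter P [0..<n]) = map (\<lambda>t. n - 1 - t) (filter P [0..<n])"
proof -
  have r: "rev [0..<n] = map (\<lambda>t. n - 1 - t) [0..<n]"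
    by (rule nth_equalityI) (auto simp: rev_nth)
  have "rev (filter P [0..<n]) = map (\<lambda>t. n - 1 - t) (filter (P \<circ> (\<lambda>t. n - 1 - t)) [0..<n])"
    by (simp add: rev_filter r filter_map)
  also have "filter (P \<circ> (\<lambda>t. n - 1 - t)) [0..<n] = filter P [0..<n]"
    using assms by (intro filter_cong) auto
  finally show ?thesis .
qed

text \<open>Reversing the increasing list of a symmetric set reflects its entries. So the couples
  formed by pairing entries from both ends of the index list are pairs of mirror images in the
  array.\<close>

lemma symmetric_filter_nth:
  fixes n :: nat
  assumes "\<And>t. t < n \<Longrightarrow> P (n - 1 - t) \<longleftrightarrow> P t" "j < length (filter P [0..<n])"
  shows "filter P [0..<n] ! (length (filter P [0..<n]) - 1 - j) = n - 1 - filter P [0..<n] ! j"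
proof -
  have "rev (filter P [0..<n]) ! j = n - 1 - filter P [0..<n] ! j"
    using assms(2) by (subst rev_filter_symmetric[of n P]) (use assms(1) in simp_all)
  then show ?thesis using assms(2) by (simp add: rev_nth)
qed

text \<open>The middle entry of a list of odd length would be fixed by the reflection, which has no
  fixed point when \<open>n\<close> is even.\<close>

lemma symmetric_filter_even:
  fixes n :: nat
  assumes "\<And>t. t < n \<Longrightarrow> P (n - 1 - t) \<longleftrightarrow> P t" "even n"
  shows "even (length (filter P [0..<n]))"
proof (rule ccontr)
  let ?ps = "filter P [0..<n]"
  assume o: "odd (length ?ps)"
  then obtain j where j: "length ?ps = 2 * j + 1" by (metis oddE)
  have "?ps ! (length ?ps - 1 - j) = n - 1 - ?ps ! j"
    using symmetric_filter_nth[of n P j] assms(1) j by simp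
  then have "?ps ! j = n - 1 - ?ps ! j" using j by simp
  moreover have "?ps ! j \<in> set ?ps" using j by (intro nth_mem) simp
  then have "?ps ! j < n" by simp
  ultimately have "2 * (?ps ! j) + 1 = n" by linarith
  with assms(2) show False by presburger
qed

text \<open>The grid after translation by \<open>s\<close>. Translating the points instead of the
  coarse grid puts the walls of the translated grid at multiples of \<open>2 ^ m\<close>, and all
  coordinates remain natural numbers.\<close>

definition region :: "('n \<Rightarrow> nat) \<Rightarrow> nat \<Rightarrow> ('n \<Rightarrow> nat) set" where
  "region s N = {z. \<forall>i. s i \<le> z i \<and> z i < s i + N}"

definition shift :: "('n \<Rightarrow> nat) \<Rightarrow> ('n \<Rightarrow> nat) \<Rightarrow> 'n \<Rightarrow> nat" where
  "shift s x = (\<lambda>i. x i + s i)"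

definition unshift :: "('n \<Rightarrow> nat) \<Rightarrow> ('n \<Rightarrow> nat) \<Rightarrow> 'n \<Rightarrow> nat" where
  "unshift s z = (\<lambda>i. z i - s i)"

lemma unshift_shift [simp]: "unshift s (shift s x) = x"
  by (simp add: shift_def unshift_def)

lemma shift_unshift: "z \<in> region s N \<Longrightarrow> shift s (unshift s z) = z"
  by (simp add: shift_def unshift_def region_def fun_eq_iff)

lemma shift_in_region: "shift s x \<in> region s N \<longleftrightarrow> x \<in> grid N"
  by (auto simp: shift_def region_def grid_def)

lemma unshift_in_grid: "z \<in> region s N \<Longrightarrow> unshift s z \<in> grid N"
  using shift_in_region[of s "unshift s z" N] by (simp add: shift_unshift)

lemma fun_upd_line_in:
  fixes z :: "'n \<Rightarrow> nat"
  assumes "2 ^ k dvd z d" "t < 2 ^ k"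
  shows "line d k (z(d := z d + t)) = line d k z"
    and "reflect d k (z(d := z d + t)) = z(d := z d + (2 ^ k - 1 - t))"
proof -
  obtain a where a: "z d = 2 ^ k * a" using assms(1) by (elim dvdE)
  show "line d k (z(d := z d + t)) = line d k z"
    using assms(2) by (auto simp: line_def a)
  show "reflect d k (z(d := z d + t)) = z(d := z d + (2 ^ k - 1 - t))"
    using assms(2) by (simp add: reflect_def mirror_def a mult.commute)
qed

lemma array_cubes_line:
  fixes z :: "'n::finite \<Rightarrow> nat"
  assumes N: "N > 0" and z: "\<And>i. i \<noteq> d \<Longrightarrow> x i < N" "x d + l \<le> N" and l: "l > 0"
  shows "array_cubes N (map (\<lambda>t. cube N (x(d := x d + t))) [0..<l])"
    and "(\<Union>(set (map (\<lambda>t. cube N (x(d := x d + t))) [0..<l])))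
      \<subseteq> grid_box N x (\<lambda>i. if i = d then x d + l else x i + 1)"
proof -
  let ?h = "\<lambda>i. if i = d then x d + l else x i + 1"
  let ?A = "grid_box N x ?h"
  have arr: "is_array N ?A"
    unfolding is_array_def using z l by (intro exI[of _ x] exI[of _ ?h] exI[of _ d]) (auto simp: Suc_leI)
  have sub: "cube N y \<subseteq> ?A \<longleftrightarrow> (\<forall>i. x i \<le> y i \<and> y i < ?h i)" for y
  proof -
    have "cube N y \<subseteq> ?A \<longleftrightarrow> (\<forall>i. x i / N \<le> y i / N \<and> real (y i + 1) / N \<le> ?h i / N)"
      unfolding cube_def grid_box_def
      by (subst subset_interval_cart) (auto simp: divide_right_mono field_simps N)
    also have "\<dots> \<longleftrightarrow> (\<forall>i. x i \<le> y i \<and> y i < ?h i)"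
      using N by (intro all_cong1) (auto simp: divide_le_cancel Suc_le_eq simp flip: of_nat_Suc)
    finally show ?thesis .
  qed
  have in_iff: "(\<forall>i. x i \<le> y i \<and> y i < ?h i) \<longleftrightarrow> (\<exists>t<l. y = x(d := x d + t))" for y
  proof
    assume y: "\<forall>i. x i \<le> y i \<and> y i < ?h i"
    have "y i = x i" if "i \<noteq> d" for i using y[rule_format, of i] that by simp
    moreover have "x d \<le> y d" "y d < x d + l" using y[rule_format, of d] by simp_all
    ultimately show "\<exists>t<l. y = x(d := x d + t)"
      by (intro exI[of _ "y d - x d"]) (auto simp: fun_eq_iff)
  qed auto
  have set: "set (map (\<lambda>t. cube N (x(d := x d + t))) [0..<l]) = {\<kappa> \<in> tiling N. \<kappa> \<subseteq> ?A}"
  proof (intro equalityI subsetI)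
    fix \<kappa> assume "\<kappa> \<in> set (map (\<lambda>t. cube N (x(d := x d + t))) [0..<l])"
    then obtain t where t: "t < l" "\<kappa> = cube N (x(d := x d + t))" by auto
    have "x(d := x d + t) \<in> grid N" using t(1) z by (auto simp: grid_def)
    then show "\<kappa> \<in> {\<kappa> \<in> tiling N. \<kappa> \<subseteq> ?A}"
      unfolding t(2) using in_iff[of "x(d := x d + t)"] t(1) sub by (auto simp: tiling_eq)
  next
    fix \<kappa> assume "\<kappa> \<in> {\<kappa> \<in> tiling N. \<kappa> \<subseteq> ?A}"
    then obtain y where "\<kappa> = cube N y" "cube N y \<subseteq> ?A" by (auto simp: tiling_eq)
    then show "\<kappa> \<in> set (map (\<lambda>t. cube N (x(d := x d + t))) [0..<l])"
      using sub in_iff by auto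
  qed
  have "distinct (map (\<lambda>t. cube N (x(d := x d + t))) [0..<l])"
    by (auto simp: distinct_map inj_on_def cube_inject N dest!: fun_cong[of _ _ d])
  moreover have "sorted_wrt (\<lambda>\<kappa> \<kappa>'. center \<kappa> \<le> center \<kappa>') (map (\<lambda>t. cube N (x(d := x d + t))) [0..<l])"
    unfolding sorted_wrt_iff_nth_less
    by (auto simp: center_cube less_eq_vec_def divide_right_mono)
  ultimately show "array_cubes N (map (\<lambda>t. cube N (x(d := x d + t))) [0..<l])"
    unfolding array_cubes_def using arr set by blast
  show "(\<Union>(set (map (\<lambda>t. cube N (x(d := x d + t))) [0..<l]))) \<subseteq> ?A"
    unfolding set by blast
qed

text \<open>All blocks that meet \<open>S\<close> serve as the arrays of one movement, and the
  symmetric set of positions of \<open>S\<close> in a block gives its swapping indices. With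
  \<open>k > 0\<close> the blocks have even length, hence the index lists do too.\<close>

lemma realizable_swap_on:
  fixes S :: "('n::finite \<Rightarrow> nat) set"
  assumes N: "N > 0" and S: "finite S" "reflect d k ` S \<subseteq> S" "\<forall>z\<in>S. line d k z \<subseteq> region s N"
    and k: "k > 0"
  shows "realizable N (\<lambda>x. unshift s (swap_on d k S (shift s x))) (2 ^ k * sqrt (card S))"
proof -
  define l where "l = (2::nat) ^ k"
  have l: "l > 0" "even l" using k by (simp_all add: l_def)
  define row where "row z t = z(d := z d + t)" for z :: "'n \<Rightarrow> nat" and t
  \<comment> \<open>The first point of the block through \<open>z\<close>; \<open>B\<close> then
    contains one representative of each block, so no array occurs twice.\<close>
  define base where "base z = z(d := l * (z d div l))" for z :: "'n \<Rightarrow> nat"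
  define B where "B = base ` S"
  have row_base: "row (base z) (z d mod l) = z" for z
    by (simp add: row_def base_def fun_eq_iff)
  have finB: "finite B" using S(1) by (simp add: B_def)
  obtain zs where zs: "set zs = B" "distinct zs" using finite_distinct_list[OF finB] by blast
  have dvdB: "l dvd z d" if "z \<in> B" for z using that by (auto simp: B_def base_def)
  have rowR: "row z t \<in> region s N" and reflect_row: "reflect d k (row z t) = row z (l - 1 - t)"
    if "z \<in> B" "t < l" for z t
  proof -
    note dv = dvdB[OF that(1), unfolded l_def] and t = that(2)[unfolded l_def]
    from that(1) obtain w where w: "z = base w" "w \<in> S" unfolding B_def by (rule imageE)
    have "w d mod l < 2 ^ k" unfolding l_def by simp
    from fun_upd_line_in(1)[of k z d, OF dv this] have "line d k w = line d k z"
      using row_base[of w] unfolding w(1)[symmetric] row_def by simp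
    also have "\<dots> = line d k (row z t)" using fun_upd_line_in(1)[of k z d, OF dv t] by (simp add: row_def)
    finally have "row z t \<in> line d k w" by (simp add: line_def)
    then show "row z t \<in> region s N" using S(3) w(2) by blast
    show "reflect d k (row z t) = row z (l - 1 - t)"
      using fun_upd_line_in(2)[of k z d, OF dv t] by (simp add: row_def l_def)
  qed
  have S_sym: "row z (l - 1 - t) \<in> S \<longleftrightarrow> row z t \<in> S" if "z \<in> B" "t < l" for z t
    using S(2) reflect_row[OF that] by (metis image_subset_iff reflect_reflect)
  define ks where "ks z = map (\<lambda>t. cube N (unshift s (row z t))) [0..<l]" for z
  define ps where "ps z = filter (\<lambda>t. row z t \<in> S) [0..<l]" for z
  define D where "D = map (\<lambda>z. (ks z, ps z)) zs"
  have start: "s d \<le> z d" "\<And>i. unshift s z i < N" "unshift s z d + l \<le> N" if "z \<in> B" for z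
  proof -
    have "row z 0 \<in> region s N" "row z (l - 1) \<in> region s N" using rowR that l(1) by simp_all
    then have r: "z \<in> region s N" "z d + (l - 1) < s d + N"
      by (auto simp: row_def region_def dest!: spec[of _ d])
    then show "s d \<le> z d" "\<And>i. unshift s z i < N"
      using unshift_in_grid[OF r(1)] by (auto simp: region_def grid_def)
    with r(2) l(1) show "unshift s z d + l \<le> N" by (simp add: unshift_def)
  qed
  have unshift_row: "unshift s (row z t) = (unshift s z)(d := unshift s z d + t)" if "z \<in> B" for z t
    using start(1)[OF that] by (auto simp: unshift_def row_def)
  have ks_eq: "ks z = map (\<lambda>t. cube N ((unshift s z)(d := unshift s z d + t))) [0..<l]" if "z \<in> B" for z
    by (simp add: ks_def unshift_row[OF that])
  have arr: "array_cubes N (ks z)" if "z \<in> B" for z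
    unfolding ks_eq[OF that] using start[OF that] N l(1) by (intro array_cubes_line) auto
  have sw: "swapping_indices (ks z) (ps z)" if "z \<in> B" for z
    using symmetric_filter_even[of l "\<lambda>t. row z t \<in> S"] S_sym[OF that] l(2)
    by (simp add: swapping_indices_def ps_def ks_def sorted_wrt_filter)
  \<comment> \<open>A common interior point gives strict inequalities in every coordinate. Across
    direction \<open>d\<close> they force equality of the integers; along \<open>d\<close> the two
    bases are multiples of \<open>l\<close> less than \<open>l\<close> apart.\<close>
  have disj: "interior (\<Union>(set (ks z))) \<inter> interior (\<Union>(set (ks z'))) = {}"
    if B: "z \<in> B" "z' \<in> B" and ne: "z \<noteq> z'" for z z'
  proof (rule ccontr)
    assume "interior (\<Union>(set (ks z))) \<inter> interior (\<Union>(set (ks z'))) \<noteq> {}"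
    then obtain p where p: "p \<in> interior (\<Union>(set (ks z)))" "p \<in> interior (\<Union>(set (ks z')))" by blast
    have bd: "unshift s z i / N < p $ i \<and> p $ i < real (if i = d then unshift s z d + l else unshift s z i + 1) / N"
      if "z \<in> B" "p \<in> interior (\<Union>(set (ks z)))" for z i
    proof -
      have "(\<Union>(set (ks z))) \<subseteq> grid_box N (unshift s z) (\<lambda>i. if i = d then unshift s z d + l else unshift s z i + 1)"
        unfolding ks_eq[OF that(1)] using start[OF that(1)] N l(1) by (intro array_cubes_line) auto
      from interior_mono[OF this] that(2) show ?thesis
        unfolding interior_grid_box[symmetric] by (metis (no_types, lifting) interior_grid_box subsetD)
    qed
    have lt: "unshift s z i < (if i = d then unshift s z' d + l else unshift s z' i + 1)"
      if "z \<in> B" "z' \<in> B" "p \<in> interior (\<Union>(set (ks z)))" "p \<in> interior (\<Union>(set (ks z')))" for z z' i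
    proof -
      have "unshift s z i / N < real (if i = d then unshift s z' d + l else unshift s z' i + 1) / N"
        using bd[OF that(1,3), of i] bd[OF that(2,4), of i] by linarith
      then show ?thesis using N by (simp add: divide_less_cancel)
    qed
    note lts = lt[OF B p] lt[OF B(2,1) p(2,1)]
    have zR: "s i \<le> z i" "s i \<le> z' i" for i
      using rowR[OF B(1) l(1)] rowR[OF B(2) l(1)] by (auto simp: region_def row_def fun_upd_idem)
    have "z i = z' i" for i
    proof (cases "i = d")
      case False
      then show ?thesis using lts[of i] zR[of i] by (simp add: unshift_def)
    next
      case True
      have "z d < z' d + l" "z' d < z d + l"
        using lts[of d] zR[of d] by (simp_all add: unshift_def)
      moreover obtain a a' where a: "z d = l * a" "z' d = l * a'"
        using dvdB B by (meson dvdE)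
      ultimately have "l * a < l * (a' + 1)" "l * a' < l * (a + 1)" by simp_all
      then have "a = a'" unfolding mult_less_cancel1 by linarith
      with True a show ?thesis by simp
    qed
    with ne show False by blast
  qed
  have valid: "valid_movement_data N D"
    unfolding valid_movement_data_def
  proof
    show "\<forall>(\<kappa>s, ps)\<in>set D. array_cubes N \<kappa>s \<and> swapping_indices \<kappa>s ps"
      using arr sw by (auto simp: D_def zs(1))
    show "sorted_wrt (\<lambda>(\<kappa>s, _) (\<kappa>s', _). interior (\<Union> (set \<kappa>s)) \<inter> interior (\<Union> (set \<kappa>s')) = {}) D"
      unfolding sorted_wrt_iff_nth_less D_def
    proof (intro allI impI)
      fix i j assume ij: "i < j" "j < length (map (\<lambda>z. (ks z, ps z)) zs)"
      then have "zs ! i \<noteq> zs ! j" "zs ! i \<in> B" "zs ! j \<in> B"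
        using zs by (auto simp: nth_eq_iff_index_eq)
      with ij disj show "(case map (\<lambda>z. (ks z, ps z)) zs ! i of (\<kappa>s, _) \<Rightarrow> \<lambda>(\<kappa>s', _).
          interior (\<Union> (set \<kappa>s)) \<inter> interior (\<Union> (set \<kappa>s')) = {}) (map (\<lambda>z. (ks z, ps z)) zs ! j)"
        by simp
    qed
  qed
  define g where "g x = unshift s (swap_on d k S (shift s x))" for x
  define Z where "Z = cell_map N g"
  have SR: "S \<subseteq> region s N"
  proof
    fix z assume "z \<in> S"
    then have "base z \<in> B" by (simp add: B_def)
    from rowR[OF this, of "z d mod l"] show "z \<in> region s N" by (simp add: row_base l(1))
  qed
  have g_fix: "g x = x" if "shift s x \<notin> S" for x
    using that by (simp add: g_def swap_on_def)
  have g_grid: "g x \<in> grid N" if "x \<in> grid N" for x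
  proof (cases "shift s x \<in> S")
    case True
    then have "swap_on d k S (shift s x) \<in> S" using S(2) by (auto simp: swap_on_def)
    then show ?thesis unfolding g_def using SR unshift_in_grid by blast
  qed (use that g_fix in simp)
  have couple: "\<exists>z\<in>B. \<exists>t<l. row z t \<in> S \<and> \<kappa> = cube N (unshift s (row z t))
      \<and> \<kappa>' = cube N (unshift s (row z (l - 1 - t)))"
    if "(\<kappa>, \<kappa>') \<in> movement_couples D" for \<kappa> \<kappa>'
  proof -
    from that obtain z where z: "z \<in> B" "(\<kappa>, \<kappa>') \<in> swapping_couples (ks z) (ps z)"
      by (auto simp: movement_couples_def D_def zs(1))
    then obtain j where j: "j < num_couples (ps z)" "\<kappa> = ks z ! (ps z ! j)"
        "\<kappa>' = ks z ! (ps z ! (length (ps z) - 1 - j))"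
      by (auto simp: swapping_couples_def)
    then have jl: "j < length (ps z)" by (simp add: num_couples_def)
    have eq: "ps z ! (length (ps z) - 1 - j) = l - 1 - ps z ! j"
      using symmetric_filter_nth[of l "\<lambda>t. row z t \<in> S" j] S_sym[OF z(1)] jl by (simp add: ps_def)
    have "ps z ! j \<in> set (ps z)" using jl by (rule nth_mem)
    then have t: "ps z ! j < l" "row z (ps z ! j) \<in> S" by (simp_all add: ps_def)
    then show ?thesis
      using z(1) j(2,3) unfolding eq by (intro bexI[of _ z] exI[of _ "ps z ! j"]) (auto simp: ks_def)
  qed
  have g_row: "g (unshift s (row z t)) = unshift s (row z (l - 1 - t))"
    if "z \<in> B" "t < l" "row z t \<in> S" for z t
    using that reflect_row[OF that(1,2)]
    by (simp add: g_def shift_unshift[OF rowR[OF that(1,2)]] swap_on_def)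
  have Z_row: "Z p = p + center (cube N (unshift s (row z (l - 1 - t)))) - center (cube N (unshift s (row z t)))"
    if "z \<in> B" "t < l" "row z t \<in> S" "p \<in> interior (cube N (unshift s (row z t)))" for z t p
    using cell_map_interior[OF N unshift_in_grid[OF rowR[OF that(1,2)]] that(4), of g]
    unfolding g_row[OF that(1-3)] Z_def by (simp add: center_cube_diff[symmetric])
  have Z_couple: "(\<forall>x\<in>interior \<kappa>. Z x = x + center \<kappa>' - center \<kappa>) \<and>
        (\<forall>x\<in>interior \<kappa>'. Z x = x + center \<kappa> - center \<kappa>')"
    if "(\<kappa>, \<kappa>') \<in> movement_couples D" for \<kappa> \<kappa>'
  proof -
    from couple[OF that] obtain z t where zt: "z \<in> B" "t < l" "row z t \<in> S"
        "\<kappa> = cube N (unshift s (row z t))" "\<kappa>' = cube N (unshift s (row z (l - 1 - t)))"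
      by blast
    have t': "l - 1 - t < l" "l - 1 - (l - 1 - t) = t" using zt(2) by simp_all
    have "row z (l - 1 - t) \<in> S" using S_sym[OF zt(1,2)] zt(3) by simp
    from Z_row[OF zt(1) t'(1) this] Z_row[OF zt(1-3)] show ?thesis
      unfolding zt(4,5) t'(2) by blast
  qed
  have Z_fix: "Z p = p" if p: "p \<notin> (\<Union>(\<kappa>, \<kappa>')\<in>movement_couples D. \<kappa> \<union> \<kappa>')" for p
  proof (cases "\<exists>x\<in>grid N. p \<in> interior (cube N x)")
    case True
    then obtain x where x: "x \<in> grid N" "p \<in> interior (cube N x)" by blast
    have "shift s x \<notin> S"
    proof
      assume xS: "shift s x \<in> S"
      define z where "z = base (shift s x)"
      define t where "t = shift s x d mod l"
      have z: "z \<in> B" and t: "t < l" using xS l(1) by (simp_all add: z_def B_def t_def)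
      have row: "row z t = shift s x" unfolding z_def t_def by (rule row_base)
      have "t \<in> set (ps z)" using t xS by (simp add: ps_def row)
      then obtain j where j: "j < length (ps z)" "ps z ! j = t" by (metis in_set_conv_nth)
      have ksx: "ks z ! t = cube N x" using t by (simp add: ks_def row)
      have ev: "even (length (ps z))" using sw[OF z] by (simp add: swapping_indices_def)
      have "\<exists>\<kappa> \<kappa>'. (\<kappa>, \<kappa>') \<in> swapping_couples (ks z) (ps z) \<and> (cube N x = \<kappa> \<or> cube N x = \<kappa>')"
      proof (cases "j < length (ps z) div 2")
        case True
        then show ?thesis unfolding swapping_couples_def num_couples_def using j ksx by blast
      next
        case False
        \<comment> \<open>An entry in the second half of the index list is the second member of the
          couple counted from the other end; as the length is even, no middle entry remains
          unpaired.\<close>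
        let ?j = "length (ps z) - 1 - j"
        have "?j < length (ps z) div 2" "length (ps z) - 1 - ?j = j" using False j(1) ev by (auto elim: evenE)
        moreover from this have "cube N x = ks z ! (ps z ! (length (ps z) - 1 - ?j))" using j ksx by simp
        ultimately show ?thesis unfolding swapping_couples_def num_couples_def by blast
      qed
      then obtain \<kappa> \<kappa>' where "(\<kappa>, \<kappa>') \<in> movement_couples D" "cube N x = \<kappa> \<or> cube N x = \<kappa>'"
        using z by (force simp: movement_couples_def D_def zs(1))
      moreover have "p \<in> cube N x" using x(2) interior_subset by blast
      ultimately show False using p by blast
    qed
    then show ?thesis
      using x N by (simp add: Z_def cell_map_interior g_fix)
  next
    case False
    then show ?thesis by (simp add: Z_def cell_map_else)
  qed
  have Z_unit: "Z \<in> unit_cube \<rightarrow> unit_cube"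
    unfolding Z_def by (intro funcsetI cell_map_unit_cube N g_grid)
  have em: "elementary_movement N D Z"
    unfolding elementary_movement_def
  proof (intro conjI valid Z_unit)
    show "\<forall>(\<kappa>, \<kappa>')\<in>movement_couples D. (\<forall>x\<in>interior \<kappa>. Z x = x + center \<kappa>' - center \<kappa>) \<and>
        (\<forall>x\<in>interior \<kappa>'. Z x = x + center \<kappa> - center \<kappa>')"
      by (intro ballI, clarify) (rule Z_couple)
    show "\<forall>x\<in>unit_cube - (\<Union>(\<kappa>, \<kappa>')\<in>movement_couples D. \<kappa> \<union> \<kappa>'). Z x = x"
      by (intro ballI Z_fix) (elim DiffE)
  qed
  \<comment> \<open>Bounding the couples of an array by all its swapped positions is enough: the
    pairs of block and position inject into \<open>S\<close>.\<close>
  have len: "(\<Sum>(\<kappa>s, ps)\<leftarrow>D. real (num_couples ps)) \<le> card S"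
  proof -
    have "(\<Sum>(\<kappa>s, ps)\<leftarrow>D. real (num_couples ps)) = (\<Sum>z\<in>B. real (num_couples (ps z)))"
      by (simp add: D_def o_def sum_list_distinct_conv_sum_set zs)
    also have "\<dots> \<le> (\<Sum>z\<in>B. real (card {t. t < l \<and> row z t \<in> S}))"
    proof (rule sum_mono)
      fix z
      have "card (set (ps z)) = length (ps z)" by (rule distinct_card) (simp add: ps_def)
      moreover have "set (ps z) = {t. t < l \<and> row z t \<in> S}" by (auto simp: ps_def)
      ultimately show "real (num_couples (ps z)) \<le> real (card {t. t < l \<and> row z t \<in> S})"
        by (simp add: num_couples_def)
    qed
    also have "\<dots> = real (card (SIGMA z:B. {t. t < l \<and> row z t \<in> S}))"
      using finB by (simp add: card_SigmaI)
    also have "\<dots> \<le> real (card S)"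
    proof -
      have "inj_on (\<lambda>(z, t). row z t) (SIGMA z:B. {t. t < l \<and> row z t \<in> S})"
      proof (rule inj_onI, clarify)
        fix z t z' t' assume a: "z \<in> B" "z' \<in> B" "t < l" "t' < l" "row z t = row z' t'"
        obtain u u' where u: "z d = l * u" "z' d = l * u'" using dvdB a(1,2) by (meson dvdE)
        have e: "l * u + t = l * u' + t'" using fun_cong[OF a(5), of d] by (simp add: row_def u)
        have "u = (l * u + t) div l" "u' = (l * u' + t') div l" using a(3,4) by simp_all
        then have uu: "u = u'" using e by simp
        then have "z i = z' i" for i
          using fun_cong[OF a(5), of i] u by (cases "i = d") (auto simp: row_def)
        then show "z = z' \<and> t = t'" using e uu by auto
      qed
      then show ?thesis
        using S(1) by (intro of_nat_mono card_inj_on_le) auto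
    qed
    finally show ?thesis .
  qed
  \<comment> \<open>All arrays have length \<open>l\<close>. Only an upper bound is claimed, as the
    maximum is the inserted 0 when \<open>S\<close> is empty.\<close>
  have "Max (insert 0 ((\<lambda>(\<kappa>s, ps). length \<kappa>s) ` set D)) \<le> l"
    by (rule Max.boundedI) (auto simp: D_def ks_def)
  then have "movement_cost N D \<le> real l * real N powr (- 1 - real CARD('n) / 2) * sqrt (card S)"
    unfolding movement_cost_def using len by (intro mult_mono real_sqrt_le_mono) (auto intro!: real_sqrt_ge_zero sum_list_nonneg)
  then have "flow_length N [(D, Z)] \<le> 2 ^ k * sqrt (card S) * real N powr (- 1 - real CARD('n) / 2)"
    by (simp add: flow_length_def l_def mult_ac)
  moreover have "discrete_flow N [(D, Z)]" using em by (simp add: discrete_flow_def)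
  moreover have "fold (\<lambda>(D, Z) y. Z y) [(D, Z)] p = p + offset N x (g x)"
    if "x \<in> grid N" "p \<in> interior (cube N x)" for x p
    using that N by (simp add: Z_def cell_map_interior)
  ultimately show ?thesis
    unfolding realizable_def g_def[symmetric] using g_grid by (intro exI[of _ "[(D, Z)]"]) blast
qed

text \<open>Reflection of blocks of length one is the identity and is realized by the empty flow; it
  is treated apart because its index lists could have odd length. Invariance of the region is
  carried through the induction so that \<open>shift\<close> undoes \<open>unshift\<close> at the
  intermediate points.\<close>

lemma realizable_flowable:
  assumes "flowable (region s N) f c" "N > 0"
  shows "realizable N (\<lambda>x. unshift s (f (shift s x))) c \<and> f ` region s N \<subseteq> region s N"
  using assms(1)
proof induction
  case flowable_id
  then show ?case using realizable_id by simp
next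
  case (flowable_step f c S d k)
  have step: "realizable N (\<lambda>x. unshift s (swap_on d k S (shift s x))) (2 ^ k * sqrt (card S))
    \<and> swap_on d k S ` region s N \<subseteq> region s N"
  proof (cases "k = 0")
    case True
    then have "swap_on d k S z = z" for z
      by (simp add: swap_on_def reflect_def mirror_def)
    then show ?thesis using realizable_mono[OF realizable_id, of "2 ^ k * sqrt (card S)"] by simp
  next
    case False
    have "z \<in> line d k z" for z by (simp add: line_def)
    then have "S \<subseteq> region s N" using flowable_step.hyps(4) by blast
    then have "swap_on d k S ` region s N \<subseteq> region s N"
      using flowable_step.hyps(3) by (auto simp: swap_on_def)
    with realizable_swap_on[OF assms(2) flowable_step.hyps(2-4)] False show ?thesis by simp
  qed
  have "unshift s (swap_on d k S (shift s (unshift s (f (shift s x))))) = unshift s ((swap_on d k S \<circ> f) (shift s x))"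
    if "x \<in> grid N" for x
  proof -
    have "f (shift s x) \<in> region s N" using flowable_step.IH that shift_in_region by blast
    then show ?thesis by (simp add: shift_unshift)
  qed
  with realizable_comp[OF conjunct1[OF step] conjunct1[OF flowable_step.IH]]
  have "realizable N (\<lambda>x. unshift s ((swap_on d k S \<circ> f) (shift s x))) (2 ^ k * sqrt (card S) + c)"
    by (elim realizable_cong) simp
  moreover have "(swap_on d k S \<circ> f) ` region s N \<subseteq> region s N"
    using step flowable_step.IH by auto
  ultimately show ?case ..
qed

section \<open>Permutations of the grid as discrete flows\<close>

text \<open>In translated coordinates \<open>f\<close>, extended by the identity off the region, is
  a bijection of the whole lattice to which \<open>route\<close> applies; a box of equal sides has
  \<open>box_size\<close> equal to \<open>CARD('n) * 2 ^ m\<close>. The translation may depend on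
  the direction, since later only some directions will be translated.\<close>

lemma realizable_permutation:
  fixes f :: "('n::finite \<Rightarrow> nat) \<Rightarrow> 'n \<Rightarrow> nat"
  assumes N: "N > 0" and f: "bij_betw f (grid N) (grid N)"
    and boxes: "\<And>x i. x \<in> grid N \<Longrightarrow> (f x i + s i) div 2 ^ m = (x i + s i) div 2 ^ m"
    and full: "\<And>x i. x \<in> grid N \<Longrightarrow> f x \<noteq> x \<Longrightarrow>
      s i \<le> (x i + s i) div 2 ^ m * 2 ^ m \<and> ((x i + s i) div 2 ^ m + 1) * 2 ^ m \<le> s i + N"
  shows "realizable N f (24 * (real CARD('n))\<^sup>2 * 2 ^ m * sqrt (card {x\<in>grid N. f x \<noteq> x}))"
proof -
  define R where "R = region s N"
  define \<sigma> where "\<sigma> z = (if z \<in> R then shift s (f (unshift s z)) else z)" for z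
  have shift_bij: "bij_betw (shift s) (grid N) R" and unshift_bij: "bij_betw (unshift s) R (grid N)"
    unfolding R_def
    by (rule bij_betw_byWitness[of _ "unshift s"] bij_betw_byWitness[of _ "shift s"];
        auto simp: shift_unshift unshift_in_grid shift_in_region)+
  have "bij_betw (shift s \<circ> (f \<circ> unshift s)) R R"
    by (rule bij_betw_trans[OF bij_betw_trans[OF unshift_bij f] shift_bij])
  then have "bij_betw \<sigma> R R" by (rule iffD1[OF bij_betw_cong, rotated]) (simp add: \<sigma>_def)
  moreover have "bij_betw \<sigma> (- R) (- R)"
    using bij_betw_id[of "- R"] by (rule iffD1[OF bij_betw_cong, rotated]) (simp add: \<sigma>_def)
  ultimately have "bij_betw \<sigma> (R \<union> - R) (R \<union> - R)"
    by (rule bij_betw_combine) blast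
  then have b\<sigma>: "bij \<sigma>" by simp
  have moved: "z \<in> R \<and> unshift s z \<in> grid N \<and> f (unshift s z) \<noteq> unshift s z" if "\<sigma> z \<noteq> z" for z
  proof -
    have z: "z \<in> R" using that by (auto simp: \<sigma>_def)
    then have "shift s (unshift s z) = z" by (simp add: R_def shift_unshift)
    with z that show ?thesis by (auto simp: \<sigma>_def R_def unshift_in_grid)
  qed
  have supp: "{z. \<sigma> z \<noteq> z} \<subseteq> shift s ` {x\<in>grid N. f x \<noteq> x}"
  proof
    fix z assume "z \<in> {z. \<sigma> z \<noteq> z}"
    with moved have "z \<in> R" "unshift s z \<in> {x\<in>grid N. f x \<noteq> x}" by simp_all
    then show "z \<in> shift s ` {x\<in>grid N. f x \<noteq> x}"
      by (intro image_eqI[of _ _ "unshift s z"]) (simp_all add: R_def shift_unshift)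
  qed
  have fin: "finite {x\<in>grid N. f x \<noteq> x}" by simp
  have fin\<sigma>: "finite {z. \<sigma> z \<noteq> z}" using supp fin by (meson finite_imageI finite_subset)
  have card\<sigma>: "card {z. \<sigma> z \<noteq> z} \<le> card {x\<in>grid N. f x \<noteq> x}"
    using card_mono[OF finite_imageI[OF fin] supp] card_image_le[OF fin, of "shift s"] by linarith
  define q where "q = (\<lambda>_::'n. m)"
  have pres: "box_index q (\<sigma> z) = box_index q z" for z
  proof (cases "z \<in> R")
    case True
    then have "unshift s z \<in> grid N" by (simp add: R_def unshift_in_grid)
    from boxes[OF this] have "box_index q (shift s (f (unshift s z))) = box_index q (shift s (unshift s z))"
      by (simp add: box_index_def q_def shift_def)
    with True show ?thesis by (simp add: \<sigma>_def R_def shift_unshift)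
  qed (simp add: \<sigma>_def)
  have good: "in_box R q z" if "\<sigma> z \<noteq> z" for z
    unfolding in_box_def
  proof clarify
    fix w assume w: "box_index q w = box_index q z"
    note mz = moved[OF that]
    have "s i \<le> w i \<and> w i < s i + N" for i
    proof -
      have "w i div 2 ^ m = z i div 2 ^ m" using fun_cong[OF w, of i] by (simp add: box_index_def q_def)
      moreover have "s i \<le> z i" using mz by (simp add: R_def region_def)
      ultimately have "s i \<le> w i div 2 ^ m * 2 ^ m" "(w i div 2 ^ m + 1) * 2 ^ m \<le> s i + N"
        using full[of "unshift s z" i] mz by (simp_all add: unshift_def)
      moreover have "w i div 2 ^ m * 2 ^ m \<le> w i" "w i < (w i div 2 ^ m + 1) * 2 ^ m"
        by (simp_all add: dividend_less_div_times)
      ultimately show ?thesis by linarith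
    qed
    then show "w \<in> R" by (simp add: R_def region_def)
  qed
  obtain c where c: "flowable R \<sigma> c" "c \<le> 24 * CARD('n) * box_size q * sqrt (card {z. \<sigma> z \<noteq> z})"
    using route[OF b\<sigma> fin\<sigma> pres good] by blast
  have "realizable N (\<lambda>x. unshift s (\<sigma> (shift s x))) c"
    using realizable_flowable[OF c(1)[unfolded R_def] N] by blast
  then have "realizable N f c"
    by (rule realizable_cong) (simp add: \<sigma>_def R_def shift_in_region)
  moreover have "c \<le> 24 * (real CARD('n))\<^sup>2 * 2 ^ m * sqrt (card {x\<in>grid N. f x \<noteq> x})"
  proof -
    have "c \<le> 24 * CARD('n) * (CARD('n) * 2 ^ m) * sqrt (card {z. \<sigma> z \<noteq> z})"
      using c(2) by (simp add: box_size_def q_def)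
    also have "\<dots> \<le> 24 * CARD('n) * (CARD('n) * 2 ^ m) * sqrt (card {x\<in>grid N. f x \<noteq> x})"
      using card\<sigma> by (intro mult_left_mono real_sqrt_le_mono) auto
    finally show ?thesis by (simp add: power2_eq_square mult_ac)
  qed
  ultimately show ?thesis by (rule realizable_mono)
qed

text \<open>The cells of the translated grid at the boundary of the cube are truncated, and the bisection
  argument needs whole boxes. Hence the cells are sorted by the set \<open>T\<close> of directions in which they are
  whole, and the cells of one sort are treated together in the grid translated only in the directions
  \<open>T\<close>; this accounts for the factor \<open>2\<^sup>\<nu>\<close>.\<close>

lemma realizable_local_permutation:
  fixes \<sigma> :: "('n::finite \<Rightarrow> nat) \<Rightarrow> 'n \<Rightarrow> nat"
  assumes N: "N > 0" and \<sigma>: "bij_betw \<sigma> (grid N) (grid N)" and s: "s < 2 ^ m" and m: "2 ^ m dvd N"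
    and boxes: "\<And>x i. x \<in> grid N \<Longrightarrow> (\<sigma> x i + s) div 2 ^ m = (x i + s) div 2 ^ m"
  shows "realizable N \<sigma> (2 ^ CARD('n) * (24 * (real CARD('n))\<^sup>2 * 2 ^ m * sqrt (card {x\<in>grid N. \<sigma> x \<noteq> x})))"
proof -
  define full where "full x = {i. s \<le> (x i + s) div 2 ^ m * 2 ^ m \<and> ((x i + s) div 2 ^ m + 1) * 2 ^ m \<le> s + N}"
    for x :: "'n \<Rightarrow> nat"
  define c where "c = 24 * (real CARD('n))\<^sup>2 * 2 ^ m * sqrt (card {x\<in>grid N. \<sigma> x \<noteq> x})"
  have \<sigma>G: "\<sigma> x \<in> grid N" if "x \<in> grid N" for x using \<sigma> that by (rule bij_betw_apply)
  have full_\<sigma>: "full (\<sigma> x) = full x" if "x \<in> grid N" for x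
    using boxes[OF that] by (simp add: full_def)
  \<comment> \<open>Restricting \<open>\<sigma>\<close> to a family of sorts leaves a bijection,
    because \<open>\<sigma>\<close> stays within its cells and so preserves the sort. Each single
    sort is one flow, and the sorts are composed one after another.\<close>
  define \<tau> where "\<tau> \<T> x = (if full x \<in> \<T> then \<sigma> x else x)" for \<T> x
  have \<tau>_bij: "bij_betw (\<tau> \<T>) (grid N) (grid N)" for \<T>
  proof -
    have "inj_on (\<tau> \<T>) (grid N)"
    proof (rule inj_onI)
      fix x y assume xy: "x \<in> grid N" "y \<in> grid N" "\<tau> \<T> x = \<tau> \<T> y"
      have "full (\<tau> \<T> z) = full z" if "z \<in> grid N" for z using full_\<sigma>[OF that] by (simp add: \<tau>_def)
      with xy have "full x = full y" by metis
      with xy show "x = y"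
        using inj_onD[OF bij_betw_imp_inj_on[OF \<sigma>]] by (auto simp: \<tau>_def split: if_splits)
    qed
    moreover have "\<tau> \<T> ` grid N \<subseteq> grid N" using \<sigma>G by (auto simp: \<tau>_def)
    ultimately show ?thesis by (simp add: bij_betw_def endo_inj_surj)
  qed
  have single: "realizable N (\<tau> {T}) c" for T
  proof -
    have "realizable N (\<tau> {T}) (24 * (real CARD('n))\<^sup>2 * 2 ^ m * sqrt (card {x\<in>grid N. \<tau> {T} x \<noteq> x}))"
    proof (rule realizable_permutation[OF N \<tau>_bij, where s="\<lambda>i. if i \<in> T then s else 0"])
      fix x :: "'n \<Rightarrow> nat" and i assume x: "x \<in> grid N"
      \<comment> \<open>In a direction where the cell is truncated it lies in one interval of the
        original grid, so there \<open>\<sigma>\<close> also respects the untranslated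
        walls.\<close>
      have "\<sigma> x i div 2 ^ m = x i div 2 ^ m" if "i \<notin> full x"
      proof (rule truncated_interval[OF s _ _ m boxes[OF x]])
        show "\<sigma> x i < N" "x i < N" using x \<sigma>G[OF x] by (simp_all add: grid_def)
        show "\<not> (s \<le> (\<sigma> x i + s) div 2 ^ m * 2 ^ m \<and> ((\<sigma> x i + s) div 2 ^ m + 1) * 2 ^ m \<le> s + N)"
          using that unfolding boxes[OF x] full_def by simp
      qed
      then show "(\<tau> {T} x i + (if i \<in> T then s else 0)) div 2 ^ m = (x i + (if i \<in> T then s else 0)) div 2 ^ m"
        using boxes[OF x, of i] by (auto simp: \<tau>_def)
      assume "\<tau> {T} x \<noteq> x"
      then have T: "full x = T" by (auto simp: \<tau>_def split: if_splits)
      \<comment> \<open>In the untranslated directions every interval is whole, because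
        \<open>2 ^ m\<close> divides \<open>N\<close>.\<close>
      obtain K where K: "N = K * 2 ^ m" using m by (metis dvdE mult.commute)
      have "x i < K * 2 ^ m" using x K by (simp add: grid_def)
      then have "x i div 2 ^ m < K" by (rule less_mult_imp_div_less)
      then have "(x i div 2 ^ m + 1) * 2 ^ m \<le> K * 2 ^ m" by (intro mult_right_mono) auto
      then show "(if i \<in> T then s else 0) \<le> (x i + (if i \<in> T then s else 0)) div 2 ^ m * 2 ^ m \<and>
          ((x i + (if i \<in> T then s else 0)) div 2 ^ m + 1) * 2 ^ m \<le> (if i \<in> T then s else 0) + N"
        using T K unfolding full_def by (cases "i \<in> T") auto
    qed
    moreover have "card {x\<in>grid N. \<tau> {T} x \<noteq> x} \<le> card {x\<in>grid N. \<sigma> x \<noteq> x}"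
      by (intro card_mono) (auto simp: \<tau>_def)
    then have "24 * (real CARD('n))\<^sup>2 * 2 ^ m * sqrt (card {x\<in>grid N. \<tau> {T} x \<noteq> x}) \<le> c"
      unfolding c_def by (intro mult_left_mono real_sqrt_le_mono) auto
    ultimately show ?thesis by (rule realizable_mono)
  qed
  have "realizable N (\<tau> \<T>) (card \<T> * c)" if "finite \<T>" for \<T>
    using that
  proof induction
    case empty
    then show ?case using realizable_id by (simp add: \<tau>_def)
  next
    case (insert T \<T>)
    have "(\<tau> {T} \<circ> \<tau> \<T>) x = \<tau> (insert T \<T>) x" if "x \<in> grid N" for x
      using insert.hyps(2) full_\<sigma>[OF that] by (auto simp: \<tau>_def)
    with realizable_comp[OF single insert.IH, of T]
    have "realizable N (\<tau> (insert T \<T>)) (c + card \<T> * c)" by (rule realizable_cong)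
    then show ?case using insert.hyps by (simp add: distrib_right)
  qed
  from this[of UNIV] have "realizable N (\<tau> UNIV) (card (UNIV :: 'n set set) * c)" by simp
  moreover have "\<tau> UNIV = \<sigma>" by (simp add: \<tau>_def fun_eq_iff)
  moreover have "real (card (UNIV :: 'n set set)) = 2 ^ CARD('n)"
    using card_Pow[of "UNIV :: 'n set"] by simp
  ultimately show ?thesis by (simp only: c_def)
qed

text \<open>\<open>V\<close> counts the cubes that \<open>\<pi>\<close> takes across the walls of
  the best translate. Bringing these cells back into order may itself carry up to \<open>V\<close>
  cubes over original walls, which explains the sum under the second root.\<close>

theorem realizable_sorting:
  fixes \<pi> :: "('n::finite \<Rightarrow> nat) \<Rightarrow> 'n \<Rightarrow> nat" and n m :: nat
  defines "N \<equiv> 2 ^ n" and "b \<equiv> 2 ^ m"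
  assumes mn: "m \<le> n" and \<pi>: "bij_betw \<pi> (grid N) (grid N)"
  obtains \<tau> V where "bij_betw \<tau> (grid N) (grid N)"
    "\<And>x i. x \<in> grid N \<Longrightarrow> \<tau> (\<pi> x) i div b = x i div b"
    "real b * real V \<le> (\<Sum>x\<in>grid N. \<Sum>i\<in>UNIV. \<bar>real (\<pi> x i) - real (x i)\<bar>)"
    "realizable N \<tau> (24 * (real CARD('n))\<^sup>2 * (real N * sqrt (real V) + 2 ^ CARD('n) * real b *
       sqrt (real V + real (card {x\<in>grid N. \<exists>i. \<pi> x i div b \<noteq> x i div b}))))"
proof -
  have N: "N > 0" and b: "b > 0" and dvd: "b dvd N" using mn by (simp_all add: N_def b_def le_imp_power_dvd)
  have \<pi>G: "\<pi> x \<in> grid N" if "x \<in> grid N" for x using \<pi> that by (rule bij_betw_apply)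
  obtain s where s: "s < b" "b * real (card {x\<in>grid N. \<exists>i. (\<pi> x i + s) div b \<noteq> (x i + s) div b})
      \<le> (\<Sum>x\<in>grid N. \<Sum>i\<in>UNIV. \<bar>real (\<pi> x i) - real (x i)\<bar>)"
    using good_shift[OF b finite_grid[of N], where \<pi>=\<pi>] by blast
  define lab where "lab x = (\<lambda>i. (x i + s) div b)" for x :: "'n \<Rightarrow> nat"
  define lab0 where "lab0 x = (\<lambda>i. x i div b)" for x :: "'n \<Rightarrow> nat"
  define V where "V = card {x\<in>grid N. lab (\<pi> x) \<noteq> lab x}"
  define W where "W = card {x\<in>grid N. lab0 (\<pi> x) \<noteq> lab0 x}"
  have lab_ne: "lab x \<noteq> lab y \<longleftrightarrow> (\<exists>i. (x i + s) div b \<noteq> (y i + s) div b)"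
    and lab0_ne: "lab0 x \<noteq> lab0 y \<longleftrightarrow> (\<exists>i. x i div b \<noteq> y i div b)" for x y
    by (auto simp: lab_def lab0_def fun_eq_iff)
  obtain \<sigma> where \<sigma>: "bij_betw \<sigma> (grid N) (grid N)" "\<And>x. x \<in> grid N \<Longrightarrow> lab (\<sigma> (\<pi> x)) = lab x"
      "{y\<in>grid N. \<sigma> y \<noteq> y} \<subseteq> \<pi> ` {x\<in>grid N. lab (\<pi> x) \<noteq> lab x}"
    by (rule relabel[OF finite_grid \<pi>, of lab]) (rule that)
  have card\<sigma>: "card {y\<in>grid N. \<sigma> y \<noteq> y} \<le> V"
  proof -
    have "card {y\<in>grid N. \<sigma> y \<noteq> y} \<le> card (\<pi> ` {x\<in>grid N. lab (\<pi> x) \<noteq> lab x})"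
      by (rule card_mono[OF _ \<sigma>(3)]) simp
    also have "\<dots> \<le> V" unfolding V_def by (rule card_image_le) simp
    finally show ?thesis .
  qed
  \<comment> \<open>Here the only box is the whole grid, of side \<open>2 ^ n\<close> and
    untranslated, so every permutation preserves it.\<close>
  have "realizable N \<sigma> (24 * (real CARD('n))\<^sup>2 * 2 ^ n * sqrt (card {x\<in>grid N. \<sigma> x \<noteq> x}))"
  proof (rule realizable_permutation[OF N \<sigma>(1), where s="\<lambda>_. 0"])
    fix x :: "'n \<Rightarrow> nat" and i assume "x \<in> grid N"
    then show "(\<sigma> x i + 0) div 2 ^ n = (x i + 0) div 2 ^ n"
      using bij_betw_apply[OF \<sigma>(1), of x] by (simp add: grid_def N_def)
    show "0 \<le> (x i + 0) div 2 ^ n * 2 ^ n \<and> ((x i + 0) div 2 ^ n + 1) * 2 ^ n \<le> 0 + N"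
      using \<open>x \<in> grid N\<close> by (simp add: grid_def N_def)
  qed
  then have real1: "realizable N \<sigma> (24 * (real CARD('n))\<^sup>2 * N * sqrt V)"
    by (rule realizable_mono) (use card\<sigma> in \<open>auto simp: N_def intro!: mult_left_mono\<close>)
  define \<rho> where "\<rho> = \<sigma> \<circ> \<pi>"
  have \<rho>: "bij_betw \<rho> (grid N) (grid N)" unfolding \<rho>_def by (rule bij_betw_trans[OF \<pi> \<sigma>(1)])
  have lab\<rho>: "lab (\<rho> x) = lab x" if "x \<in> grid N" for x using \<sigma>(2)[OF that] by (simp add: \<rho>_def)
  \<comment> \<open>Restoring the pair of labels, rather than the original label alone, keeps the
    second sorting inside the translated cells.\<close>
  obtain \<sigma>' where \<sigma>': "bij_betw \<sigma>' (grid N) (grid N)"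
      "\<And>x. x \<in> grid N \<Longrightarrow> (lab (\<sigma>' (\<rho> x)), lab0 (\<sigma>' (\<rho> x))) = (lab x, lab0 x)"
      "{y\<in>grid N. \<sigma>' y \<noteq> y} \<subseteq> \<rho> ` {x\<in>grid N. (lab (\<rho> x), lab0 (\<rho> x)) \<noteq> (lab x, lab0 x)}"
    by (rule relabel[OF finite_grid \<rho>, of "\<lambda>x. (lab x, lab0 x)"]) (rule that)
  have lab\<sigma>': "lab (\<sigma>' y) = lab y" if "y \<in> grid N" for y
  proof -
    from that have "y \<in> \<rho> ` grid N" by (simp only: bij_betw_imp_surj_on[OF \<rho>])
    then obtain x where x: "y = \<rho> x" "x \<in> grid N" by (rule imageE)
    then show ?thesis using \<sigma>'(2)[OF x(2)] lab\<rho>[OF x(2)] by simp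
  qed
  have card\<sigma>': "card {y\<in>grid N. \<sigma>' y \<noteq> y} \<le> V + W"
  proof -
    let ?X = "{x\<in>grid N. (lab (\<rho> x), lab0 (\<rho> x)) \<noteq> (lab x, lab0 x)}"
    have "?X \<subseteq> {x\<in>grid N. lab (\<pi> x) \<noteq> lab x} \<union> {x\<in>grid N. lab0 (\<pi> x) \<noteq> lab0 x}"
    proof
      fix x assume "x \<in> ?X"
      then have x: "x \<in> grid N" "lab0 (\<rho> x) \<noteq> lab0 x" using lab\<rho> by auto
      show "x \<in> {x\<in>grid N. lab (\<pi> x) \<noteq> lab x} \<union> {x\<in>grid N. lab0 (\<pi> x) \<noteq> lab0 x}"
      proof (cases "\<sigma> (\<pi> x) = \<pi> x")
        case True
        with x show ?thesis by (simp add: \<rho>_def)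
      next
        case False
        with \<pi>G[OF x(1)] have "\<pi> x \<in> \<pi> ` {x\<in>grid N. lab (\<pi> x) \<noteq> lab x}"
          by (intro subsetD[OF \<sigma>(3)]) simp
        then obtain x' where x': "\<pi> x = \<pi> x'" "x' \<in> {x\<in>grid N. lab (\<pi> x) \<noteq> lab x}" by (rule imageE)
        from x'(2) have "x' \<in> grid N" by simp
        with x'(1) have "x = x'" using inj_onD[OF bij_betw_imp_inj_on[OF \<pi>]] x(1) by simp
        with x'(2) show ?thesis by simp
      qed
    qed
    then have "card ?X \<le> card ({x\<in>grid N. lab (\<pi> x) \<noteq> lab x} \<union> {x\<in>grid N. lab0 (\<pi> x) \<noteq> lab0 x})"
      by (rule card_mono[rotated]) simp
    also have "\<dots> \<le> V + W" unfolding V_def W_def by (rule card_Un_le)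
    finally have X: "card ?X \<le> V + W" .
    have "card {y\<in>grid N. \<sigma>' y \<noteq> y} \<le> card (\<rho> ` ?X)"
      by (rule card_mono[OF _ \<sigma>'(3)]) simp
    also have "\<dots> \<le> card ?X" by (rule card_image_le) simp
    finally show ?thesis using X by simp
  qed
  have "realizable N \<sigma>' (2 ^ CARD('n) * (24 * (real CARD('n))\<^sup>2 * 2 ^ m * sqrt (card {x\<in>grid N. \<sigma>' x \<noteq> x})))"
  proof (rule realizable_local_permutation[OF N \<sigma>'(1) s(1)[unfolded b_def] dvd[unfolded b_def]])
    fix x :: "'n \<Rightarrow> nat" and i assume "x \<in> grid N"
    from fun_cong[OF lab\<sigma>'[OF this], of i]
    show "(\<sigma>' x i + s) div 2 ^ m = (x i + s) div 2 ^ m" by (simp add: lab_def b_def)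
  qed
  moreover have "2 ^ CARD('n) * (24 * (real CARD('n))\<^sup>2 * 2 ^ m * sqrt (card {x\<in>grid N. \<sigma>' x \<noteq> x}))
      \<le> 24 * (real CARD('n))\<^sup>2 * (2 ^ CARD('n) * b * sqrt (real V + real W))"
  proof -
    have "sqrt (card {x\<in>grid N. \<sigma>' x \<noteq> x}) \<le> sqrt (real V + real W)"
      using card\<sigma>' by (intro real_sqrt_le_mono) linarith
    then have "2 ^ CARD('n) * (24 * (real CARD('n))\<^sup>2 * 2 ^ m * sqrt (card {x\<in>grid N. \<sigma>' x \<noteq> x}))
        \<le> 2 ^ CARD('n) * (24 * (real CARD('n))\<^sup>2 * 2 ^ m * sqrt (real V + real W))"
      by (intro mult_left_mono) auto
    then show ?thesis by (simp add: b_def mult_ac)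
  qed
  ultimately have real2: "realizable N \<sigma>' (24 * (real CARD('n))\<^sup>2 * (2 ^ CARD('n) * b * sqrt (real V + real W)))"
    by (rule realizable_mono)
  show ?thesis
  proof (rule that)
    show "bij_betw (\<sigma>' \<circ> \<sigma>) (grid N) (grid N)" by (rule bij_betw_trans[OF \<sigma>(1) \<sigma>'(1)])
    show "(\<sigma>' \<circ> \<sigma>) (\<pi> x) i div b = x i div b" if "x \<in> grid N" for x i
    proof -
      have "lab0 (\<sigma>' (\<rho> x)) = lab0 x" using \<sigma>'(2)[OF that] by simp
      from fun_cong[OF this, of i] show ?thesis by (simp add: lab0_def \<rho>_def)
    qed
    show "real b * real V \<le> (\<Sum>x\<in>grid N. \<Sum>i\<in>UNIV. \<bar>real (\<pi> x i) - real (x i)\<bar>)"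
      using s(2) by (simp add: V_def lab_ne)
    show "realizable N (\<sigma>' \<circ> \<sigma>) (24 * (real CARD('n))\<^sup>2 * (real N * sqrt (real V) + 2 ^ CARD('n) * real b *
       sqrt (real V + real (card {x\<in>grid N. \<exists>i. \<pi> x i div b \<noteq> x i div b}))))"
      using realizable_comp[OF real2 real1] unfolding W_def lab0_ne by (simp add: algebra_simps)
  qed
qed

section \<open>Permutations of the tiling and of the grid\<close>

lemma unit_cube_covered:
  assumes N: "N > 0"
  shows "unit_cube \<subseteq> (\<Union>x\<in>grid N. cube N x)"
proof
  fix p :: "real^'n" assume "p \<in> unit_cube"
  then have p: "0 \<le> p $ i" "p $ i \<le> 1" for i by (simp_all add: unit_cube_def mem_box_cart)
  \<comment> \<open>The cap \<open>N - 1\<close> assigns points with a coordinate equal to 1 to the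
    last cube.\<close>
  define x where "x i = min (N - 1) (nat \<lfloor>N * p $ i\<rfloor>)" for i
  have "x \<in> grid N" using N by (auto simp: grid_def x_def min_def)
  moreover have "x i / N \<le> p $ i \<and> p $ i \<le> (real (x i) + 1) / N" for i
  proof -
    have f: "real (nat \<lfloor>N * p $ i\<rfloor>) \<le> N * p $ i" "N * p $ i < real (nat \<lfloor>N * p $ i\<rfloor>) + 1"
    proof -
      have "0 \<le> N * p $ i" using p(1)[of i] by simp
      then show "real (nat \<lfloor>N * p $ i\<rfloor>) \<le> N * p $ i" "N * p $ i < real (nat \<lfloor>N * p $ i\<rfloor>) + 1"
        by linarith+
    qed
    have "N * p $ i \<le> N" using p(2)[of i] by (simp add: mult_left_le)
    then have "x i \<le> N * p $ i" "N * p $ i \<le> real (x i) + 1"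
      using f N by (auto simp: x_def min_def of_nat_diff)
    then show ?thesis using N by (simp add: field_simps)
  qed
  then have "p \<in> cube N x" by (simp add: mem_cube)
  ultimately show "p \<in> (\<Union>x\<in>grid N. cube N x)" by blast
qed

section \<open>Null walls and preservation of measure\<close>

lemma interior_cube_eq_box:
  "interior (cube N x) = box (\<chi> i. real (x i) / N) (\<chi> i. real (x i + 1) / N)"
  by (simp add: cube_def grid_box_def)

lemma closure_interior_cube: "N > 0 \<Longrightarrow> closure (interior (cube N x)) = cube N x"
proof -
  assume "N > 0"
  then have "box (\<chi> i. real (x i) / N) (\<chi> i. real (x i + 1) / N) \<noteq> {}"
    using center_in_interior[of N x] by (auto simp: interior_cube_eq_box)
  then show ?thesis by (simp add: interior_cube_eq_box cube_def grid_box_def)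
qed

lemma negligible_walls:
  assumes "N > 0"
  shows "negligible (unit_cube - (\<Union>x\<in>grid N. interior (cube N x)))"
proof (rule negligible_subset)
  show "negligible (\<Union>x\<in>grid N. cube N x - interior (cube N x))"
    using negligible_frontier_interval
    by (intro negligible_Union) (auto simp: cube_def grid_box_def)
  show "unit_cube - (\<Union>x\<in>grid N. interior (cube N x)) \<subseteq> (\<Union>x\<in>grid N. cube N x - interior (cube N x))"
    using unit_cube_covered[OF assms] by blast
qed

lemma AE_in_cubes:
  assumes "N > 0"
  shows "AE p in lebesgue_on unit_cube. p \<in> (\<Union>x\<in>grid N. interior (cube N x))"
proof -
  have "AE p in lebesgue. p \<notin> unit_cube - (\<Union>x\<in>grid N. interior (cube N x))"
    using negligible_walls[OF assms] by (intro AE_not_in) (simp add: negligible_iff_null_sets)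
  then show ?thesis
    by (subst AE_restrict_space_iff) (auto simp: unit_cube_def)
qed

lemma interior_cube_lmeasurable: "interior (cube N x) \<in> lmeasurable"
  by (simp add: interior_cube_eq_box)

lemma measure_interior_cube:
  fixes x :: "'n::finite \<Rightarrow> nat"
  assumes "N > 0"
  shows "measure lebesgue (interior (cube N x)) = 1 / real N ^ CARD('n)"
proof -
  let ?a = "\<chi> i. real (x i) / N" and ?b = "\<chi> i. real (x i + 1) / N"
  have "interior (cube N x) \<subseteq> cube N x" by (rule interior_subset)
  then have ne: "cbox ?a ?b \<noteq> {}"
    using center_in_interior[OF assms, of x] by (auto simp: cube_def grid_box_def)
  have "measure lebesgue (interior (cube N x)) = measure lebesgue (box ?a ?b)"
    by (simp add: interior_cube_eq_box)
  also have "\<dots> = measure lborel (cbox ?a ?b)" by (simp add: measure_lborel_box_eq measure_lborel_cbox_eq)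
  also have "\<dots> = (\<Prod>i\<in>UNIV. real (x i + 1) / N - real (x i) / N)"
    by (subst content_cbox_cart[OF ne]) simp
  also have "\<dots> = (\<Prod>i\<in>(UNIV::'n set). 1 / real N)"
    by (simp add: diff_divide_distrib[symmetric])
  finally show ?thesis by (simp add: power_one_over)
qed

lemma measure_by_cubes:
  fixes A :: "(real^'n::finite) set"
  assumes N: "N > 0" and A: "A \<in> sets lebesgue" "A \<subseteq> unit_cube"
  shows "A \<in> lmeasurable"
    and "measure lebesgue A = (\<Sum>x\<in>grid N. measure lebesgue (A \<inter> interior (cube N x)))"
proof -
  show "A \<in> lmeasurable"
    using A by (intro bounded_set_imp_lmeasurable) (auto simp: unit_cube_def intro: bounded_subset[OF bounded_cbox])
  define U where "U = (\<Union>x\<in>grid N. A \<inter> interior (cube N x))"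
  have m: "A \<inter> interior (cube N x) \<in> lmeasurable" for x
    using fmeasurable_Int_fmeasurable[OF interior_cube_lmeasurable A(1)] by (simp add: Int_commute)
  have "A - U \<subseteq> unit_cube - (\<Union>x\<in>grid N. interior (cube N x))" using A(2) by (auto simp: U_def)
  then have null: "A - U \<in> null_sets lebesgue"
    using negligible_walls[OF N] negligible_subset negligible_iff_null_sets by blast
  have "U \<in> sets lebesgue" unfolding U_def using m by (intro sets.finite_UN) auto
  from measure_Un_null_set[OF this null] have "measure lebesgue (U \<union> (A - U)) = measure lebesgue U" .
  moreover have "U \<union> (A - U) = A" by (auto simp: U_def)
  moreover have "measure lebesgue U = (\<Sum>x\<in>grid N. measure lebesgue (A \<inter> interior (cube N x)))"
    unfolding U_def
  proof (rule measure_finite_Union)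
    show "disjoint_family_on (\<lambda>x. A \<inter> interior (cube N x)) (grid N)"
      using interior_cubes_disjoint[OF _ _ N] unfolding disjoint_family_on_def by blast
    show "emeasure lebesgue (A \<inter> interior (cube N i)) \<noteq> \<infinity>" for i
      using fmeasurableD2[OF m[of i]] by simp
  qed (use m in auto)
  ultimately show "measure lebesgue A = (\<Sum>x\<in>grid N. measure lebesgue (A \<inter> interior (cube N x)))" by simp
qed

text \<open>The preimage of a set consists, up to walls, of translates of its parts in the cubes;
  the measures of these parts are summed over the grid and reindexed by the bijection
  \<open>f\<close>.\<close>

lemma measure_preserving_cell_map:
  fixes f :: "('n::finite \<Rightarrow> nat) \<Rightarrow> 'n \<Rightarrow> nat"
  assumes N: "N > 0" and f: "bij_betw f (grid N) (grid N)"
  shows "measure_preserving_cube (cell_map N f)"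
proof -
  let ?Q = "cell_map N f" and ?C = "unit_cube :: (real^'n) set"
  have fG: "f x \<in> grid N" if "x \<in> grid N" for x using f that by (rule bij_betw_apply)
  have C: "?C \<in> sets lebesgue" by (simp add: unit_cube_def)
  have QC: "?Q p \<in> ?C" if "p \<in> ?C" for p using cell_map_unit_cube[OF N fG that] .
  have piece: "(?Q -` A \<inter> ?C) \<inter> interior (cube N x)
      = (\<lambda>p. p - offset N x (f x)) ` (A \<inter> interior (cube N (f x)))"
    if "x \<in> grid N" for x A
  proof (intro equalityI subsetI)
    fix p assume p: "p \<in> (?Q -` A \<inter> ?C) \<inter> interior (cube N x)"
    then have "p + offset N x (f x) \<in> A \<inter> interior (cube N (f x))"
      using cell_map_interior[OF N that, of p f] by (simp add: add_offset_interior)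
    then show "p \<in> (\<lambda>p. p - offset N x (f x)) ` (A \<inter> interior (cube N (f x)))"
      by (intro image_eqI[of _ _ "p + offset N x (f x)"]) simp_all
  next
    fix p assume "p \<in> (\<lambda>p. p - offset N x (f x)) ` (A \<inter> interior (cube N (f x)))"
    then have a: "p + offset N x (f x) \<in> A" "p + offset N x (f x) \<in> interior (cube N (f x))"
      by auto
    then have p: "p \<in> interior (cube N x)" by (simp add: add_offset_interior)
    then have "p \<in> ?C" using cube_subset_unit_cube[OF that] interior_subset by blast
    with p a(1) cell_map_interior[OF N that p, of f]
    show "p \<in> (?Q -` A \<inter> ?C) \<inter> interior (cube N x)" by simp
  qed
  have meas_piece: "A \<inter> interior (cube N x) \<in> lmeasurable" if "A \<in> sets lebesgue" for A and x :: "'n \<Rightarrow> nat"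
    using fmeasurable_Int_fmeasurable[OF interior_cube_lmeasurable that] by (simp add: Int_commute)
  \<comment> \<open>The part on the walls is a null set, hence measurable by completeness of
    Lebesgue measure; the rest is a finite union of translated measurable sets.\<close>
  have preimage: "?Q -` A \<inter> ?C \<in> sets lebesgue" if A: "A \<in> sets lebesgue" for A
  proof -
    let ?U = "\<Union>x\<in>grid N. interior (cube N x)"
    have "negligible ((?Q -` A \<inter> ?C) - ?U)"
      by (rule negligible_subset[OF negligible_walls[OF N]]) auto
    then have "(?Q -` A \<inter> ?C) - ?U \<in> sets lebesgue"
      by (simp add: negligible_iff_null_sets null_setsD2)
    moreover have "(?Q -` A \<inter> ?C) \<inter> interior (cube N x) \<in> sets lebesgue" if "x \<in> grid N" for x
      unfolding piece[OF that] using measurable_translation_subtract[OF meas_piece[OF A]] by blast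
    then have "(\<Union>x\<in>grid N. (?Q -` A \<inter> ?C) \<inter> interior (cube N x)) \<in> sets lebesgue"
      by (intro sets.finite_UN) auto
    ultimately have "((?Q -` A \<inter> ?C) - ?U) \<union> (\<Union>x\<in>grid N. (?Q -` A \<inter> ?C) \<inter> interior (cube N x)) \<in> sets lebesgue"
      by (rule sets.Un)
    also have "((?Q -` A \<inter> ?C) - ?U) \<union> (\<Union>x\<in>grid N. (?Q -` A \<inter> ?C) \<inter> interior (cube N x)) = ?Q -` A \<inter> ?C"
      by blast
    finally show ?thesis .
  qed
  have sets_on: "A \<in> sets (lebesgue_on ?C) \<longleftrightarrow> A \<in> sets lebesgue \<and> A \<subseteq> ?C" for A
    using C by (auto simp: sets_restrict_space_iff)
  have meas: "?Q \<in> lebesgue_on ?C \<rightarrow>\<^sub>M lebesgue_on ?C"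
    by (rule measurableI) (use preimage QC in \<open>auto simp: sets_on space_restrict_space\<close>)
  moreover have "distr (lebesgue_on ?C) (lebesgue_on ?C) ?Q = lebesgue_on ?C"
  proof (rule measure_eqI)
    fix A assume "A \<in> sets (distr (lebesgue_on ?C) (lebesgue_on ?C) ?Q)"
    then have A: "A \<in> sets lebesgue" "A \<subseteq> ?C" by (simp_all add: sets_on)
    have Q: "?Q -` A \<inter> ?C \<in> sets lebesgue" "?Q -` A \<inter> ?C \<subseteq> ?C" using preimage[OF A(1)] by auto
    have "measure lebesgue (?Q -` A \<inter> ?C)
        = (\<Sum>x\<in>grid N. measure lebesgue ((?Q -` A \<inter> ?C) \<inter> interior (cube N x)))"
      by (rule measure_by_cubes(2)[OF N Q])
    also have "\<dots> = (\<Sum>x\<in>grid N. measure lebesgue (A \<inter> interior (cube N (f x))))"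
      by (intro sum.cong refl) (simp only: piece measure_translation_subtract)
    also have "\<dots> = (\<Sum>y\<in>grid N. measure lebesgue (A \<inter> interior (cube N y)))"
      by (rule sum.reindex_bij_betw[OF f])
    also have "\<dots> = measure lebesgue A" by (rule measure_by_cubes(2)[OF N A, symmetric])
    finally have "emeasure lebesgue (?Q -` A \<inter> ?C) = emeasure lebesgue A"
      using measure_by_cubes(1)[OF N Q] measure_by_cubes(1)[OF N A] by (simp add: emeasure_eq_measure2)
    then have "emeasure (lebesgue_on ?C) (?Q -` A \<inter> ?C) = emeasure (lebesgue_on ?C) A"
      using A(2) C by (simp add: emeasure_restrict_space)
    moreover have "A \<in> sets (lebesgue_on ?C)" using A by (simp add: sets_on)
    ultimately show "emeasure (distr (lebesgue_on ?C) (lebesgue_on ?C) ?Q) A = emeasure (lebesgue_on ?C) A"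
      using meas by (simp add: emeasure_distr space_restrict_space)
  qed simp
  ultimately show ?thesis by (simp add: measure_preserving_cube_def)
qed

lemma cube_image_cell_map:
  assumes "N > 0" "x \<in> grid N"
  shows "cube_image (cell_map N f) (cube N x) = cube N (f x)"
proof -
  have "cell_map N f ` interior (cube N x) = interior (cube N (f x))"
  proof (intro equalityI subsetI)
    fix p assume "p \<in> cell_map N f ` interior (cube N x)"
    then show "p \<in> interior (cube N (f x))"
      using cell_map_interior[OF assms] by (auto simp: add_offset_interior)
  next
    fix p assume p: "p \<in> interior (cube N (f x))"
    then have "p - offset N x (f x) \<in> interior (cube N x)"
      using add_offset_interior[of "p - offset N x (f x)" N x "f x"] by simp
    then show "p \<in> cell_map N f ` interior (cube N x)"
      using cell_map_interior[OF assms, of _ f] by (intro image_eqI[of _ _ "p - offset N x (f x)"]) simp_all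
  qed
  then show ?thesis using assms(1) by (simp add: cube_image_def closure_interior_cube)
qed

lemma cell_map_permutation:
  assumes N: "N > 0" and f: "bij_betw f (grid N) (grid N)"
  shows "cell_map N f \<in> permutations_of_tiling N"
proof -
  have "bij_betw (cube_image (cell_map N f)) (cube N ` grid N) (cube N ` grid N)"
  proof (rule bij_betw_imageI)
    have im: "f ` grid N = grid N" using f by (rule bij_betw_imp_surj_on)
    show "cube_image (cell_map N f) ` cube N ` grid N = cube N ` grid N"
      unfolding image_image using cube_image_cell_map[OF N, of _ f] im by (simp add: image_image[symmetric])
    show "inj_on (cube_image (cell_map N f)) (cube N ` grid N)"
      using cube_image_cell_map[OF N, of _ f] bij_betw_imp_inj_on[OF f]
      by (auto simp: inj_on_def cube_inject[OF N])
  qed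
  moreover have "cell_map N f p = p + center (cube_image (cell_map N f) (cube N x)) - center (cube N x)"
    if "x \<in> grid N" "p \<in> interior (cube N x)" for x p
    using that by (simp add: cube_image_cell_map[OF N] cell_map_interior[OF N] center_cube_diff[symmetric])
  ultimately show ?thesis
    using measure_preserving_cell_map[OF N f] by (auto simp: permutations_of_tiling_def tiling_eq)
qed

section \<open>Lattice displacements of a given permutation of the tiling\<close>

lemma induced_permutation:
  fixes P :: "real^'n::finite \<Rightarrow> real^'n"
  assumes N: "N > 0" and P: "P \<in> permutations_of_tiling N"
  obtains \<pi> where "bij_betw \<pi> (grid N) (grid N)"
    "\<And>x p. x \<in> grid N \<Longrightarrow> p \<in> interior (cube N x) \<Longrightarrow> P p = p + offset N x (\<pi> x)"
proof -
  have inj: "inj_on (cube N) (grid N)" using cube_inject[OF N] by (auto simp: inj_on_def)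
  then have b: "bij_betw (cube N) (grid N) (tiling N :: (real^'n) set set)"
    by (simp add: bij_betw_def tiling_eq)
  have bP: "bij_betw (cube_image P) (tiling N) (tiling N)"
    using P by (simp add: permutations_of_tiling_def)
  define \<pi> where "\<pi> = the_inv_into (grid N) (cube N) \<circ> (cube_image P \<circ> cube N)"
  have "bij_betw \<pi> (grid N) (grid N)"
    unfolding \<pi>_def by (rule bij_betw_trans[OF bij_betw_trans[OF b bP] bij_betw_the_inv_into[OF b]])
  moreover have "P p = p + offset N x (\<pi> x)" if "x \<in> grid N" "p \<in> interior (cube N x)" for x p
  proof -
    have "cube_image P (cube N x) \<in> cube N ` grid N"
      using bij_betw_apply[OF bij_betw_trans[OF b bP] that(1)] by (simp add: tiling_eq)
    then have "cube N (\<pi> x) = cube_image P (cube N x)"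
      unfolding \<pi>_def using f_the_inv_into_f[OF inj] by simp
    moreover have "P p = p + center (cube_image P (cube N x)) - center (cube N x)"
      using P that by (auto simp: permutations_of_tiling_def tiling_eq)
    ultimately show ?thesis by (simp add: center_cube_diff[symmetric])
  qed
  ultimately show ?thesis by (rule that)
qed

text \<open>On each open cube the displacement is a constant vector, so the integral is a finite
  sum. The volume of a cube and the square of the lattice step \<open>1 / N\<close> together give
  the exponent \<open>CARD('n) + 2\<close>.\<close>

lemma L2_norm_displacement:
  fixes P :: "real^'n::finite \<Rightarrow> real^'n"
  assumes N: "N > 0" and P: "P \<in> permutations_of_tiling N"
    and \<pi>: "\<And>x p. x \<in> grid N \<Longrightarrow> p \<in> interior (cube N x) \<Longrightarrow> P p = p + offset N x (\<pi> x)"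
  shows "(L2_norm_cube (\<lambda>x. P x - x))\<^sup>2 =
    (\<Sum>x\<in>grid N. \<Sum>i\<in>UNIV. (real (\<pi> x i) - real (x i))\<^sup>2) / real N ^ (CARD('n) + 2)"
proof -
  let ?C = "unit_cube :: (real^'n) set"
  let ?h = "\<lambda>p. \<Sum>x\<in>grid N. indicator (interior (cube N x)) p * (norm (offset N x (\<pi> x)))\<^sup>2"
  have C: "?C \<in> sets lebesgue" by (simp add: unit_cube_def)
  have idm: "(\<lambda>x::real^'n. x) \<in> borel_measurable (lebesgue_on ?C)"
    using id_borel_measurable_lebesgue_on[of ?C] by (simp add: id_def)
  have "P \<in> lebesgue_on ?C \<rightarrow>\<^sub>M lebesgue_on ?C"
    using P by (simp add: permutations_of_tiling_def measure_preserving_cube_def)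
  from measurable_compose[OF this idm] have Pm: "P \<in> borel_measurable (lebesgue_on ?C)" .
  have sets_on: "interior (cube N x) \<in> sets (lebesgue_on ?C)"
    and meas_on: "measure (lebesgue_on ?C) (interior (cube N x)) = 1 / real N ^ CARD('n)"
    if "x \<in> grid N" for x :: "'n \<Rightarrow> nat"
  proof -
    have sub: "interior (cube N x) \<subseteq> ?C" using cube_subset_unit_cube[OF that] interior_subset by blast
    then show "interior (cube N x) \<in> sets (lebesgue_on ?C)"
      using C interior_cube_lmeasurable[of N x] by (auto simp: sets_restrict_space_iff)
    show "measure (lebesgue_on ?C) (interior (cube N x)) = 1 / real N ^ CARD('n)"
      using sub C by (simp add: measure_restrict_space measure_interior_cube[OF N])
  qed
  have int_C: "interior (cube N x) \<inter> ?C = interior (cube N x)" if "x \<in> grid N" for x :: "'n \<Rightarrow> nat"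
    using cube_subset_unit_cube[OF that] interior_subset by blast
  have fin: "emeasure (lebesgue_on ?C) A < \<infinity>" for A
  proof -
    have "emeasure (lebesgue_on ?C) A \<le> emeasure (lebesgue_on ?C) (space (lebesgue_on ?C))"
      by (rule emeasure_space)
    also have "\<dots> = emeasure lebesgue ?C" using C by (simp add: space_restrict_space emeasure_restrict_space)
    also have "\<dots> < \<infinity>" by (simp add: unit_cube_def emeasure_lborel_cbox_eq)
    finally show ?thesis .
  qed
  have "(LINT p|lebesgue_on ?C. (norm (P p - p))\<^sup>2) = (LINT p|lebesgue_on ?C. ?h p)"
  proof (rule integral_cong_AE)
    show "(\<lambda>p. (norm (P p - p))\<^sup>2) \<in> borel_measurable (lebesgue_on ?C)"
      using Pm idm by measurable
    show "?h \<in> borel_measurable (lebesgue_on ?C)"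
      using sets_on by (intro borel_measurable_sum borel_measurable_times borel_measurable_indicator) auto
    show "AE p in lebesgue_on ?C. (norm (P p - p))\<^sup>2 = ?h p"
      using AE_in_cubes[OF N]
    proof (rule AE_mp[OF _ AE_I2], intro impI)
      fix p :: "real^'n" assume "p \<in> (\<Union>x\<in>grid N. interior (cube N x))"
      then obtain x where x: "x \<in> grid N" "p \<in> interior (cube N x)" by blast
      have ind: "indicator (interior (cube N y)) p = (if y = x then 1 else 0 :: real)" for y
        using interior_cubes_disjoint[OF x(2) _ N, of y] x(2) by (cases "y = x") (auto simp: indicator_def)
      have "?h p = (\<Sum>y\<in>grid N. if y = x then (norm (offset N x (\<pi> x)))\<^sup>2 else 0)"
        unfolding ind by (intro sum.cong refl) simp
      also have "\<dots> = (norm (offset N x (\<pi> x)))\<^sup>2" using x(1) by (simp add: sum.delta)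
      finally show "(norm (P p - p))\<^sup>2 = ?h p" using \<pi>[OF x] by simp
    qed
  qed
  also have "\<dots> = (\<Sum>x\<in>grid N. measure (lebesgue_on ?C) (interior (cube N x)) * (norm (offset N x (\<pi> x)))\<^sup>2)"
    using sets_on fin by (subst Bochner_Integration.integral_sum) (auto simp: int_C intro!: sum.cong)
  also have "\<dots> = (\<Sum>x\<in>grid N. \<Sum>i\<in>UNIV. (real (\<pi> x i) - real (x i))\<^sup>2) / real N ^ (CARD('n) + 2)"
  proof -
    have "(norm (offset N x (\<pi> x)))\<^sup>2 = (\<Sum>i\<in>UNIV. (real (\<pi> x i) - real (x i))\<^sup>2) / (real N)\<^sup>2" for x
      unfolding power2_norm_eq_inner inner_vec_def offset_def
      by (simp add: power2_eq_square sum_divide_distrib)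
    then have "measure (lebesgue_on ?C) (interior (cube N x)) * (norm (offset N x (\<pi> x)))\<^sup>2
        = (\<Sum>i\<in>UNIV. (real (\<pi> x i) - real (x i))\<^sup>2) / (real N ^ CARD('n) * (real N)\<^sup>2)" if "x \<in> grid N" for x
      using meas_on[OF that] by simp
    then show ?thesis unfolding power_add by (simp add: sum_divide_distrib[symmetric])
  qed
  finally have eq: "(LINT p|lebesgue_on ?C. (norm (P p - p))\<^sup>2)
    = (\<Sum>x\<in>grid N. \<Sum>i\<in>UNIV. (real (\<pi> x i) - real (x i))\<^sup>2) / real N ^ (CARD('n) + 2)" .
  have "0 \<le> (\<Sum>x\<in>grid N. \<Sum>i\<in>UNIV. (real (\<pi> x i) - real (x i))\<^sup>2) / real N ^ (CARD('n) + 2)"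
    by (intro divide_nonneg_nonneg sum_nonneg) auto
  then show ?thesis unfolding L2_norm_cube_def eq by (rule real_sqrt_pow2)
qed

lemma cube_subset_cube:
  fixes x y :: "'n::finite \<Rightarrow> nat"
  assumes "N > 0" "b > 0" "N = M * b"
  shows "cube N x \<subseteq> cube M y \<longleftrightarrow> (\<forall>i. x i div b = y i)"
proof -
  have M: "M > 0" using assms by (cases M) auto
  have "cube N x \<subseteq> cube M y \<longleftrightarrow>
      (\<forall>i. real (y i) / M \<le> real (x i) / N \<and> real (x i + 1) / N \<le> real (y i + 1) / M)"
    unfolding cube_def grid_box_def by (subst subset_interval_cart) (auto simp: divide_right_mono)
  also have "\<dots> \<longleftrightarrow> (\<forall>i. x i div b = y i)"
  proof (intro all_cong1)
    fix i
    have scale: "real z / M = real (z * b) / N" for z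
      using M assms(2) by (simp add: assms(3))
    have "real (y i) / M \<le> real (x i) / N \<longleftrightarrow> real (y i * b) \<le> real (x i)"
      unfolding scale divide_le_cancel using assms(1) by auto
    moreover have "real (x i + 1) / N \<le> real (y i + 1) / M \<longleftrightarrow> real (x i + 1) \<le> real ((y i + 1) * b)"
      unfolding scale divide_le_cancel using assms(1) by auto
    moreover have "y i * b \<le> x i \<and> x i + 1 \<le> (y i + 1) * b \<longleftrightarrow> x i div b = y i"
    proof
      assume "y i * b \<le> x i \<and> x i + 1 \<le> (y i + 1) * b"
      then show "x i div b = y i" by (intro div_nat_eqI) (simp_all add: mult.commute)
    next
      assume "x i div b = y i"
      then show "y i * b \<le> x i \<and> x i + 1 \<le> (y i + 1) * b"
        using dividend_less_div_times[OF assms(2), of "x i"] div_times_less_eq_dividend[of "x i" b]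
        by (auto simp: add.commute)
    qed
    ultimately show "(real (y i) / M \<le> real (x i) / N \<and> real (x i + 1) / N \<le> real (y i + 1) / M)
        \<longleftrightarrow> x i div b = y i"
      by (simp only: of_nat_le_iff)
  qed
  finally show ?thesis .
qed

section \<open>The estimate\<close>

text \<open>A cube that crosses a wall in direction \<open>i\<close> either moves farther than
  \<open>T\<close> in that direction, which Chebyshev's inequality makes rare, or lies within
  \<open>T\<close> of a wall. The latter leaves at most \<open>2 * T\<close> of every
  \<open>b\<close> positions for one coordinate.\<close>

lemma card_displaced_across_walls:
  fixes \<pi> :: "('n::finite \<Rightarrow> nat) \<Rightarrow> 'n \<Rightarrow> nat" and T :: real
  assumes "b > 0" "N = K * b" "T > 0"
  shows "real (card {x\<in>grid N. \<exists>i. \<pi> x i div b \<noteq> x i div b})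
    \<le> CARD('n) * (2 * T / b * real N ^ CARD('n)) +
       (\<Sum>x\<in>grid N. \<Sum>i\<in>UNIV. (real (\<pi> x i) - real (x i))\<^sup>2) / T\<^sup>2"
proof -
  \<comment> \<open>Displacements are integers, so a bound by \<open>T\<close> is a bound by its
    floor.\<close>
  define t where "t = nat \<lfloor>T\<rfloor>"
  define far where "far i = {x\<in>grid N. T < \<bar>real (\<pi> x i) - real (x i)\<bar>}" for i
  define near where "near i = {x \<in> grid N. x i mod b < t \<or> b - t \<le> x i mod b}" for i :: 'n
  have "{x\<in>grid N. \<exists>i. \<pi> x i div b \<noteq> x i div b} \<subseteq> (\<Union>i\<in>UNIV. near i) \<union> (\<Union>i\<in>UNIV. far i)"
  proof
    fix x assume "x \<in> {x\<in>grid N. \<exists>i. \<pi> x i div b \<noteq> x i div b}"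
    then obtain i where x: "x \<in> grid N" "\<pi> x i div b \<noteq> x i div b" by blast
    show "x \<in> (\<Union>i\<in>UNIV. near i) \<union> (\<Union>i\<in>UNIV. far i)"
    proof (cases "x \<in> far i")
      case False
      then have "\<bar>real (\<pi> x i) - real (x i)\<bar> \<le> T" using x(1) by (simp add: far_def)
      then have "\<bar>int (\<pi> x i) - int (x i)\<bar> \<le> \<lfloor>T\<rfloor>" by (subst le_floor_iff) linarith
      then have "\<bar>real (\<pi> x i) - real (x i)\<bar> \<le> t" unfolding t_def by linarith
      from near_wall[OF x(2) this] show ?thesis using x(1) by (auto simp: near_def)
    qed blast
  qed
  then have "card {x\<in>grid N. \<exists>i. \<pi> x i div b \<noteq> x i div b} \<le> card ((\<Union>i\<in>UNIV. near i) \<union> (\<Union>i\<in>UNIV. far i))"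
    by (rule card_mono[rotated]) (simp add: near_def far_def)
  also have "\<dots> \<le> card (\<Union>i\<in>UNIV. near i) + card (\<Union>i\<in>UNIV. far i)" by (rule card_Un_le)
  also have "\<dots> \<le> (\<Sum>i\<in>UNIV. card (near i)) + (\<Sum>i\<in>UNIV. card (far i))"
    by (intro add_mono card_UN_le) auto
  finally have "real (card {x\<in>grid N. \<exists>i. \<pi> x i div b \<noteq> x i div b})
      \<le> (\<Sum>i\<in>UNIV. real (card (near i))) + (\<Sum>i\<in>UNIV. real (card (far i)))"
    by (simp flip: of_nat_sum of_nat_add)
  moreover have "real (card (near i)) \<le> 2 * T / b * real N ^ CARD('n)" for i
  proof -
    let ?B = "{y. y < N \<and> (y mod b < t \<or> b - t \<le> y mod b)}"
    have "near i = PiE UNIV (\<lambda>j. if j = i then ?B else {..<N})"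
      by (auto simp: near_def grid_def PiE_def Pi_def split: if_splits)
    then have "card (near i) = (\<Prod>j\<in>UNIV. card (if j = i then ?B else {..<N}))"
      by (simp add: card_PiE)
    also have "\<dots> = card ?B * (\<Prod>j\<in>UNIV - {i}. card (if j = i then ?B else {..<N}))"
      by (subst prod.remove[of _ i]) auto
    also have "(\<Prod>j\<in>UNIV - {i}. card (if j = i then ?B else {..<N})) = (\<Prod>j\<in>UNIV - {i}. N)"
      by (rule prod.cong) auto
    also have "\<dots> = N ^ (CARD('n) - 1)" by (simp add: card_Diff_singleton)
    finally have "card (near i) \<le> K * (2 * t) * N ^ (CARD('n) - 1)"
      using card_near_walls[OF assms(2), of t] by (simp add: mult_right_mono)
    then have "real (card (near i)) \<le> real (K * (2 * t) * N ^ (CARD('n) - 1))" by (rule of_nat_mono)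
    also have "\<dots> \<le> K * (2 * T) * real N ^ (CARD('n) - 1)"
    proof -
      have "real t \<le> T" using assms(3) by (simp add: t_def of_nat_floor)
      then show ?thesis by (simp add: mult_left_mono mult_right_mono)
    qed
    also have "\<dots> = 2 * T / b * (real N * real N ^ (CARD('n) - 1))"
      using assms(1) by (simp add: assms(2))
    also have "real N * real N ^ (CARD('n) - 1) = real N ^ CARD('n)"
      by (simp flip: power_Suc)
    finally show ?thesis .
  qed
  then have "(\<Sum>i\<in>UNIV. real (card (near i))) \<le> (\<Sum>i\<in>(UNIV::'n set). 2 * T / b * real N ^ CARD('n))"
    by (rule sum_mono)
  moreover have "(\<Sum>i\<in>UNIV. real (card (far i)))
      \<le> (\<Sum>x\<in>grid N. \<Sum>i\<in>UNIV. (real (\<pi> x i) - real (x i))\<^sup>2) / T\<^sup>2"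
  proof -
    have "real (card (far i)) \<le> (\<Sum>x\<in>grid N. (real (\<pi> x i) - real (x i))\<^sup>2 / T\<^sup>2)" for i
    proof -
      have "real (card (far i)) = (\<Sum>x\<in>far i. 1)" by simp
      also have "\<dots> \<le> (\<Sum>x\<in>far i. (real (\<pi> x i) - real (x i))\<^sup>2 / T\<^sup>2)"
      proof (rule sum_mono)
        fix x assume "x \<in> far i"
        then have "T\<^sup>2 \<le> \<bar>real (\<pi> x i) - real (x i)\<bar>\<^sup>2"
          using assms(3) by (intro power_mono) (auto simp: far_def)
        then show "1 \<le> (real (\<pi> x i) - real (x i))\<^sup>2 / T\<^sup>2" using assms(3) by simp
      qed
      also have "\<dots> \<le> (\<Sum>x\<in>grid N. (real (\<pi> x i) - real (x i))\<^sup>2 / T\<^sup>2)"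
        by (rule sum_mono2) (auto simp: far_def)
      finally show ?thesis .
    qed
    then have "(\<Sum>i\<in>UNIV. real (card (far i)))
        \<le> (\<Sum>i\<in>UNIV. \<Sum>x\<in>grid N. (real (\<pi> x i) - real (x i))\<^sup>2 / T\<^sup>2)"
      by (rule sum_mono)
    then show ?thesis by (subst (asm) sum.swap) (simp add: sum_divide_distrib)
  qed
  ultimately show ?thesis by simp
qed

text \<open>Cauchy-Schwarz over all pairs of a grid point and a direction, whose number is the
  factor in front.\<close>

lemma sum_abs_le_sqrt_sum_squares:
  fixes \<pi> :: "('n::finite \<Rightarrow> nat) \<Rightarrow> 'n \<Rightarrow> nat"
  shows "(\<Sum>x\<in>grid N. \<Sum>i\<in>UNIV. \<bar>real (\<pi> x i) - real (x i)\<bar>)\<^sup>2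
    \<le> CARD('n) * real N ^ CARD('n) * (\<Sum>x\<in>grid N. \<Sum>i\<in>UNIV. (real (\<pi> x i) - real (x i))\<^sup>2)"
proof -
  let ?I = "grid N \<times> (UNIV :: 'n set)" and ?d = "\<lambda>(x, i). \<bar>real (\<pi> x i) - real (x i)\<bar>"
  from Cauchy_Schwarz_ineq_sum[of "\<lambda>_. 1" ?d ?I] show ?thesis
    by (simp add: sum.cartesian_product case_prod_beta card_cartesian_product card_grid mult.commute)
qed

text \<open>Dividing counts by \<open>N ^ \<nu>\<close> gives volume fractions \<open>v\<close> and
  \<open>w\<close>, and all powers of \<open>N\<close> cancel against the unit of cost. In the
  constant, \<nu> comes from the bound on \<open>sqrt v\<close>, and 4\<nu> is \<nu> + 3\<nu> from
  \<open>v\<close> and \<open>w\<close> in the second sorting.\<close>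

lemma final_estimate:
  fixes \<delta> \<epsilon> N b V W S2 :: real and \<nu> :: nat
  assumes \<nu>: "\<nu> \<ge> 1" and \<epsilon>: "0 < \<epsilon>" "\<epsilon> < 1" and \<delta>: "0 < \<delta>" "\<delta> \<le> 1"
    and N: "N > 0" and b: "b = \<delta> powr \<epsilon> * N"
    and S2: "0 \<le> S2" "S2 \<le> (\<delta> powr (1 - \<epsilon> / 2))\<^sup>2 * N ^ (\<nu> + 2)"
    and V: "0 \<le> V" "(b * V)\<^sup>2 \<le> \<nu> * N ^ \<nu> * S2"
    and W: "0 \<le> W" "W \<le> \<nu> * (2 * (N * \<delta> powr (2/3)) / b * N ^ \<nu>) + S2 / (N * \<delta> powr (2/3))\<^sup>2"
  shows "24 * (real \<nu>)^2 * (N * sqrt V + 2 ^ \<nu> * b * sqrt (V + W)) * N powr (- 1 - \<nu> / 2)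
    \<le> 24 * (real \<nu>)^2 * (real \<nu> + 2 ^ \<nu> * (4 * real \<nu>)) * max (\<delta> powr (1/2 - 3 * \<epsilon> / 4)) (\<delta> powr (1/6 + 7 * \<epsilon> / 12))"
proof -
  have \<nu>1: "real \<nu> \<ge> 1" using \<nu> by simp
  define v where "v = V / N ^ \<nu>"
  define w where "w = W / N ^ \<nu>"
  have vw: "V = v * N ^ \<nu>" "W = w * N ^ \<nu>" "0 \<le> v" "0 \<le> w"
    using N V(1) W(1) by (simp_all add: v_def w_def)
  have sq: "(\<delta> powr a)\<^sup>2 = \<delta> powr (2 * a)" for a
    by (simp add: power2_eq_square flip: powr_add)
  have S2': "S2 \<le> \<delta> powr (2 - \<epsilon>) * (N ^ \<nu> * N\<^sup>2)"
    using S2(2) unfolding power_add sq by (simp add: algebra_simps)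
  have v_le: "v \<le> \<nu>\<^sup>2 * \<delta> powr (1 - 3 * \<epsilon> / 2)"
  proof -
    have "(b * V)\<^sup>2 \<le> \<nu> * N ^ \<nu> * (\<delta> powr (2 - \<epsilon>) * (N ^ \<nu> * N\<^sup>2))"
      using V(2) S2' N by (elim order_trans) (intro mult_left_mono, auto)
    also have "\<dots> = \<nu> * \<delta> powr (2 - \<epsilon>) * (N ^ \<nu> * N)\<^sup>2" by (simp add: power2_eq_square mult_ac)
    finally have "(\<delta> powr \<epsilon> * v)\<^sup>2 * (N ^ \<nu> * N)\<^sup>2 \<le> \<nu> * \<delta> powr (2 - \<epsilon>) * (N ^ \<nu> * N)\<^sup>2"
      by (simp add: b vw(1) power2_eq_square mult_ac)
    then have "(\<delta> powr \<epsilon> * v)\<^sup>2 \<le> \<nu> * \<delta> powr (2 - \<epsilon>)"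
      using N by (simp add: mult_le_cancel_right)
    \<comment> \<open>Enlarging \<nu> to its fourth power leaves the plain factor \<nu> after the
      two square roots to come.\<close>
    also have "\<dots> \<le> (\<nu>\<^sup>2)\<^sup>2 * \<delta> powr (2 - \<epsilon>)"
    proof -
      have "real \<nu> ^ 1 \<le> real \<nu> ^ 4" using \<nu>1 by (intro power_increasing) auto
      then show ?thesis by (simp add: mult_right_mono)
    qed
    also have "\<dots> = (\<nu>\<^sup>2 * \<delta> powr (1 - \<epsilon> / 2))\<^sup>2" by (simp add: power_mult_distrib sq algebra_simps)
    finally have "\<delta> powr \<epsilon> * v \<le> \<nu>\<^sup>2 * \<delta> powr (1 - \<epsilon> / 2)" by (rule power2_le_imp_le) simp
    also have "\<dots> = \<delta> powr \<epsilon> * (\<nu>\<^sup>2 * \<delta> powr (1 - 3 * \<epsilon> / 2))"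
      by (simp add: mult_ac flip: powr_add)
    finally show ?thesis using \<delta> by simp
  qed
  have w_le: "w \<le> (3 * real \<nu>)\<^sup>2 * \<delta> powr (2/3 - \<epsilon>)"
  proof -
    have near: "2 * (N * \<delta> powr (2/3)) / b = 2 * \<delta> powr (2/3 - \<epsilon>)"
      using N \<delta> by (simp add: b powr_diff)
    have "S2 / (N * \<delta> powr (2/3))\<^sup>2 \<le> \<delta> powr (2 - \<epsilon>) * (N ^ \<nu> * N\<^sup>2) / (N * \<delta> powr (2/3))\<^sup>2"
      using S2' by (rule divide_right_mono) simp
    moreover have "\<delta> powr (2 - \<epsilon>) * (N ^ \<nu> * N\<^sup>2) / (N * \<delta> powr (2/3))\<^sup>2 = \<delta> powr (2/3 - \<epsilon>) * N ^ \<nu>"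
    proof -
      have "\<delta> powr (2 - \<epsilon>) = \<delta> powr (2/3 - \<epsilon>) * (\<delta> powr (2/3))\<^sup>2"
        by (simp add: sq flip: powr_add)
      then show ?thesis using N \<delta> by (simp add: power_mult_distrib)
    qed
    ultimately have "W \<le> \<nu> * (2 * \<delta> powr (2/3 - \<epsilon>) * N ^ \<nu>) + \<delta> powr (2/3 - \<epsilon>) * N ^ \<nu>"
      using W(2) unfolding near by linarith
    also have "\<dots> = (2 * real \<nu> + 1) * \<delta> powr (2/3 - \<epsilon>) * N ^ \<nu>" by (simp add: algebra_simps)
    finally have "w \<le> (2 * real \<nu> + 1) * \<delta> powr (2/3 - \<epsilon>)" using N by (simp add: w_def divide_le_eq)
    also have "\<dots> \<le> (3 * real \<nu>)\<^sup>2 * \<delta> powr (2/3 - \<epsilon>)"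
    proof (rule mult_right_mono)
      have "\<nu> \<le> \<nu> * \<nu>" by simp
      then have "real \<nu> \<le> real \<nu> * real \<nu>" by (simp only: of_nat_mult[symmetric] of_nat_le_iff)
      then have "real (2 * \<nu> + 1) \<le> 9 * (real \<nu> * real \<nu>)" using \<nu>1 by linarith
      then show "2 * real \<nu> + 1 \<le> (3 * real \<nu>)\<^sup>2" by (simp add: power2_eq_square)
    qed simp
    finally show ?thesis .
  qed
  define m where "m = max (\<delta> powr (1/2 - 3 * \<epsilon> / 4)) (\<delta> powr (1/6 + 7 * \<epsilon> / 12))"
  have sqv: "sqrt v \<le> \<nu> * \<delta> powr (1/2 - 3 * \<epsilon> / 4)"
  proof -
    have "sqrt v \<le> sqrt ((\<nu> * \<delta> powr (1/2 - 3 * \<epsilon> / 4))\<^sup>2)"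
      using v_le by (intro real_sqrt_le_mono) (simp add: power_mult_distrib sq algebra_simps)
    then show ?thesis by simp
  qed
  have sqw: "sqrt w \<le> 3 * \<nu> * \<delta> powr (1/3 - \<epsilon> / 2)"
  proof -
    have "sqrt w \<le> sqrt ((3 * \<nu> * \<delta> powr (1/3 - \<epsilon> / 2))\<^sup>2)"
      using w_le by (intro real_sqrt_le_mono) (simp add: power_mult_distrib sq algebra_simps)
    then show ?thesis by simp
  qed
  have v_m: "sqrt v \<le> \<nu> * m" using sqv \<nu>1 by (elim order_trans) (auto simp: m_def)
  \<comment> \<open>Only the term with \<open>w\<close> needs the gain from working inside the
    cells; for \<open>v\<close> the factor is simply bounded by 1.\<close>
  have "\<delta> powr \<epsilon> * sqrt (v + w) \<le> \<delta> powr \<epsilon> * (sqrt v + sqrt w)"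
    using vw(3,4) by (intro mult_left_mono sqrt_add_le_add_sqrt) auto
  also have "\<dots> \<le> \<nu> * m + 3 * \<nu> * m"
  proof -
    have "\<delta> powr \<epsilon> * sqrt v \<le> 1 * sqrt v"
      using \<delta> \<epsilon> vw(3) by (intro mult_right_mono powr_le1) auto
    moreover have "\<delta> powr \<epsilon> * sqrt w \<le> 3 * \<nu> * m"
    proof -
      have "\<delta> powr \<epsilon> * sqrt w \<le> \<delta> powr \<epsilon> * (3 * \<nu> * \<delta> powr (1/3 - \<epsilon> / 2))"
        using sqw by (rule mult_left_mono) simp
      also have "\<dots> = 3 * \<nu> * \<delta> powr (1/3 + \<epsilon> / 2)" by (simp add: ac_simps flip: powr_add)
      \<comment> \<open>The exponents differ by 1/6 - \<epsilon>/12, which is positive, and \<delta>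
        \<le> 1.\<close>
      also have "\<dots> \<le> 3 * \<nu> * \<delta> powr (1/6 + 7 * \<epsilon> / 12)"
        using \<delta> \<epsilon> by (intro mult_left_mono powr_mono') auto
      also have "\<dots> \<le> 3 * \<nu> * m" by (intro mult_left_mono) (auto simp: m_def)
      finally show ?thesis .
    qed
    ultimately show ?thesis using v_m unfolding distrib_left by linarith
  qed
  finally have vw_m: "\<delta> powr \<epsilon> * sqrt (v + w) \<le> 4 * \<nu> * m" by (simp add: mult_ac)
  have scale: "N * sqrt (N ^ \<nu>) * N powr (- 1 - \<nu> / 2) = 1"
  proof -
    have "sqrt (N ^ \<nu>) = N powr (\<nu> / 2)"
      using N by (simp add: powr_half_sqrt[symmetric] powr_realpow[symmetric] powr_powr)
    then have "N * sqrt (N ^ \<nu>) * N powr (- 1 - \<nu> / 2) = N powr 1 * N powr (\<nu> / 2) * N powr (- 1 - \<nu> / 2)"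
      using N by simp
    also have "\<dots> = N powr (1 + \<nu> / 2 + (- 1 - \<nu> / 2))" by (simp only: powr_add)
    finally show ?thesis using N by simp
  qed
  have "V + W = (v + w) * N ^ \<nu>" by (simp only: vw(1,2) distrib_right)
  then have sqrt_eq: "sqrt (V + W) = sqrt (v + w) * sqrt (N ^ \<nu>)" "sqrt V = sqrt v * sqrt (N ^ \<nu>)"
    by (simp_all only: vw(1) real_sqrt_mult)
  have "N * sqrt V + 2 ^ \<nu> * b * sqrt (V + W) = (sqrt v + 2 ^ \<nu> * (\<delta> powr \<epsilon> * sqrt (v + w))) * (N * sqrt (N ^ \<nu>))"
    unfolding sqrt_eq b by (simp add: algebra_simps)
  then have "24 * \<nu>^2 * (N * sqrt V + 2 ^ \<nu> * b * sqrt (V + W)) * N powr (- 1 - \<nu> / 2)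
      = 24 * \<nu>^2 * (sqrt v + 2 ^ \<nu> * (\<delta> powr \<epsilon> * sqrt (v + w))) * (N * sqrt (N ^ \<nu>) * N powr (- 1 - \<nu> / 2))"
    by (simp add: mult_ac)
  also have "\<dots> = 24 * \<nu>^2 * (sqrt v + 2 ^ \<nu> * (\<delta> powr \<epsilon> * sqrt (v + w)))" unfolding scale by simp
  also have "\<dots> \<le> 24 * \<nu>^2 * (\<nu> * m + 2 ^ \<nu> * (4 * \<nu> * m))"
    using v_m vw_m by (intro mult_left_mono add_mono) auto
  finally show ?thesis by (simp add: m_def algebra_simps)
qed

theorem theorem1p10:
  assumes "CARD('n::finite) \<ge> 2"
  shows "\<exists>\<delta>\<^sub>0 C :: real. 0 < \<delta>\<^sub>0 \<and> \<delta>\<^sub>0 < 1 \<and> 0 < C \<and>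
    (\<forall>(\<epsilon>::real) (\<delta>::real) (N::nat) (n::nat) (m::nat) (P :: real^'n \<Rightarrow> real^'n).
       0 < \<epsilon> \<longrightarrow> \<epsilon> < 2 / (2 + real CARD('n)) \<longrightarrow>
       0 < \<delta> \<longrightarrow> \<delta> \<le> \<delta>\<^sub>0 \<longrightarrow>
       N = 2 ^ n \<longrightarrow> m \<le> n \<longrightarrow> \<delta> powr \<epsilon> * real N = 2 ^ m \<longrightarrow>
       P \<in> permutations_of_tiling N \<longrightarrow>
       L2_norm_cube (\<lambda>x. P x - x) \<le> \<delta> powr (1 - \<epsilon> / 2) \<longrightarrow>
       (\<forall>\<kappa>\<in>tiling N. displacement P \<kappa> \<le> \<delta> powr \<epsilon>) \<longrightarrow>
       (\<exists>P'\<in>permutations_of_tiling N.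
          constant_on_tiling N (nat \<lfloor>\<delta> powr (- \<epsilon>)\<rfloor>) P' \<and>
          (\<exists>F. discrete_flow N F \<and> flow_connects F P P' \<and>
             flow_length N F \<le>
               C * max (\<delta> powr (1 / 2 - 3 * \<epsilon> / 4)) (\<delta> powr (1 / 6 + 7 * \<epsilon> / 12)))))"
proof -
  define C where "C = 24 * (real CARD('n))^2 * (real CARD('n) + 2 ^ CARD('n) * (4 * real CARD('n)))"
  have C: "C > 0" by (simp add: C_def add_pos_pos)
  have main: "\<exists>P'\<in>permutations_of_tiling N.
          constant_on_tiling N (nat \<lfloor>\<delta> powr (- \<epsilon>)\<rfloor>) P' \<and>
          (\<exists>F. discrete_flow N F \<and> flow_connects F P P' \<and>
             flow_length N F \<le>
               C * max (\<delta> powr (1 / 2 - 3 * \<epsilon> / 4)) (\<delta> powr (1 / 6 + 7 * \<epsilon> / 12)))"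
    if \<epsilon>: "0 < \<epsilon>" "\<epsilon> < 1" and \<delta>: "0 < \<delta>" "\<delta> \<le> 1" and N_def: "N = 2 ^ n" and mn: "m \<le> n"
      and b_eq: "\<delta> powr \<epsilon> * real N = 2 ^ m" and P: "P \<in> permutations_of_tiling N"
      and L2: "L2_norm_cube (\<lambda>x. P x - x) \<le> \<delta> powr (1 - \<epsilon> / 2)"
    for \<epsilon> \<delta> :: real and N n m :: nat and P :: "real^'n \<Rightarrow> real^'n"
  proof -
    define b where "b = (2::nat) ^ m"
    define M where "M = (2::nat) ^ (n - m)"
    have N: "N > 0" and b: "b > 0" by (simp_all add: N_def b_def)
    have NMb: "N = M * b" using mn by (simp add: N_def M_def b_def flip: power_add)
    have b_real: "real b = \<delta> powr \<epsilon> * real N" using b_eq by (simp add: b_def)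
    have "\<delta> powr (- \<epsilon>) = real M"
    proof -
      have "real M * real b = real N" by (simp add: NMb)
      then have "\<delta> powr \<epsilon> * real M = 1" using b N unfolding b_real by (simp add: mult_ac)
      then show ?thesis by (simp add: powr_minus inverse_unique)
    qed
    \<comment> \<open>The quotient is exactly the integer \<open>2 ^ (n - m)\<close>, so the floor
      changes nothing.\<close>
    then have M: "nat \<lfloor>\<delta> powr (- \<epsilon>)\<rfloor> = M" by simp
    obtain \<pi> where \<pi>: "bij_betw \<pi> (grid N) (grid N)"
        "\<And>x p. x \<in> grid N \<Longrightarrow> p \<in> interior (cube N x) \<Longrightarrow> P p = p + offset N x (\<pi> x)"
      by (rule induced_permutation[OF N P]) (rule that)
    define S1 where "S1 = (\<Sum>x\<in>grid N. \<Sum>i\<in>UNIV. \<bar>real (\<pi> x i) - real (x i)\<bar>)"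
    define S2 where "S2 = (\<Sum>x\<in>grid N. \<Sum>i\<in>UNIV. (real (\<pi> x i) - real (x i))\<^sup>2)"
    define W where "W = card {x\<in>grid N. \<exists>i. \<pi> x i div b \<noteq> x i div b}"
    obtain \<tau> V where \<tau>: "bij_betw \<tau> (grid N) (grid N)"
        "\<And>x i. x \<in> grid N \<Longrightarrow> \<tau> (\<pi> x) i div b = x i div b"
        "real b * real V \<le> S1"
        "realizable N \<tau> (24 * (real CARD('n))\<^sup>2 * (real N * sqrt (real V) + 2 ^ CARD('n) * real b *
           sqrt (real V + real W)))"
      using realizable_sorting[OF mn \<pi>(1)[unfolded N_def]] unfolding N_def b_def S1_def W_def by blast
    \<comment> \<open>For a threshold \<open>N * \<delta> powr a\<close> the volume near walls is of
      order \<delta> to the power a - \<epsilon>, and the far volume of order \<delta> to the power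
      2 - \<epsilon> - 2a. They balance at a = 2/3.\<close>
    define T where "T = real N * \<delta> powr (2/3)"
    have T: "T > 0" using N \<delta> by (simp add: T_def)
    have estimate: "24 * (real CARD('n))\<^sup>2 * (real N * sqrt V + 2 ^ CARD('n) * real b * sqrt (real V + real W))
        * real N powr (- 1 - real CARD('n) / 2)
      \<le> C * max (\<delta> powr (1/2 - 3 * \<epsilon> / 4)) (\<delta> powr (1/6 + 7 * \<epsilon> / 12))"
      unfolding C_def
    proof (rule final_estimate[where ?S2.0=S2])
      show "1 \<le> CARD('n)" using assms by simp
      show "0 < real N" using N by simp
      show "0 \<le> S2" unfolding S2_def by (intro sum_nonneg) auto
      have "0 \<le> L2_norm_cube (\<lambda>x. P x - x)" by (simp add: L2_norm_cube_def)
      then have "S2 / real N ^ (CARD('n) + 2) \<le> (\<delta> powr (1 - \<epsilon> / 2))\<^sup>2"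
        unfolding S2_def using L2 power_mono[of "L2_norm_cube (\<lambda>x. P x - x)" _ 2]
          L2_norm_displacement[OF N P \<pi>(2)] by simp
      then show "S2 \<le> (\<delta> powr (1 - \<epsilon> / 2))\<^sup>2 * real N ^ (CARD('n) + 2)"
        using N by (simp add: pos_divide_le_eq del: power_add)
      have "(real b * real V)\<^sup>2 \<le> S1\<^sup>2" using \<tau>(3) by (intro power_mono) auto
      also have "\<dots> \<le> CARD('n) * real N ^ CARD('n) * S2"
        unfolding S1_def S2_def by (rule sum_abs_le_sqrt_sum_squares)
      finally show "(real b * real V)\<^sup>2 \<le> CARD('n) * real N ^ CARD('n) * S2" .
      show "real W \<le> CARD('n) * (2 * (real N * \<delta> powr (2/3)) / real b * real N ^ CARD('n))
          + S2 / (real N * \<delta> powr (2/3))\<^sup>2"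
        using card_displaced_across_walls[OF b NMb T, of \<pi>] unfolding W_def S2_def T_def .
    qed (use \<epsilon> \<delta> b_real in auto)
    obtain F where F: "discrete_flow N F"
        "flow_length N F \<le> 24 * (real CARD('n))\<^sup>2 * (real N * sqrt (real V) + 2 ^ CARD('n) * real b *
           sqrt (real V + real W)) * real N powr (- 1 - real CARD('n) / 2)"
        "\<And>x p. x \<in> grid N \<Longrightarrow> p \<in> interior (cube N x) \<Longrightarrow> fold (\<lambda>(D, Z) y. Z y) F p = p + offset N x (\<tau> x)"
      using \<tau>(4) unfolding realizable_def by blast
    define P' where "P' = cell_map N (\<tau> \<circ> \<pi>)"
    have bij: "bij_betw (\<tau> \<circ> \<pi>) (grid N) (grid N)" by (rule bij_betw_trans[OF \<pi>(1) \<tau>(1)])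
    have P': "P' \<in> permutations_of_tiling N" unfolding P'_def by (rule cell_map_permutation[OF N bij])
    have const: "constant_on_tiling N M P'"
      unfolding constant_on_tiling_def tiling_eq
    proof (intro ballI impI, elim imageE)
      fix K \<kappa> :: "(real^'n) set" and x y
      assume K: "\<kappa> \<subseteq> K" "K = cube M y" "\<kappa> = cube N x" "x \<in> grid N"
      then have "\<forall>i. x i div b = y i" using cube_subset_cube[OF N b NMb] by blast
      then have "\<forall>i. \<tau> (\<pi> x) i div b = y i" using \<tau>(2)[OF K(4)] by simp
      then have "cube N (\<tau> (\<pi> x)) \<subseteq> cube M y" using cube_subset_cube[OF N b NMb] by blast
      then show "cube_image P' \<kappa> \<subseteq> K"
        unfolding K P'_def using cube_image_cell_map[OF N K(4), of "\<tau> \<circ> \<pi>"] by simp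
    qed
    have "flow_connects F P P'"
      unfolding flow_connects_def
    proof (rule AE_mp[OF AE_in_cubes[OF N] AE_I2], intro impI)
      fix p :: "real^'n" assume "p \<in> (\<Union>x\<in>grid N. interior (cube N x))"
      then obtain x where x: "x \<in> grid N" "p \<in> interior (cube N x)" by blast
      have "\<pi> x \<in> grid N" using \<pi>(1) x(1) by (rule bij_betw_apply)
      moreover have "P p \<in> interior (cube N (\<pi> x))" using x \<pi>(2) by (simp add: add_offset_interior)
      ultimately have "fold (\<lambda>(D, Z) y. Z y) F (P p) = P p + offset N (\<pi> x) (\<tau> (\<pi> x))" by (rule F(3))
      also have "\<dots> = p + offset N x (\<tau> (\<pi> x))" using \<pi>(2)[OF x] by (simp add: add.assoc offset_add)
      also have "\<dots> = P' p" unfolding P'_def using cell_map_interior[OF N x, of "\<tau> \<circ> \<pi>"] by simp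
      finally show "fold (\<lambda>(D, Z) y. Z y) F (P p) = P' p" .
    qed
    with F(1) order_trans[OF F(2) estimate] P' const show ?thesis unfolding M by blast
  qed
  have small: "2 / (2 + real CARD('n)) \<le> 1" by simp
  show ?thesis
  \<comment> \<open>The estimates in \<open>main\<close> are valid up to \<delta> = 1, so 1/2 is an
    arbitrary choice in (0,1).\<close>
  proof (rule exI[of _ "1/2"], rule exI[of _ C], intro conjI allI impI)
    fix \<epsilon> \<delta> :: real and N n m :: nat and P :: "real^'n \<Rightarrow> real^'n"
    assume "\<epsilon> < 2 / (2 + real CARD('n))"
    then have "\<epsilon> < 1" using small by linarith
    moreover assume "0 < \<epsilon>" "0 < \<delta>" "\<delta> \<le> 1 / 2" "N = 2 ^ n" "m \<le> n"
      "\<delta> powr \<epsilon> * real N = 2 ^ m" "P \<in> permutations_of_tiling N"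
      "L2_norm_cube (\<lambda>x. P x - x) \<le> \<delta> powr (1 - \<epsilon> / 2)"
    ultimately show "\<exists>P'\<in>permutations_of_tiling N.
          constant_on_tiling N (nat \<lfloor>\<delta> powr (- \<epsilon>)\<rfloor>) P' \<and>
          (\<exists>F. discrete_flow N F \<and> flow_connects F P P' \<and>
             flow_length N F \<le>
               C * max (\<delta> powr (1 / 2 - 3 * \<epsilon> / 4)) (\<delta> powr (1 / 6 + 7 * \<epsilon> / 12)))"
      by (intro main) auto
  qed (use C in auto)
qed

end
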